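(* Let $\ell=2$ and fix a $2$-charge $\mathbf r\in\mathbb Z^2$. All core blocks (of Ariki–Koike algebras with $2$-charge $\mathbf r$) in a single $\mathbf W_e$-orbit are Scopes equivalent. Equivalently, all core blocks with the same moving vector (with respect to any $\mathbf r'\in\mathbf r^{\widehat{\mathbf W}_2}\cap\overline{\mathcal A}_e^{2}$) are Scopes equivalent.
   Context: Throughout $e\ge 2$ is a fixed integer and $\ell$ is a positive integer (in the claim $\ell=2$). $[a,b]$ is the set of integers $x$ with $a\le x\le b$; $\mathbb Z/m\mathbb Z$ is identified with $[0,m-1]$; $\mathbf x^{\sigma}=(x_{\sigma(1)},\dots,x_{\sigma(m)})$ for an $m$-tuple $\mathbf x$ and $\sigma\in\mathfrak S_m$ (permutations composed right to left). $\beta$-sets. A $\beta$-set is a subset $\mathsf B\subseteq\mathbb Z$ such that $\max(\mathsf B)$ and $\min(\mathbb Z\setminus\mathsf B)$ exist; its charge is $\mathrm{ch}(\mathsf B)=|\mathsf B\cap\mathbb Z_{\ge0}|-|\mathbb Z_{<0}\setminus\mathsf B|$. Let $\mathcal P$ be the set of partitions and $\beta_t(\lambda)=\{\lambda_i+t-i\mid i\ge1\}$; $(\lambda,t)\mapsto\beta_t(\lambda)$ is a bijection from $\mathcal P\times\mathbb Z$ to $\beta$-sets, with $\mathrm{ch}(\beta_t(\lambda))=t$; $\beta^{-1}(\mathsf B)$ denotes the partition $\lambda$ with $\beta_{\mathrm{ch}(\mathsf B)}(\lambda)=\mathsf B$. The $e$-quotient is $\mathrm{quot}_e(\mathsf B)=(\mathsf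 B_1,\dots,\mathsf B_e)$ with $\mathsf B_{i+1}=\{a\in\mathbb Z\mid ae+i\in\mathsf B\}$ ($0\le i<e$). The $e$-core $\mathrm{core}_e(\mathsf B)$ is the $\beta$-set with $e$-quotient $(\mathbb Z_{<\mathrm{ch}(\mathsf B_1)},\dots,\mathbb Z_{<\mathrm{ch}(\mathsf B_e)})$ and $\mathrm{wt}_e(\mathsf B)=\sum_{i=1}^e|\beta^{-1}(\mathsf B_i)|$. For a partition, $\mathrm{wt}_e(\lambda)=\mathrm{wt}_e(\beta_t(\lambda))$ (independent of $t$). Multipartitions. For $\boldsymbol\lambda\in\mathcal P^\ell$ and $\mathbf t\in\mathbb Z^\ell$ put $\beta_{\mathbf t}(\boldsymbol\lambda)=(\beta_{t_1}(\lambda^{(1)}),\dots,\beta_{t_\ell}(\lambda^{(\ell)}))$; $\mathcal P^\ell(n)$ is the set of $\boldsymbol\lambda\in\mathcal P^\ell$ of total size $n$. Nodes of $\boldsymbol\lambda$ are triples $(a,b,i)$ of positive integers with $b\le\lambda^{(i)}_a$; addable and removable nodes are as usual; the $(m,\mathbf t)$-residue of $(a,b,i)$ is $b-a+t_i$ mod $m$ (likewise for $e$-partitions). Uglov map. $\upsilon_i(ae+b)=ae\ell+(\ell-i)e+b$ for $a\in\mathbb Z$, $0\le b<e$, $i\in[1,\ell]$; $\mathbf U(\mathsf B^{(1)},\dots,\mathsf B^{(\ell)})=\bigcup_{i=1}^{\ell}\upsilon_i(\mathsf B^{(i)})$. Put $\mathrm{core}_e(\boldsymbol\lambda;\mathbf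 t)=\mathrm{core}_e(\mathbf U(\beta_{\mathbf t}(\boldsymbol\lambda)))$, $\mathrm{wt}_e(\boldsymbol\lambda;\mathbf t)=\mathrm{wt}_e(\mathbf U(\beta_{\mathbf t}(\boldsymbol\lambda)))$. The $e$-moving vector is $\mathbf{mv}_e(\boldsymbol\lambda;\mathbf t)=(C_{\ell-1},\dots,C_0)$, where $(\boldsymbol\mu;\mathbf u)\in\mathcal P^e\times\mathbb Z^e$ is defined by $\mathrm{quot}_e(\mathbf U(\beta_{\mathbf t}(\boldsymbol\lambda)))=\beta_{\mathbf u}(\boldsymbol\mu)$ and $C_i$ is the number of nodes of $\boldsymbol\mu$ with $(\ell,\mathbf u)$-residue $i$. Group actions. $\widehat{\mathbf W}_m=\mathfrak S_m\ltimes\mathbb Z^m$ with $(\sigma\mathbf t)(\tau\mathbf u)=(\sigma\tau)(\mathbf t^\tau+\mathbf u)$. $\widehat{\mathbf W}_\ell$ acts on the right by $\mathbf t^{\sigma\mathbf u}=\mathbf t^\sigma+e\mathbf u$, $\boldsymbol\lambda^{\sigma\mathbf u}=\boldsymbol\lambda^\sigma$, $(\boldsymbol\lambda;\mathbf t)^w=(\boldsymbol\lambda^w;\mathbf t^w)$. $\overline{\mathcal A}_e^{\ell}=\{\mathbf a\in\mathbb Z^\ell\mid a_1\le\dots\le a_\ell\le a_1+e\}$. $\mathbf W_e$ is the affine Weyl group of type $\widetilde A_{e-1}$ with Coxeter generators $s_0,\dots,s_{e-1}$. Algebras. $\mathbb F$ is a field of characteristic $p\ge0$; $q\in\mathbb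 F$ with $q=1$ if $e=p$, and $q$ a primitive $e$-th root of unity otherwise; $\mathbf r\in\mathbb Z^\ell$. $\mathcal H_n=\mathcal H_{\mathbb F,q,\mathbf r}(n)$ is the unital $\mathbb F$-algebra with generators $T_0,\dots,T_{n-1}$ and relations $\prod_{i=1}^\ell(T_0-q^{r_i})=0$, $(T_a-q)(T_a+1)=0$ ($a\ge1$), $T_0T_1T_0T_1=T_1T_0T_1T_0$, $T_aT_{a+1}T_a=T_{a+1}T_aT_{a+1}$ ($a\ge1$), $T_aT_b=T_bT_a$ ($|a-b|\ge2$), with $\mathcal H_0=\mathbb F$; for $e=p$ it is read as the degenerate cyclotomic Hecke algebra, i.e. the quotient of the degenerate affine Hecke algebra of $\mathfrak S_n$ by $\prod_i(x_1-r_i)$. $\boldsymbol\lambda\in\mathcal P^\ell(n)$ lies in a block $B$ if its Specht module does. Known: $\boldsymbol\lambda,\boldsymbol\mu$ lie in the same block iff the partitions $\beta^{-1}(\mathrm{core}_e((\cdot;\mathbf r)^w))$ and the weights $\mathrm{wt}_e((\cdot;\mathbf r)^w)$ agree, for any $w$ with $\mathbf r^w\in\overline{\mathcal A}_e^\ell$ (independent of such $w$). For $\mathbf r'\in\mathbf r^{\widehat{\mathbf W}_\ell}\cap\overline{\mathcal A}_e^\ell$, the moving vector $\mathbf{mv}^{\mathbf r'}(B)$ of $B$ with respect to $\mathbf r'$ is the common value of $\mathbf{mv}_e((\boldsymbol\lambda;\mathbf r)^w)$ for all $\boldsymbol\lambda$ in $B$ and all $w$ with $\mathbf r^w=\mathbf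 r'$. A core block is a block in which every $\boldsymbol\lambda$ satisfies $\mathrm{wt}_e(\lambda^{(i)})=0$ for all $i$. Action on blocks and Scopes equivalence. For $j\in\mathbb Z/e\mathbb Z$, $s_j\bullet_{\mathbf r}\boldsymbol\lambda$ is obtained from $\boldsymbol\lambda$ by removing all its removable nodes and adding all its addable nodes of $(e,\mathbf r)$-residue $j$; this extends to a left action of $\mathbf W_e$ on $\mathcal P^\ell$, and induces an action on blocks (of the algebras $\mathcal H_n$, $n\ge0$, with the same $\mathbf r$): $s_j\bullet B$ is the block containing $s_j\bullet_{\mathbf r}\boldsymbol\lambda$ for $\boldsymbol\lambda$ in $B$. $B$ and $s_j\bullet B$ are (elementarily) Scopes equivalent if all $\boldsymbol\lambda$ in $B$ have no addable node of $(e,\mathbf r)$-residue $j$, or all $\boldsymbol\lambda$ in $B$ have no removable node of $(e,\mathbf r)$-residue $j$; Scopes equivalence is the reflexive transitive closure. *)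

theory Defs
  imports "HOL-Algebra.QuotRing" "HOL-Library.Poly_Mapping" "HOL-Combinatorics.Permutations"
begin

section \<open>Partitions, beta-sets, cores and weights\<close>

text \<open>
  All sequences are indexed from 0: the part \<open>p a\<close> of a partition \<open>p\<close> is the classical
  \<open>(a+1)\<close>-st part, the component \<open>lam ! i\<close> of a multipartition is the classical \<open>(i+1)\<close>-st
  component, and a node \<open>(a, b, i)\<close> is the classical node \<open>(a+1, b+1, i+1)\<close>.  Contents
  \<open>b - a\<close> are unaffected by this shift.
\<close>

type_synonym partition = "nat \<Rightarrow> nat"

definition is_partition :: "partition \<Rightarrow> bool" where
  "is_partition p \<longleftrightarrow> antimono p \<and> finite {a. p a \<noteq> 0}"

definition psize :: "partition \<Rightarrow> nat" where
  "psize p = (\<Sum>a | p a \<noteq> 0. p a)"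

definition beta :: "int \<Rightarrow> partition \<Rightarrow> int set" where
  "beta t p = {int (p a) + t - (int a + 1) | a. True}"

definition charge :: "int set \<Rightarrow> int" where
  "charge B = int (card (B \<inter> {0..})) - int (card ({..<0} - B))"

definition beta_inv :: "int set \<Rightarrow> partition" where
  "beta_inv B = (THE p. is_partition p \<and> beta (charge B) p = B)"

definition quot :: "nat \<Rightarrow> int set \<Rightarrow> int set list" where
  "quot e B = map (\<lambda>i. {a. a * int e + int i \<in> B}) [0..<e]"

definition core :: "nat \<Rightarrow> int set \<Rightarrow> int set" where
  "core e B = {a * int e + int i | a i. i < e \<and> a < charge (quot e B ! i)}"

definition wt :: "nat \<Rightarrow> int set \<Rightarrow> nat" where
  "wt e B = (\<Sum>C\<leftarrow>quot e B. psize (beta_inv C))"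

text \<open>The weight of a partition does not depend on the charge; we use the charge 0.\<close>

definition partition_wt :: "nat \<Rightarrow> partition \<Rightarrow> nat" where
  "partition_wt e p = wt e (beta 0 p)"


section \<open>Multipartitions and the Uglov map\<close>

type_synonym multipartition = "partition list"

definition multipartitions :: "nat \<Rightarrow> multipartition set" where
  "multipartitions l = {lam. length lam = l \<and> (\<forall>p \<in> set lam. is_partition p)}"

definition msize :: "multipartition \<Rightarrow> nat" where
  "msize lam = (\<Sum>p\<leftarrow>lam. psize p)"

type_synonym node = "nat \<times> nat \<times> nat"

definition nodes :: "multipartition \<Rightarrow> node set" where
  "nodes lam = {(a, b, i). i < length lam \<and> b < (lam ! i) a}"

definition residue :: "nat \<Rightarrow> int list \<Rightarrow> node \<Rightarrow> nat" where
  "residue m t = (\<lambda>(a, b, i). nat ((int b - int a + t ! i) mod int m))"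

definition addable :: "multipartition \<Rightarrow> node set" where
  "addable lam = {x. x \<notin> nodes lam \<and>
     (\<exists>mu \<in> multipartitions (length lam). nodes mu = insert x (nodes lam))}"

definition removable :: "multipartition \<Rightarrow> node set" where
  "removable lam = {x. x \<in> nodes lam \<and>
     (\<exists>mu \<in> multipartitions (length lam). nodes mu = nodes lam - {x})}"

text \<open>Here \<open>x div int e\<close> and \<open>x mod int e\<close> are the \<open>a\<close> and \<open>b\<close> in \<open>x = a e + b\<close>;
  the index \<open>i\<close> runs over \<open>1, ..., l\<close>.\<close>

definition upsilon :: "nat \<Rightarrow> nat \<Rightarrow> nat \<Rightarrow> int \<Rightarrow> int" where
  "upsilon e l i x = (x div int e) * int e * int l + (int l - int i) * int e + x mod int e"

definition uglov :: "nat \<Rightarrow> int set list \<Rightarrow> int set" where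
  "uglov e Bs = (\<Union>i<length Bs. upsilon e (length Bs) (Suc i) ` (Bs ! i))"

definition mbeta :: "int list \<Rightarrow> multipartition \<Rightarrow> int set list" where
  "mbeta t lam = map2 beta t lam"

definition mcore :: "nat \<Rightarrow> multipartition \<Rightarrow> int list \<Rightarrow> int set" where
  "mcore e lam t = core e (uglov e (mbeta t lam))"

definition mwt :: "nat \<Rightarrow> multipartition \<Rightarrow> int list \<Rightarrow> nat" where
  "mwt e lam t = wt e (uglov e (mbeta t lam))"

definition moving_vector :: "nat \<Rightarrow> multipartition \<Rightarrow> int list \<Rightarrow> nat list" where
  "moving_vector e lam t =
     (let Q = quot e (uglov e (mbeta t lam)); u = map charge Q; mu = map beta_inv Q; l = length lam
      in map (\<lambda>i. card {x \<in> nodes mu. residue l u x = i}) (rev [0..<l]))"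


section \<open>The extended affine Weyl group action and the fundamental alcove\<close>

text \<open>The pair \<open>(\<sigma>, u)\<close> stands for the group element \<open>\<sigma> u\<close>.\<close>

definition ext_affine_weyl :: "nat \<Rightarrow> ((nat \<Rightarrow> nat) \<times> int list) set" where
  "ext_affine_weyl l = {(\<sigma>, u). \<sigma> permutes {..<l} \<and> length u = l}"

definition charge_act :: "nat \<Rightarrow> int list \<Rightarrow> (nat \<Rightarrow> nat) \<times> int list \<Rightarrow> int list" where
  "charge_act e t = (\<lambda>(\<sigma>, u). map2 (\<lambda>x y. x + int e * y) (permute_list \<sigma> t) u)"

definition mp_act :: "multipartition \<Rightarrow> (nat \<Rightarrow> nat) \<times> int list \<Rightarrow> multipartition" where
  "mp_act lam = (\<lambda>(\<sigma>, u). permute_list \<sigma> lam)"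

definition charge_orbit :: "nat \<Rightarrow> int list \<Rightarrow> int list set" where
  "charge_orbit e r = charge_act e r ` ext_affine_weyl (length r)"

definition closed_alcove :: "nat \<Rightarrow> nat \<Rightarrow> int list set" where
  "closed_alcove e l = {a. length a = l \<and> sorted a \<and> last a \<le> hd a + int e}"


section \<open>(Degenerate) cyclotomic Hecke algebras\<close>

text \<open>
  The free associative algebra on a set of letters is realised as the finitely supported
  functions on words, with convolution as multiplication.
\<close>

datatype letter = T nat | X nat

datatype word = Word (letters: "letter list")

instantiation word :: monoid_add
begin
definition zero_word :: word where "0 = Word []"
definition plus_word :: "word \<Rightarrow> word \<Rightarrow> word" where "v + w = Word (letters v @ letters w)"
instance by standard (auto simp: zero_word_def plus_word_def)
end

type_synonym 'f free = "word \<Rightarrow>\<^sub>0 'f"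

definition lett :: "letter \<Rightarrow> 'f::field free" where
  "lett x = Poly_Mapping.single (Word [x]) 1"

definition scal :: "'f::field \<Rightarrow> 'f free" where
  "scal c = Poly_Mapping.single 0 c"

definition free_algebra :: "letter set \<Rightarrow> ('f::field free) ring" where
  "free_algebra A =
     \<lparr>carrier = {f. \<forall>w \<in> Poly_Mapping.keys f. set (letters w) \<subseteq> A},
      monoid.mult = (*), one = 1, zero = 0, add = (+)\<rparr>"

text \<open>
  Presentations: generators, and elements of the free algebra that are set to 0.  The letter
  \<open>T a\<close> stands for \<open>T\<^sub>a\<close>.  In the degenerate case \<open>T 1, ..., T (n-1)\<close> are the simple
  transpositions and \<open>X 1, ..., X n\<close> the polynomial generators of the degenerate affine Hecke
  algebra.
\<close>

definition hecke_gens :: "nat \<Rightarrow> letter set" where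
  "hecke_gens n = T ` {..<n}"

definition hecke_rels :: "'f::field \<Rightarrow> int list \<Rightarrow> nat \<Rightarrow> 'f free set" where
  "hecke_rels q r n =
     (if n \<ge> 1 then {(\<Prod>k\<leftarrow>r. lett (T 0) - scal (q powi k))} else {}) \<union>
     {(lett (T a) - scal q) * (lett (T a) + 1) | a. 1 \<le> a \<and> a < n} \<union>
     (if n \<ge> 2 then {lett (T 0) * lett (T 1) * lett (T 0) * lett (T 1)
        - lett (T 1) * lett (T 0) * lett (T 1) * lett (T 0)} else {}) \<union>
     {lett (T a) * lett (T (a+1)) * lett (T a)
        - lett (T (a+1)) * lett (T a) * lett (T (a+1)) | a. 1 \<le> a \<and> a + 1 < n} \<union>
     {lett (T a) * lett (T b) - lett (T b) * lett (T a) | a b. a + 2 \<le> b \<and> b < n}"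

definition deg_gens :: "nat \<Rightarrow> letter set" where
  "deg_gens n = T ` {1..<n} \<union> X ` {1..n}"

definition deg_rels :: "int list \<Rightarrow> nat \<Rightarrow> 'f::field free set" where
  "deg_rels r n =
     (if n \<ge> 1 then {(\<Prod>k\<leftarrow>r. lett (X 1) - scal (of_int k))} else {}) \<union>
     {lett (T a) * lett (T a) - 1 | a. 1 \<le> a \<and> a < n} \<union>
     {lett (T a) * lett (T (a+1)) * lett (T a)
        - lett (T (a+1)) * lett (T a) * lett (T (a+1)) | a. 1 \<le> a \<and> a + 1 < n} \<union>
     {lett (T a) * lett (T b) - lett (T b) * lett (T a) | a b. 1 \<le> a \<and> a + 2 \<le> b \<and> b < n} \<union>
     {lett (X j) * lett (X k) - lett (X k) * lett (X j) | j k. j \<in> {1..n} \<and> k \<in> {1..n}} \<union>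
     {lett (T a) * lett (X k) - lett (X k) * lett (T a) | a k.
        1 \<le> a \<and> a < n \<and> k \<in> {1..n} \<and> k \<noteq> a \<and> k \<noteq> a + 1} \<union>
     {lett (T a) * lett (X (a+1)) - lett (X a) * lett (T a) - 1 | a. 1 \<le> a \<and> a < n}"

definition AK_free :: "nat \<Rightarrow> 'f::field \<Rightarrow> nat \<Rightarrow> 'f free ring" where
  "AK_free e q n = free_algebra (if e = CHAR('f) then deg_gens n else hecke_gens n)"

definition AK_ideal :: "nat \<Rightarrow> 'f::field \<Rightarrow> int list \<Rightarrow> nat \<Rightarrow> 'f free set" where
  "AK_ideal e q r n =
     genideal (AK_free e q n) (if e = CHAR('f) then deg_rels r n else hecke_rels q r n)"

text \<open>
  The algebra \<open>\<H>\<^sub>n\<close>.  It is recorded as a ring only: the scalars sit inside it as the cosets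
  of the elements \<open>scal c\<close>, so its ring-theoretic one- and two-sided ideals are subspaces.
\<close>

definition AK :: "nat \<Rightarrow> 'f::field \<Rightarrow> int list \<Rightarrow> nat \<Rightarrow> 'f free set ring" where
  "AK e q r n = AK_free e q n Quot AK_ideal e q r n"


section \<open>Specht modules\<close>

text \<open>
  Specht modules are the cell modules of the Dipper--James--Mathas basis (and its degenerate
  analogue due to Ariki, Mathas and Rui).  With \<open>m\<^sub>\<lambda> = u\<^sub>\<lambda> x\<^sub>\<lambda>\<close> as below and \<open>N\<^sub>\<lambda>\<close>
  the two-sided ideal generated by all \<open>m\<^sub>\<mu>\<close> with \<open>\<mu>\<close> strictly dominating \<open>\<lambda>\<close> (which is
  the span of the basis elements of shape strictly dominating \<open>\<lambda>\<close>), the Specht module of \<open>\<lambda>\<close>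
  is the right module \<open>(m\<^sub>\<lambda> H + N\<^sub>\<lambda>) / N\<^sub>\<lambda>\<close>.
\<close>

text \<open>The cyclotomic parameter attached to \<open>k\<close>, and the Jucys--Murphy elements \<open>L\<^sub>1, L\<^sub>2, ...\<close>
  (the argument of \<open>hecke_jm\<close> is shifted by one).\<close>

definition param :: "nat \<Rightarrow> 'f::field \<Rightarrow> int \<Rightarrow> 'f" where
  "param e q k = (if e = CHAR('f) then of_int k else q powi k)"

fun hecke_jm :: "'f::field \<Rightarrow> nat \<Rightarrow> 'f free" where
  "hecke_jm q 0 = lett (T 0)"
| "hecke_jm q (Suc k) = scal (inverse q) * lett (T (Suc k)) * hecke_jm q k * lett (T (Suc k))"

definition jm :: "nat \<Rightarrow> 'f::field \<Rightarrow> nat \<Rightarrow> 'f free" where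
  "jm e q k = (if e = CHAR('f) then lett (X k) else hecke_jm q (k - 1))"

definition u_elt :: "nat \<Rightarrow> 'f::field \<Rightarrow> int list \<Rightarrow> multipartition \<Rightarrow> 'f free" where
  "u_elt e q r lam =
     (\<Prod>s\<leftarrow>[1..<length r]. \<Prod>k\<leftarrow>[1..<Suc (\<Sum>i<s. psize (lam ! i))].
        jm e q k - scal (param e q (r ! s)))"

definition word_perm :: "nat list \<Rightarrow> nat \<Rightarrow> nat" where
  "word_perm ks = foldr (\<lambda>k f. Transposition.transpose k (Suc k) \<circ> f) ks id"

text \<open>\<open>T\<^sub>w\<close>, for a permutation \<open>w\<close> of \<open>{1..n}\<close>, via a choice of reduced word; modulo the
  braid relations the choice does not matter.\<close>

definition T_perm :: "nat \<Rightarrow> (nat \<Rightarrow> nat) \<Rightarrow> 'f::field free" where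
  "T_perm n w = (\<Prod>k\<leftarrow>arg_min length (\<lambda>ks. set ks \<subseteq> {1..<n} \<and> word_perm ks = w). lett (T k))"

text \<open>The entries of a row of the initial standard tableau, which lists \<open>1, ..., n\<close> row by row,
  component by component.\<close>

definition row_entries :: "multipartition \<Rightarrow> nat \<Rightarrow> nat \<Rightarrow> nat set" where
  "row_entries lam i a =
     (let k = (\<Sum>c<i. psize (lam ! c)) + (\<Sum>d<a. (lam ! i) d) in {k + 1..k + (lam ! i) a})"

definition young_subgroup :: "multipartition \<Rightarrow> (nat \<Rightarrow> nat) set" where
  "young_subgroup lam =
     {w. w permutes {1..msize lam} \<and>
         (\<forall>i<length lam. \<forall>a. w ` row_entries lam i a = row_entries lam i a)}"

definition x_elt :: "multipartition \<Rightarrow> 'f::field free" where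
  "x_elt lam = (\<Sum>w\<in>young_subgroup lam. T_perm (msize lam) w)"

definition m_elt :: "nat \<Rightarrow> 'f::field \<Rightarrow> int list \<Rightarrow> multipartition \<Rightarrow> 'f free set" where
  "m_elt e q r lam =
     (let n = msize lam in AK_ideal e q r n +>\<^bsub>AK_free e q n\<^esub> (u_elt e q r lam * x_elt lam))"

definition dominates :: "multipartition \<Rightarrow> multipartition \<Rightarrow> bool" where
  "dominates lam mu \<longleftrightarrow>
     (\<forall>s<length lam. \<forall>k.
        (\<Sum>i<s. psize (lam ! i)) + (\<Sum>a<k. (lam ! s) a) \<ge>
        (\<Sum>i<s. psize (mu ! i)) + (\<Sum>a<k. (mu ! s) a))"

definition specht_lower :: "nat \<Rightarrow> 'f::field \<Rightarrow> int list \<Rightarrow> multipartition \<Rightarrow> 'f free set set" where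
  "specht_lower e q r lam =
     genideal (AK e q r (msize lam))
       {m_elt e q r mu | mu. mu \<in> multipartitions (length r) \<and> msize mu = msize lam \<and>
                             dominates mu lam \<and> mu \<noteq> lam}"

definition specht_upper :: "nat \<Rightarrow> 'f::field \<Rightarrow> int list \<Rightarrow> multipartition \<Rightarrow> 'f free set set" where
  "specht_upper e q r lam =
     (let H = AK e q r (msize lam) in
      {(m_elt e q r lam \<otimes>\<^bsub>H\<^esub> h) \<oplus>\<^bsub>H\<^esub> y | h y. h \<in> carrier H \<and> y \<in> specht_lower e q r lam})"


section \<open>Blocks\<close>

definition central_idempotent :: "('a, 'b) ring_scheme \<Rightarrow> 'a \<Rightarrow> bool" where
  "central_idempotent R b \<longleftrightarrow>
     b \<in> carrier R \<and> b \<otimes>\<^bsub>R\<^esub> b = b \<and> (\<forall>x \<in> carrier R. b \<otimes>\<^bsub>R\<^esub> x = x \<otimes>\<^bsub>R\<^esub> b)"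

definition block_idempotent :: "('a, 'b) ring_scheme \<Rightarrow> 'a \<Rightarrow> bool" where
  "block_idempotent R b \<longleftrightarrow>
     central_idempotent R b \<and> b \<noteq> \<zero>\<^bsub>R\<^esub> \<and>
     (\<forall>c d. central_idempotent R c \<and> central_idempotent R d \<and> c \<otimes>\<^bsub>R\<^esub> d = \<zero>\<^bsub>R\<^esub> \<and>
            c \<oplus>\<^bsub>R\<^esub> d = b \<longrightarrow> c = \<zero>\<^bsub>R\<^esub> \<or> d = \<zero>\<^bsub>R\<^esub>)"

text \<open>A block of \<open>\<H>\<^sub>n\<close> is recorded by \<open>n\<close> and its primitive central idempotent.\<close>

type_synonym 'f block = "nat \<times> 'f free set"

definition blocks :: "nat \<Rightarrow> 'f::field \<Rightarrow> int list \<Rightarrow> 'f block set" where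
  "blocks e q r = {(n, b). block_idempotent (AK e q r n) b}"

text \<open>
  A multipartition lies in a block if the block idempotent acts as the identity on its Specht
  module.  As the zero module satisfies this for every block, the module is required to be
  nonzero (which Specht modules are).
\<close>

definition lies_in :: "nat \<Rightarrow> 'f::field \<Rightarrow> int list \<Rightarrow> multipartition \<Rightarrow> 'f block \<Rightarrow> bool" where
  "lies_in e q r lam = (\<lambda>(n, b).
     lam \<in> multipartitions (length r) \<and> msize lam = n \<and>
     specht_upper e q r lam \<noteq> specht_lower e q r lam \<and>
     (\<forall>x \<in> specht_upper e q r lam.
        (x \<otimes>\<^bsub>AK e q r n\<^esub> b) \<ominus>\<^bsub>AK e q r n\<^esub> x \<in> specht_lower e q r lam))"

definition core_block :: "nat \<Rightarrow> 'f::field \<Rightarrow> int list \<Rightarrow> 'f block \<Rightarrow> bool" where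
  "core_block e q r B \<longleftrightarrow>
     B \<in> blocks e q r \<and> (\<forall>lam. lies_in e q r lam B \<longrightarrow> (\<forall>p \<in> set lam. partition_wt e p = 0))"

definition block_moving_vector ::
    "nat \<Rightarrow> 'f::field \<Rightarrow> int list \<Rightarrow> int list \<Rightarrow> 'f block \<Rightarrow> nat list" where
  "block_moving_vector e q r r' B =
     (THE v. \<forall>lam w. lies_in e q r lam B \<and> w \<in> ext_affine_weyl (length r) \<and> charge_act e r w = r'
                \<longrightarrow> moving_vector e (mp_act lam w) (charge_act e r w) = v)"


section \<open>The affine Weyl group action on blocks and Scopes equivalence\<close>

definition node_refl :: "nat \<Rightarrow> int list \<Rightarrow> nat \<Rightarrow> multipartition \<Rightarrow> multipartition" where
  "node_refl e r j lam =
     (THE mu. mu \<in> multipartitions (length lam) \<and>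
        nodes mu = (nodes lam - {x \<in> removable lam. residue e r x = j})
                     \<union> {x \<in> addable lam. residue e r x = j})"

definition block_refl :: "nat \<Rightarrow> 'f::field \<Rightarrow> int list \<Rightarrow> nat \<Rightarrow> 'f block \<Rightarrow> 'f block" where
  "block_refl e q r j B =
     (THE B'. B' \<in> blocks e q r \<and>
        (\<forall>lam. lies_in e q r lam B \<longrightarrow> lies_in e q r (node_refl e r j lam) B'))"

text \<open>Every element of the affine Weyl group is a product of the Coxeter generators
  \<open>s\<^sub>0, ..., s\<^sub>e\<^sub>-\<^sub>1\<close>, so the orbit of a block consists of its images under such products.\<close>

definition weyl_orbit :: "nat \<Rightarrow> 'f::field \<Rightarrow> int list \<Rightarrow> 'f block \<Rightarrow> 'f block set" where
  "weyl_orbit e q r B = {foldr (block_refl e q r) js B | js. set js \<subseteq> {..<e}}"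

definition elementary_scopes :: "nat \<Rightarrow> 'f::field \<Rightarrow> int list \<Rightarrow> 'f block \<Rightarrow> 'f block \<Rightarrow> bool" where
  "elementary_scopes e q r B B' \<longleftrightarrow>
     B \<in> blocks e q r \<and>
     (\<exists>j<e. B' = block_refl e q r j B \<and>
        ((\<forall>lam. lies_in e q r lam B \<longrightarrow> (\<forall>x \<in> addable lam. residue e r x \<noteq> j)) \<or>
         (\<forall>lam. lies_in e q r lam B \<longrightarrow> (\<forall>x \<in> removable lam. residue e r x \<noteq> j))))"

definition scopes_equivalent :: "nat \<Rightarrow> 'f::field \<Rightarrow> int list \<Rightarrow> 'f block \<Rightarrow> 'f block \<Rightarrow> bool" where
  "scopes_equivalent e q r = (elementary_scopes e q r)\<^sup>*\<^sup>*"

end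

theory Submission
  imports Defs "HOL-Library.Infinite_Set"
begin

text \<open>
  Put a bipartition on an abacus with \<open>e\<close> runners, and let runner \<open>b\<close> have
  charge \<open>x\<^sub>b\<close> in the first and \<open>y\<^sub>b\<close> in the second component. Under the Uglov map the two copies of
  runner \<open>b\<close> are interleaved, so the core of the block amounts to the vector \<open>c\<^sub>b = x\<^sub>b + y\<^sub>b\<close>. By
  the classification of blocks, once the charge has been moved into the alcove, a block is the set
  of bipartitions with a given \<open>c\<close> and a given weight.

  Put \<open>d\<^sub>b = x\<^sub>b - y\<^sub>b\<close>. For a pair of cores the interleaved runner is a staircase of size \<open>d\<^sub>b (d\<^sub>b +
  1) / 2\<close>. If two entries of \<open>d\<close> are more than 2 apart, one can move them towards each other
  without changing \<open>c\<close>, and use the weight saved to raise a bead on its runner: the block then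
  contains a bipartition that is not a pair of cores (\<open>exchange\<close>). So in a core block any two
  entries of \<open>d\<close> are at most 2 apart (\<open>core_spread\<close>).

  This is all that is needed for the first claim. The reflection \<open>s\<^sub>j\<close> exchanges runner \<open>j\<close> with
  the runner before it. If the two entries of \<open>c\<close> (suitably normalised for \<open>j = 0\<close>) agree, it
  fixes the block. Otherwise, as entries of \<open>d\<close> are close, the same one of the two runners is at
  least as full as the other in both components of every member, so that either no member has an
  addable \<open>j\<close>-node or no member has a removable one (\<open>elementary_step\<close>). Hence every step along an
  orbit is a Scopes equivalence, or trivial.

  For the second claim, take charges in the alcove. The entries of \<open>d\<close> then lie in \<open>{-2..1}\<close>, the
  moving vector counts the entries \<open>1\<close> and \<open>-2\<close>, at most one of which occurs, and the number of
  odd entries of \<open>c\<close> is determined by it (\<open>tight_pair\<close>). The vectors with a given sum and a given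
  number of odd entries form a single orbit (\<open>swap_step_connected\<close>), and \<open>c\<close> determines the weight
  of a core block, so two core blocks with the same moving vector lie in one orbit.

  That the Scopes relation and the action on blocks behave as expected requires that each block
  has a member and each multipartition lies in at most one block. The latter is orthogonality of
  block idempotents; the former follows by induction on dominance from \<open>m\<^sub>\<lambda> = 1\<close> for a column
  bipartition (\<open>block_inhabited\<close>).
\<close>

section \<open>Beta-sets, charges and sizes\<close>

text \<open>
  Bounded above, with complement bounded below: for sets of integers this is the existence of the
  maximum of the set and of the minimum of the complement.
\<close>

definition beta_set :: "int set \<Rightarrow> bool" where
  "beta_set B \<longleftrightarrow> (\<exists>N M. {..<N} \<subseteq> B \<and> B \<subseteq> {..<M})"

lemma finite_tail: "B \<subseteq> {..<M} \<Longrightarrow> finite (B \<inter> {N..})" for M N :: int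
  by (rule finite_subset[of _ "{N..<M}"]) auto

text \<open>
  The charge compares the set with the negative integers. Any cut \<open>N\<close> below which the set is full
  serves equally well, and one common low cut makes several sets comparable.
\<close>

lemma charge_eq_card:
  assumes "{..<N} \<subseteq> B" "B \<subseteq> {..<M}"
  shows "charge B = int (card (B \<inter> {N..})) + N"
proof (cases "N \<le> 0")
  case True
  have "B \<inter> {N..} = (B \<inter> {0..}) \<union> (B \<inter> {N..<0})" "(B \<inter> {0..}) \<inter> (B \<inter> {N..<0}) = {}"
    using True by auto
  then have 1: "card (B \<inter> {N..}) = card (B \<inter> {0..}) + card (B \<inter> {N..<0})"
    using finite_tail[OF assms(2)] by (simp add: card_Un_disjoint)
  have "z \<ge> N" if "z \<notin> B" for z using assms(1) that by (meson lessThan_iff not_less subsetD)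
  then have "{..<0} - B = {N..<0} - (B \<inter> {N..<0})" using True by auto
  then have "card ({..<0} - B) = card {N..<0} - card (B \<inter> {N..<0})"
    by (simp add: card_Diff_subset)
  moreover have "card (B \<inter> {N..<0}) \<le> card {N..<0}" by (intro card_mono) auto
  ultimately show ?thesis using 1 True by (simp add: charge_def)
next
  case False
  have "B \<inter> {0..} = {0..<N} \<union> (B \<inter> {N..})" using assms False by auto
  then have "card (B \<inter> {0..}) = card {0..<N} + card (B \<inter> {N..})"
    using finite_tail[OF assms(2)] by (simp add: card_Un_disjoint disjoint_iff)
  moreover have "{..<0} - B = {}" using assms False by auto
  then have "card ({..<0} - B) = 0" by (simp only: card.empty)
  ultimately show ?thesis using False by (simp add: charge_def)
qed

definition bead :: "int \<Rightarrow> partition \<Rightarrow> nat \<Rightarrow> int" where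
  "bead t p a = int (p a) + t - (int a + 1)"

lemma beta_range: "beta t p = range (bead t p)"
  by (auto simp: beta_def bead_def)

lemma bead_strict:
  assumes "is_partition p" "a < a'"
  shows "bead t p a' < bead t p a"
  using assms antimonoD[of p a a'] by (auto simp: is_partition_def bead_def)

lemma bead_less_iff: "is_partition p \<Longrightarrow> bead t p a' < bead t p a \<longleftrightarrow> a < a'"
  using bead_strict[of p a a' t] bead_strict[of p a' a t] by (cases a a' rule: linorder_cases) auto

lemma bead_eq_iff: "is_partition p \<Longrightarrow> bead t p a' = bead t p a \<longleftrightarrow> a = a'"
  using bead_strict[of p a a' t] bead_strict[of p a' a t] by (cases a a' rule: linorder_cases) auto

lemma inj_bead: "is_partition p \<Longrightarrow> inj_on (bead t p) A"
  by (auto intro: inj_onI simp: bead_eq_iff)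

lemma beta_tail:
  assumes "\<And>a. a \<ge> n \<Longrightarrow> p a = 0"
  shows "{..<t - int n} \<subseteq> beta t p" "beta t p \<inter> {t - int n..} = bead t p ` {..<n}"
proof
  fix z assume "z \<in> {..<t - int n}"
  then have "z = bead t p (nat (t - 1 - z))" using assms[of "nat (t - 1 - z)"] by (auto simp: bead_def)
  then show "z \<in> beta t p" by (auto simp: beta_range)
next
  have "a < n" if "bead t p a \<ge> t - int n" for a
    using that assms[of a] by (cases "a < n") (auto simp: bead_def)
  then show "beta t p \<inter> {t - int n..} = bead t p ` {..<n}"
    by (auto simp: beta_range) (auto simp: bead_def)
qed

lemma partition_support:
  assumes "is_partition p"
  obtains n where "\<And>a. a \<ge> n \<Longrightarrow> p a = 0"
proof -
  have "finite {a. p a \<noteq> 0}" using assms by (simp add: is_partition_def)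
  then obtain n where "{a. p a \<noteq> 0} \<subseteq> {..<n}" using finite_nat_bounded by blast
  then show ?thesis by (intro that[of n]) (auto simp: subset_eq not_less[symmetric])
qed

lemma beta_bounded:
  assumes "is_partition p"
  shows "beta t p \<subseteq> {..<int (p 0) + t}"
proof -
  have "p a \<le> p 0" for a using assms antimonoD[of p 0 a] by (simp add: is_partition_def)
  then have "int (p a) \<le> int (p 0)" for a by simp
  then have "bead t p a < int (p 0) + t" for a
    using \<open>int (p a) \<le> int (p 0)\<close> unfolding bead_def by linarith
  then show ?thesis by (auto simp: beta_range)
qed

lemma beta_set_beta:
  assumes "is_partition p"
  shows "beta_set (beta t p)"
proof -
  obtain n where "\<And>a. a \<ge> n \<Longrightarrow> p a = 0" using partition_support[OF assms] by blast
  then show ?thesis using beta_tail(1)[of n p t] beta_bounded[OF assms] unfolding beta_set_def by blast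
qed

lemma charge_beta:
  assumes "is_partition p"
  shows "charge (beta t p) = t"
proof -
  obtain n where n: "\<And>a. a \<ge> n \<Longrightarrow> p a = 0" using partition_support[OF assms] by blast
  show ?thesis
    using charge_eq_card[OF beta_tail(1) beta_bounded[OF assms], of n t] n beta_tail(2)[of n p t]
    by (simp add: card_image inj_bead[OF assms])
qed

text \<open>
  The bead \<open>bead t p a\<close> is the element of the beta-set with exactly \<open>a\<close> larger elements, so the
  beta-set determines the beads and hence the parts.
\<close>

lemma beta_inj:
  assumes "is_partition p" "is_partition p'" "beta t p = beta t p'"
  shows "p = p'"
proof
  fix a
  have main: "bead t p a \<ge> bead t p' a"
    if that: "is_partition p" "is_partition p'" "beta t p = beta t p'" for p p'
  proof (rule ccontr)
    assume "\<not> ?thesis"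
    then have less: "bead t p a < bead t p' a" by simp
    have "bead t p' ` {..a} \<subseteq> bead t p ` {..<a}"
    proof safe
      fix i assume "i \<le> a"
      with less have *: "bead t p a < bead t p' i"
        using bead_strict[OF that(2), of i a t] by (cases "i = a") auto
      have "bead t p' i \<in> beta t p" using that(3) by (simp add: beta_range)
      then obtain j where j: "bead t p' i = bead t p j" by (auto simp: beta_range)
      with * have "j < a" using that(1) by (simp add: bead_less_iff)
      then show "bead t p' i \<in> bead t p ` {..<a}" using j by auto
    qed
    then have "card {..a} \<le> card {..<a}"
      by (metis card_image inj_bead that(1,2) card_mono finite_imageI finite_lessThan)
    then show False by simp
  qed
  have "bead t p a = bead t p' a" using main[of p p'] main[of p' p] assms by simp
  then show "p a = p' a" by (simp add: bead_def)
qed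

text \<open>
  The part attached to a bead is the number of gaps below it. That this places the bead where
  \<open>beta\<close> puts it is a count of beads and gaps between a low cut and the bead; the charge supplies
  the number of beads.
\<close>

lemma beta_surj:
  assumes "beta_set B"
  shows "\<exists>p. is_partition p \<and> beta (charge B) p = B"
proof -
  obtain N M where N: "{..<N} \<subseteq> B" and M: "B \<subseteq> {..<M}" using assms by (auto simp: beta_set_def)
  define t where "t = charge B"
  define S where "S = {n. M - 1 - int n \<in> B}"
  have "n \<in> S" if "n \<ge> nat (M - N)" for n
    using that N by (auto simp: S_def)
  then have inf: "infinite S" by (meson infinite_nat_iff_unbounded_le nle_le)
  define b where "b a = M - 1 - int (enumerate S a)" for a
  have b_mono: "b a < b a'" if "a' < a" for a a'
    using enumerate_mono[OF that inf] by (simp add: b_def)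
  have b_le: "b a \<le> M - 1 - int a" for a using le_enumerate[OF inf, of a] by (simp add: b_def)
  have range_b: "range b = B"
  proof (intro equalityI subsetI)
    fix z assume "z \<in> range b"
    then show "z \<in> B" using enumerate_in_set[OF inf] by (auto simp: b_def S_def)
  next
    fix z assume z: "z \<in> B"
    then have "nat (M - 1 - z) \<in> S" using M by (auto simp: S_def)
    then obtain a where "enumerate S a = nat (M - 1 - z)" using enumerate_Ex[OF inf] by blast
    then have "b a = z" using z M by (auto simp: b_def)
    then show "z \<in> range b" by blast
  qed
  have b_inj: "inj b" by (metis b_mono injI linorder_neqE_nat order_less_irrefl)
  define p where "p a = card ({..<b a} - B)" for a
  have p: "bead t p a = b a" for a
  proof -
    define N' where "N' = min N (b a)"
    have N': "{..<N'} \<subseteq> B" "N' \<le> b a" using N by (auto simp: N'_def)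
    have fin: "finite (B \<inter> {N'..})" using M by (rule finite_tail)
    have "B \<inter> {b a..} = b ` {..a}"
    proof (intro equalityI subsetI)
      fix z assume "z \<in> B \<inter> {b a..}"
      then obtain i where "z = b i" "b i \<ge> b a" using range_b by auto
      then show "z \<in> b ` {..a}" using b_mono[of a i] by (cases "i \<le> a") auto
    next
      fix z assume "z \<in> b ` {..a}"
      then obtain i where "z = b i" "i \<le> a" by auto
      then show "z \<in> B \<inter> {b a..}" using b_mono[of i a] range_b by (cases "i = a") auto
    qed
    then have 1: "card (B \<inter> {b a..}) = a + 1" using b_inj by (simp add: card_image inj_on_subset)
    have "B \<inter> {N'..} = (B \<inter> {N'..<b a}) \<union> (B \<inter> {b a..})" using N' by auto
    then have "card (B \<inter> {N'..}) = card (B \<inter> {N'..<b a}) + card (B \<inter> {b a..})"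
      using fin by (subst card_Un_disjoint[symmetric]) auto
    then have 2: "t = int (card (B \<inter> {N'..<b a})) + int a + 1 + N'"
      using charge_eq_card[OF N'(1) M] 1 by (simp add: t_def)
    have "z \<ge> N'" if "z \<notin> B" for z using N'(1) that by (meson lessThan_iff not_less subsetD)
    then have "{..<b a} - B = {N'..<b a} - (B \<inter> {N'..<b a})" by auto
    then have "p a = card {N'..<b a} - card (B \<inter> {N'..<b a})"
      by (simp add: p_def card_Diff_subset)
    moreover have "card (B \<inter> {N'..<b a}) \<le> card {N'..<b a}" by (intro card_mono) auto
    ultimately show ?thesis using 2 N'(2) by (simp add: bead_def)
  qed
  have "antimono p"
  proof (rule antimonoI)
    fix a a' :: nat assume "a \<le> a'"
    then have "b a' \<le> b a" using b_mono[of a a'] by (cases "a = a'") auto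
    moreover have "z \<ge> N" if "z \<notin> B" for z using N that by (meson lessThan_iff not_less subsetD)
    then have "{..<b a} - B \<subseteq> {N..<b a}" by auto
    then have "finite ({..<b a} - B)" by (rule finite_subset) simp
    ultimately show "p a' \<le> p a" unfolding p_def by (intro card_mono) auto
  qed
  moreover have "p a = 0" if "a \<ge> nat (M - N)" for a
  proof -
    have "{..<b a} - B = {}" using b_le[of a] that N by auto
    then show ?thesis by (simp only: p_def card.empty)
  qed
  then have "{a. p a \<noteq> 0} \<subseteq> {..<nat (M - N)}" using not_less by blast
  then have "finite {a. p a \<noteq> 0}" using finite_subset by blast
  ultimately have "is_partition p" by (simp add: is_partition_def)
  moreover have "beta t p = B" using p range_b by (auto simp: beta_range)
  ultimately show ?thesis unfolding t_def by blast
qed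

lemma beta_inv_beta: "is_partition p \<Longrightarrow> beta_inv (beta t p) = p"
  unfolding beta_inv_def by (rule the_equality) (auto simp: charge_beta intro: beta_inj)

lemma beta_beta_inv:
  assumes "beta_set B"
  shows "is_partition (beta_inv B)" "beta (charge B) (beta_inv B) = B"
proof -
  obtain p where p: "is_partition p" "beta (charge B) p = B" using beta_surj[OF assms] by blast
  then have "beta_inv B = p" using beta_inv_beta[OF p(1), of "charge B"] by simp
  then show "is_partition (beta_inv B)" "beta (charge B) (beta_inv B) = B" using p by auto
qed

lemma beta_inv_inj:
  assumes "beta_set B" "beta_set B'" "charge B = charge B'" "beta_inv B = beta_inv B'"
  shows "B = B'"
proof -
  have "B = beta (charge B) (beta_inv B)" using beta_beta_inv(2)[OF assms(1)] by (rule sym)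
  also have "\<dots> = beta (charge B') (beta_inv B')" by (simp only: assms(3,4))
  also have "\<dots> = B'" by (rule beta_beta_inv(2)[OF assms(2)])
  finally show ?thesis .
qed

lemma beta_shift: "beta (t + k) p = (\<lambda>z. z + k) ` beta t p"
proof -
  have "bead (t + k) p = (\<lambda>z. z + k) \<circ> bead t p" by (auto simp: bead_def)
  then show ?thesis unfolding beta_range by (metis image_comp)
qed

lemma beta_zero: "beta t (\<lambda>_. 0) = {..<t}"
proof (intro equalityI subsetI)
  show "z \<in> {..<t}" if "z \<in> beta t (\<lambda>_. 0)" for z using that by (auto simp: beta_range bead_def)
qed (use beta_tail(1)[of 0 "\<lambda>_. 0" t] in auto)

definition bsize :: "int set \<Rightarrow> nat" where
  "bsize B = psize (beta_inv B)"

lemma bsize_shift: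
  assumes "beta_set B"
  shows "beta_set ((\<lambda>z. z + k) ` B)" "charge ((\<lambda>z. z + k) ` B) = charge B + k"
    "bsize ((\<lambda>z. z + k) ` B) = bsize B"
proof -
  have *: "(\<lambda>z. z + k) ` B = beta (charge B + k) (beta_inv B)"
    unfolding beta_shift using beta_beta_inv[OF assms] by simp
  show "beta_set ((\<lambda>z. z + k) ` B)" "charge ((\<lambda>z. z + k) ` B) = charge B + k"
    "bsize ((\<lambda>z. z + k) ` B) = bsize B"
    unfolding * bsize_def using beta_beta_inv[OF assms]
    by (auto simp: beta_set_beta charge_beta beta_inv_beta)
qed

lemma bsize_lessThan: "beta_set {..<t}" "charge {..<t} = t" "bsize {..<t} = 0"
proof -
  have "is_partition (\<lambda>_. 0)" by (simp add: is_partition_def antimono_def)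
  then show "beta_set {..<t}" "charge {..<t} = t" "bsize {..<t} = 0"
    unfolding bsize_def beta_zero[symmetric]
    by (simp_all add: beta_set_beta charge_beta beta_inv_beta psize_def del: One_nat_def)
qed

lemma bsize_eq_0_iff:
  assumes "beta_set B"
  shows "bsize B = 0 \<longleftrightarrow> B = {..<charge B}"
proof
  assume "bsize B = 0"
  then have "beta_inv B = (\<lambda>_. 0)"
    using beta_beta_inv(1)[OF assms] by (auto simp: bsize_def psize_def is_partition_def)
  then show "B = {..<charge B}" using beta_beta_inv(2)[OF assms] beta_zero by metis
next
  assume "B = {..<charge B}"
  then show "bsize B = 0" using bsize_lessThan(3) by metis
qed

lemma down_closed_iff:
  assumes "beta_set B"
  shows "(\<forall>z\<in>B. z - 1 \<in> B) \<longleftrightarrow> B = {..<charge B}"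
proof
  assume *: "\<forall>z\<in>B. z - 1 \<in> B"
  obtain N M where N: "{..<N} \<subseteq> B" and M: "B \<subseteq> {..<M}" using assms by (auto simp: beta_set_def)
  have down: "z - int k \<in> B" if "z \<in> B" for z k
    using that by (induction k) (use * in \<open>auto simp: algebra_simps\<close>)
  have "finite (B \<inter> {N - 1..})" "N - 1 \<in> B \<inter> {N - 1..}" using N M finite_tail by auto
  then have fin: "finite (B \<inter> {N - 1..})" "B \<inter> {N - 1..} \<noteq> {}" by blast+
  define m where "m = Max (B \<inter> {N - 1..})"
  have m: "m \<in> B" "m \<ge> N - 1" using Max_in[OF fin] by (auto simp: m_def)
  have "z \<le> m" if "z \<in> B" for z
    using that m Max_ge[OF fin(1), of z] by (cases "z \<ge> N - 1") (auto simp: m_def)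
  moreover have "z \<in> B" if "z \<le> m" for z using down[OF m(1), of "nat (m - z)"] that by simp
  ultimately have "B = {..<m + 1}" by auto
  then show "B = {..<charge B}" using bsize_lessThan(2) by metis
next
  assume "B = {..<charge B}"
  then obtain t where "B = {..<t}" by blast
  then show "\<forall>z\<in>B. z - 1 \<in> B" by auto
qed

text \<open>
  The size of a partition is the total displacement of its beads from the vacuum \<open>{..<t}\<close>, so it
  can be read off from sums over tails of the beta-set.
\<close>

lemma sum_bead_tail:
  assumes "is_partition p" "\<And>a. a \<ge> n \<Longrightarrow> p a = 0"
  shows "int (psize p) = \<Sum>(beta t p \<inter> {t - int n..}) - \<Sum>{t - int n..<t}"
proof -
  have "\<Sum>(beta t p \<inter> {t - int n..}) = (\<Sum>a<n. bead t p a)"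
    using beta_tail(2)[of n p t] assms(2) by (simp add: sum.reindex inj_bead[OF assms(1)])
  also have "\<dots> = (\<Sum>a<n. int (p a)) + (\<Sum>a<n. t - 1 - int a)"
    by (simp add: bead_def sum.distrib[symmetric] algebra_simps)
  also have "(\<Sum>a<n. t - 1 - int a) = \<Sum>{t - int n..<t}"
    by (rule sum.reindex_bij_witness[of _ "\<lambda>z. nat (t - 1 - z)" "\<lambda>a. t - 1 - int a"]) auto
  also have "(\<Sum>a<n. int (p a)) = int (psize p)"
    unfolding psize_def of_nat_sum
  proof (rule sum.mono_neutral_right)
    show "{a. p a \<noteq> 0} \<subseteq> {..<n}" using assms(2) not_less by blast
  qed auto
  finally show ?thesis by simp
qed

lemma bsize_eventually:
  assumes "beta_set B"
  obtains N0 where "\<And>N. N \<le> N0 \<Longrightarrow> {..<N} \<subseteq> B \<and>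
     int (bsize B) = \<Sum>(B \<inter> {N..}) - \<Sum>{N..<charge B}"
proof -
  note B = beta_beta_inv[OF assms]
  obtain n where n: "\<And>a. a \<ge> n \<Longrightarrow> beta_inv B a = 0" using partition_support[OF B(1)] by blast
  have "{..<N} \<subseteq> B \<and> int (bsize B) = \<Sum>(B \<inter> {N..}) - \<Sum>{N..<charge B}"
    if "N \<le> charge B - int n" for N
  proof -
    have "N = charge B - int (nat (charge B - N))" using that by simp
    moreover have "beta_inv B a = 0" if "a \<ge> nat (charge B - N)" for a
      using that \<open>N \<le> charge B - int n\<close> by (intro n) simp
    ultimately show ?thesis
      using beta_tail(1)[of "nat (charge B - N)" "beta_inv B" "charge B"]
        sum_bead_tail[OF B(1), of "nat (charge B - N)" "charge B"] B(2) by (simp add: bsize_def)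
  qed
  then show ?thesis by (rule that)
qed

text \<open>
  All size comparisons below rest on this: moving a single bead keeps the charge and changes the
  size by the distance moved, because the sum over a tail changes by that distance.
\<close>

lemma bead_move:
  assumes B: "beta_set B" and x: "x \<in> B" and y: "y \<notin> B"
  shows "beta_set (insert y (B - {x}))" "charge (insert y (B - {x})) = charge B"
    "int (bsize (insert y (B - {x}))) = int (bsize B) + y - x"
proof -
  define B' where "B' = insert y (B - {x})"
  obtain N1 M1 where N1: "{..<N1} \<subseteq> B" and M1: "B \<subseteq> {..<M1}" using B by (auto simp: beta_set_def)
  have "{..<min N1 x} \<subseteq> B'" and M: "B' \<subseteq> {..<max M1 (y + 1)}" using N1 M1 by (auto simp: B'_def)
  then show B': "beta_set B'" by (auto simp: beta_set_def)
  obtain N2 where N2: "\<And>N. N \<le> N2 \<Longrightarrow> {..<N} \<subseteq> B \<and> int (bsize B) = \<Sum>(B \<inter> {N..}) - \<Sum>{N..<charge B}"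
    using bsize_eventually[OF B] by blast
  obtain N3 where N3: "\<And>N. N \<le> N3 \<Longrightarrow> {..<N} \<subseteq> B' \<and> int (bsize B') = \<Sum>(B' \<inter> {N..}) - \<Sum>{N..<charge B'}"
    using bsize_eventually[OF B'] by blast
  define N where "N = min (min N2 N3) (min x y)"
  have N: "N \<le> N2" "N \<le> N3" "N \<le> x" "N \<le> y" by (auto simp: N_def)
  have fin: "finite (B \<inter> {N..})" using finite_tail[OF M1] .
  have tail: "B' \<inter> {N..} = insert y ((B \<inter> {N..}) - {x})" using N by (auto simp: B'_def)
  have "card (B' \<inter> {N..}) = Suc (card ((B \<inter> {N..}) - {x}))"
    unfolding tail using y fin by (subst card_insert_disjoint) auto
  also have "\<dots> = card (B \<inter> {N..})"
    using x N fin by (intro card_Suc_Diff1) auto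
  finally have "card (B' \<inter> {N..}) = card (B \<inter> {N..})" .
  then show c: "charge B' = charge B"
    using charge_eq_card[of N B] charge_eq_card[of N B'] N2[OF N(1)] N3[OF N(2)] M1 M by simp
  have "\<Sum>(B' \<inter> {N..}) = y + (\<Sum>(B \<inter> {N..}) - x)"
    unfolding tail using x y N fin by (simp add: sum_diff1)
  then show "int (bsize B') = int (bsize B) + y - x"
    using N2[OF N(1)] N3[OF N(2)] c by simp
qed

section \<open>Runners and the Uglov map\<close>

definition runner :: "nat \<Rightarrow> int set \<Rightarrow> nat \<Rightarrow> int set" where
  "runner e B i = {a. a * int e + int i \<in> B}"

lemma quot_nth: "i < e \<Longrightarrow> quot e B ! i = runner e B i"
  by (simp add: quot_def runner_def)

lemma quot_runner: "quot e B = map (runner e B) [0..<e]"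
  by (simp add: quot_def runner_def)

lemma wt_runner: "wt e B = (\<Sum>i<e. bsize (runner e B i))"
  unfolding wt_def quot_runner bsize_def
  by (simp add: comp_def interv_sum_list_conv_sum_set_nat atLeast0LessThan)

lemma core_runner: "core e B = {a * int e + int i | a i. i < e \<and> a < charge (runner e B i)}"
  unfolding core_def using quot_nth by metis

lemma runner_pos_eq_iff:
  assumes "i < e" "i' < e"
  shows "a * int e + int i = a' * int e + int i' \<longleftrightarrow> a = a' \<and> i = i'"
proof
  assume eq: "a * int e + int i = a' * int e + int i'"
  have "a = (a * int e + int i) div int e" "a' = (a' * int e + int i') div int e"
    using assms by auto
  then have "a = a'" using eq by metis
  then show "a = a' \<and> i = i'" using eq by simp
qed auto

lemma pos_decomp:
  fixes z :: int assumes "e > 0"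
  obtains a i where "i < e" "z = a * int e + int i"
proof
  show "nat (z mod int e) < e" using assms by (simp add: nat_less_iff)
  show "z = (z div int e) * int e + int (nat (z mod int e))" using assms by simp
qed

lemma runner_ext:
  assumes "e > 0" "\<And>i. i < e \<Longrightarrow> runner e B i = runner e B' i"
  shows "B = B'"
proof (rule Set.set_eqI)
  fix z
  obtain a i where "i < e" "z = a * int e + int i" using pos_decomp[OF assms(1)] .
  then show "z \<in> B \<longleftrightarrow> z \<in> B'" using assms(2)[of i] by (auto simp: runner_def)
qed

lemma pos_less_iff:
  assumes "i < e"
  shows "a * int e + int i < N * int e \<longleftrightarrow> a < N"
proof
  assume "a < N"
  then have "(a + 1) * int e \<le> N * int e" by (intro mult_right_mono) auto
  then show "a * int e + int i < N * int e" using assms by (simp add: algebra_simps)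
next
  assume *: "a * int e + int i < N * int e"
  show "a < N"
  proof (rule ccontr)
    assume "\<not> a < N"
    then have "N * int e \<le> a * int e" by (intro mult_right_mono) auto
    then show False using * by simp
  qed
qed

lemma beta_set_runner:
  assumes "beta_set B" "i < e"
  shows "beta_set (runner e B i)"
proof -
  obtain N M where N: "{..<N} \<subseteq> B" and M: "B \<subseteq> {..<M}" using assms by (auto simp: beta_set_def)
  have le: "\<bar>N\<bar> * 1 \<le> \<bar>N\<bar> * int e" "\<bar>M\<bar> * 1 \<le> \<bar>M\<bar> * int e"
    using assms(2) by (intro mult_left_mono; simp)+
  have "{..< - \<bar>N\<bar>} \<subseteq> runner e B i"
  proof
    fix a assume "a \<in> {..< - \<bar>N\<bar>}"
    then have "a < - \<bar>N\<bar>" by simp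
    then have "a * int e + int i < (- \<bar>N\<bar>) * int e" by (rule iffD2[OF pos_less_iff[OF assms(2)]])
    then have "a * int e + int i < N" using le by simp
    then show "a \<in> runner e B i" using N by (auto simp: runner_def)
  qed
  moreover have "runner e B i \<subseteq> {..< \<bar>M\<bar>}"
  proof
    fix a assume "a \<in> runner e B i"
    then have "a * int e + int i < M" using M by (auto simp: runner_def)
    then have "a * int e + int i < \<bar>M\<bar> * int e" using le by simp
    then show "a \<in> {..< \<bar>M\<bar>}" using pos_less_iff[OF assms(2)] by auto
  qed
  ultimately show ?thesis by (auto simp: beta_set_def)
qed

lemma runner_bounds:
  assumes e: "e > 0" and B: "\<And>i. i < e \<Longrightarrow> beta_set (runner e B i)"
  obtains N M where "{..<N * int e} \<subseteq> B" "B \<subseteq> {..<M * int e}"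
    "\<And>i. i < e \<Longrightarrow> {..<N} \<subseteq> runner e B i" "\<And>i. i < e \<Longrightarrow> runner e B i \<subseteq> {..<M}"
proof -
  have "\<exists>N M. \<forall>i<e. {..<N i} \<subseteq> runner e B i \<and> runner e B i \<subseteq> {..<M i}"
    using B unfolding beta_set_def by metis
  then obtain N M where NM: "\<And>i. i < e \<Longrightarrow> {..<N i} \<subseteq> runner e B i \<and> runner e B i \<subseteq> {..<M i}"
    by blast
  define N' M' where "N' = Min (N ` {..<e})" and "M' = Max (M ` {..<e})"
  have le: "N' \<le> N i" "M i \<le> M'" if "i < e" for i using that by (auto simp: N'_def M'_def)
  have 1: "{..<N'} \<subseteq> runner e B i" "runner e B i \<subseteq> {..<M'}" if "i < e" for i
    using NM[OF that] le[OF that] by fastforce+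
  have "{..<N' * int e} \<subseteq> B"
  proof
    fix z assume z: "z \<in> {..<N' * int e}"
    obtain a i where ai: "i < e" "z = a * int e + int i" using pos_decomp[OF e] .
    then have "a < N'" using z pos_less_iff by auto
    then show "z \<in> B" using 1(1)[OF ai(1)] ai(2) by (auto simp: runner_def)
  qed
  moreover have "B \<subseteq> {..<M' * int e}"
  proof
    fix z assume z: "z \<in> B"
    obtain a i where ai: "i < e" "z = a * int e + int i" using pos_decomp[OF e] .
    then have "a < M'" using z 1(2)[OF ai(1)] by (auto simp: runner_def)
    then show "z \<in> {..<M' * int e}" using ai pos_less_iff by auto
  qed
  ultimately show ?thesis using that 1 by blast
qed

lemma beta_set_of_runners:
  assumes "e > 0" "\<And>i. i < e \<Longrightarrow> beta_set (runner e B i)"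
  shows "beta_set B"
  using runner_bounds[OF assms] unfolding beta_set_def by metis

text \<open>
  Cutting every runner at the same level \<open>N\<close> cuts the whole set at \<open>N * e\<close>, and the beads above
  the cut are distributed over the runners.
\<close>

lemma charge_sum_runners:
  assumes e: "e > 0" and B: "beta_set B"
  shows "charge B = (\<Sum>i<e. charge (runner e B i))"
proof -
  obtain N M where NM: "{..<N * int e} \<subseteq> B" "B \<subseteq> {..<M * int e}"
    "\<And>i. i < e \<Longrightarrow> {..<N} \<subseteq> runner e B i" "\<And>i. i < e \<Longrightarrow> runner e B i \<subseteq> {..<M}"
    using runner_bounds[of e B thesis] beta_set_runner[OF B] e by blast
  define f where "f i a = a * int e + int i" for i :: nat and a :: int
  have ge: "f i a \<ge> N * int e \<longleftrightarrow> a \<ge> N" if "i < e" for i a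
    using pos_less_iff[OF that, of a N] by (auto simp: f_def)
  have "B \<inter> {N * int e..} = (\<Union>i\<in>{..<e}. f i ` (runner e B i \<inter> {N..}))" (is "?L = ?R")
  proof (intro equalityI subsetI)
    fix z assume z: "z \<in> ?L"
    obtain a i where ai: "i < e" "z = f i a" using pos_decomp[OF e] unfolding f_def .
    then have "a \<in> runner e B i \<inter> {N..}" using z ge by (auto simp: runner_def f_def)
    then show "z \<in> ?R" using ai by blast
  next
    fix z assume "z \<in> ?R"
    then show "z \<in> ?L" using ge by (auto simp: runner_def f_def)
  qed
  moreover have "card ?R = (\<Sum>i<e. card (f i ` (runner e B i \<inter> {N..})))"
    using NM(4) by (intro card_UN_disjoint) (auto simp: f_def runner_pos_eq_iff intro!: finite_tail)
  moreover have "card (f i ` (runner e B i \<inter> {N..})) = card (runner e B i \<inter> {N..})" for i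
    using e by (intro card_image) (auto simp: inj_on_def f_def)
  ultimately have card: "card (B \<inter> {N * int e..}) = (\<Sum>i<e. card (runner e B i \<inter> {N..}))" by simp
  have "(\<Sum>i<e. charge (runner e B i)) = (\<Sum>i<e. int (card (runner e B i \<inter> {N..})) + N)"
    using NM(3,4) by (intro sum.cong refl charge_eq_card) auto
  also have "\<dots> = int (card (B \<inter> {N * int e..})) + N * int e"
    by (simp add: card sum.distrib)
  also have "\<dots> = charge B" using charge_eq_card[OF NM(1,2)] by simp
  finally show ?thesis by simp
qed

lemma runner_core: "i < e \<Longrightarrow> runner e (core e B) i = {..<charge (runner e B i)}"
  by (auto simp: core_runner runner_def runner_pos_eq_iff)

text \<open>
  The core forgets everything except the charges of the runners, and recovering it from its
  partition requires only the total charge.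
\<close>

lemma core_beta_inv_eq_iff:
  assumes e: "e > 0" and B: "beta_set B" "beta_set B'" "charge B = charge B'"
  shows "beta_inv (core e B) = beta_inv (core e B') \<longleftrightarrow>
    (\<forall>i<e. charge (runner e B i) = charge (runner e B' i))"
proof -
  have bs: "beta_set (core e B)" "charge (core e B) = charge B" if "beta_set B" for B
  proof -
    show "beta_set (core e B)"
      by (rule beta_set_of_runners[OF e]) (simp add: runner_core bsize_lessThan(1))
    then have "charge (core e B) = (\<Sum>i<e. charge (runner e B i))"
      by (subst charge_sum_runners[OF e]) (simp_all add: runner_core bsize_lessThan(2))
    then show "charge (core e B) = charge B" using charge_sum_runners[OF e that] by simp
  qed
  show ?thesis
  proof
    assume "beta_inv (core e B) = beta_inv (core e B')"
    then have "core e B = core e B'" using B bs by (intro beta_inv_inj) auto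
    then have "{..<charge (runner e B i)} = {..<charge (runner e B' i)}" if "i < e" for i
      using runner_core[OF that] by metis
    then show "\<forall>i<e. charge (runner e B i) = charge (runner e B' i)" by (simp add: lessThan_eq_iff)
  next
    assume *: "\<forall>i<e. charge (runner e B i) = charge (runner e B' i)"
    have "core e B = core e B'" by (rule runner_ext[OF e]) (simp add: runner_core *)
    then show "beta_inv (core e B) = beta_inv (core e B')" by simp
  qed
qed

text \<open>
  The set with 2-quotient \<open>(D, C)\<close>; in level two each runner of the Uglov set has this form.
\<close>

definition interleave :: "int set \<Rightarrow> int set \<Rightarrow> int set" where
  "interleave C D = (\<lambda>a. 2 * a + 1) ` C \<union> (\<lambda>a. 2 * a) ` D"

lemma odd_mem_interleave [simp]: "2 * a + 1 \<in> interleave C D \<longleftrightarrow> a \<in> C"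
  by (auto simp: interleave_def) presburger

lemma even_mem_interleave [simp]: "2 * a \<in> interleave C D \<longleftrightarrow> a \<in> D"
  by (auto simp: interleave_def) presburger

lemma runner_interleave: "runner 2 (interleave C D) 0 = D" "runner 2 (interleave C D) 1 = C"
  by (auto simp: runner_def mult.commute[of _ 2])

lemma interleave_beta:
  assumes "beta_set C" "beta_set D"
  shows "beta_set (interleave C D)" "charge (interleave C D) = charge C + charge D"
proof -
  show *: "beta_set (interleave C D)"
    by (rule beta_set_of_runners[of 2])
      (use assms runner_interleave[of C D] in \<open>auto simp: less_2_cases_iff\<close>)
  show "charge (interleave C D) = charge C + charge D"
    using charge_sum_runners[OF _ *, of 2] runner_interleave[of C D] by (simp add: numeral_2_eq_2)
qed

lemma interleave_shift:
  "interleave ((\<lambda>z. z + k) ` C) ((\<lambda>z. z + k) ` D) = (\<lambda>z. z + 2 * k) ` interleave C D"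
  by (simp add: interleave_def image_Un image_image algebra_simps)

text \<open>
  Transferring a bead between the two components on one runner moves a single bead of the
  interleaved set, so that the size changes by an odd distance that depends on the two levels.
\<close>

lemma interleave_move_down:
  "interleave (C - {u}) (insert v D) = insert (2 * v) (interleave C D - {2 * u + 1})"
  by (auto simp: interleave_def) presburger+

lemma interleave_move_up:
  "interleave (insert u C) (D - {v}) = insert (2 * u + 1) (interleave C D - {2 * v})"
  by (auto simp: interleave_def) presburger+

lemma runner_uglov:
  assumes "b < e"
  shows "runner e (uglov e [C, D]) b = interleave (runner e C b) (runner e D b)"
proof -
  have e: "e > 0" using assms by simp
  have C: "a * int e + int b \<in> upsilon e 2 1 ` C \<longleftrightarrow> (\<exists>c. a = 2 * c + 1 \<and> c * int e + int b \<in> C)" for a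
  proof
    assume "a * int e + int b \<in> upsilon e 2 1 ` C"
    then obtain x where x: "x \<in> C" "a * int e + int b = upsilon e 2 1 x" by auto
    obtain c i where ci: "i < e" "x = c * int e + int i" using pos_decomp[OF e] .
    have "upsilon e 2 1 x = (2 * c + 1) * int e + int i"
      using ci by (simp add: upsilon_def algebra_simps)
    then have "a = 2 * c + 1" "b = i" using x(2) runner_pos_eq_iff[OF assms ci(1)] by metis+
    then show "\<exists>c. a = 2 * c + 1 \<and> c * int e + int b \<in> C" using x ci by auto
  next
    assume "\<exists>c. a = 2 * c + 1 \<and> c * int e + int b \<in> C"
    then obtain c where c: "a = 2 * c + 1" "c * int e + int b \<in> C" by auto
    have "upsilon e 2 1 (c * int e + int b) = a * int e + int b"
      using assms c by (simp add: upsilon_def algebra_simps)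
    then show "a * int e + int b \<in> upsilon e 2 1 ` C" using c(2) by (metis imageI)
  qed
  have D: "a * int e + int b \<in> upsilon e 2 2 ` D \<longleftrightarrow> (\<exists>c. a = 2 * c \<and> c * int e + int b \<in> D)" for a
  proof
    assume "a * int e + int b \<in> upsilon e 2 2 ` D"
    then obtain x where x: "x \<in> D" "a * int e + int b = upsilon e 2 2 x" by auto
    obtain c i where ci: "i < e" "x = c * int e + int i" using pos_decomp[OF e] .
    have "upsilon e 2 2 x = (2 * c) * int e + int i"
      using ci by (simp add: upsilon_def algebra_simps)
    then have "a = 2 * c" "b = i" using x(2) runner_pos_eq_iff[OF assms ci(1)] by metis+
    then show "\<exists>c. a = 2 * c \<and> c * int e + int b \<in> D" using x ci by auto
  next
    assume "\<exists>c. a = 2 * c \<and> c * int e + int b \<in> D"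
    then obtain c where c: "a = 2 * c" "c * int e + int b \<in> D" by auto
    have "upsilon e 2 2 (c * int e + int b) = a * int e + int b"
      using assms c by (simp add: upsilon_def algebra_simps)
    then show "a * int e + int b \<in> upsilon e 2 2 ` D" using c(2) by (metis imageI)
  qed
  have "uglov e [C, D] = upsilon e 2 1 ` C \<union> upsilon e 2 2 ` D"
    by (auto simp: uglov_def lessThan_Suc numeral_2_eq_2)
  then show ?thesis using C D by (auto simp: runner_def interleave_def)
qed

definition pair_charge :: "nat \<Rightarrow> int set \<Rightarrow> int set \<Rightarrow> nat \<Rightarrow> int" where
  "pair_charge e C D b = charge (runner e C b) + charge (runner e D b)"

definition pair_wt :: "nat \<Rightarrow> int set \<Rightarrow> int set \<Rightarrow> nat" where
  "pair_wt e C D = (\<Sum>b<e. bsize (interleave (runner e C b) (runner e D b)))"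

lemma wt_uglov: "wt e (uglov e [C, D]) = pair_wt e C D"
  by (simp add: wt_runner pair_wt_def runner_uglov)

lemma core_uglov_eq_iff:
  assumes e: "e > 0" and "beta_set C" "beta_set D" "beta_set C'" "beta_set D'"
    and "charge C = charge C'" "charge D = charge D'"
  shows "beta_inv (core e (uglov e [C, D])) = beta_inv (core e (uglov e [C', D'])) \<longleftrightarrow>
    (\<forall>b<e. pair_charge e C D b = pair_charge e C' D' b)"
proof -
  have r: "charge (runner e (uglov e [C, D]) b) = pair_charge e C D b"
    if "beta_set C" "beta_set D" "b < e" for C D b
    using that by (simp add: runner_uglov interleave_beta beta_set_runner pair_charge_def)
  have bs: "beta_set (uglov e [C, D])" if "beta_set C" "beta_set D" for C D
    by (rule beta_set_of_runners[OF e]) (simp add: runner_uglov that interleave_beta beta_set_runner)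
  have ch: "charge (uglov e [C, D]) = charge C + charge D" if "beta_set C" "beta_set D" for C D
    using charge_sum_runners[OF e bs[OF that]] charge_sum_runners[OF e that(1)]
      charge_sum_runners[OF e that(2)] r[OF that]
    by (simp add: pair_charge_def sum.distrib)
  show ?thesis using assms by (subst core_beta_inv_eq_iff[OF e]) (simp_all add: bs ch r)
qed

section \<open>Swapping adjacent runners\<close>

text \<open>
  The simple reflection \<open>s\<^sub>j\<close> acting on positions: it exchanges each position of residue \<open>j\<close> with
  its predecessor.
\<close>

definition swap_pos :: "nat \<Rightarrow> nat \<Rightarrow> int \<Rightarrow> int" where
  "swap_pos e j z = (if z mod int e = int j then z - 1
     else if (z + 1) mod int e = int j then z + 1 else z)"

text \<open>
  The runner \<open>pred_runner e j\<close> carries the positions just before those of runner \<open>j\<close>. For \<open>j = 0\<close>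
  the predecessor lies on the last runner one level lower; \<open>wrap j\<close> records this change of level,
  which lets all \<open>j\<close> be treated uniformly.
\<close>

definition pred_runner :: "nat \<Rightarrow> nat \<Rightarrow> nat" where
  "pred_runner e j = (if j = 0 then e - 1 else j - 1)"

definition wrap :: "nat \<Rightarrow> int" where
  "wrap j = (if j = 0 then 1 else 0)"

lemma pred_runner: "e \<ge> 2 \<Longrightarrow> j < e \<Longrightarrow> pred_runner e j < e \<and> pred_runner e j \<noteq> j"
  by (auto simp: pred_runner_def)

lemma pos_mod: "i < e \<Longrightarrow> (a * int e + int i) mod int e = int i"
  by simp

lemma pos_before:
  assumes "e \<ge> 2" "j < e"
  shows "a * int e + int j - 1 = (a - wrap j) * int e + int (pred_runner e j)"
  using assms by (auto simp: pred_runner_def wrap_def algebra_simps of_nat_diff)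

lemma pos_after:
  assumes "e \<ge> 2" "j < e"
  shows "a * int e + int (pred_runner e j) + 1 = (a + wrap j) * int e + int j"
  using pos_before[OF assms, of "a + wrap j"] by simp

lemma swap_pos_runner:
  assumes e: "e \<ge> 2" "j < e" and i: "i < e"
  shows "swap_pos e j (a * int e + int i) =
    (if i = j then (a - wrap j) * int e + int (pred_runner e j)
     else if i = pred_runner e j then (a + wrap j) * int e + int j else a * int e + int i)"
proof -
  have 2: "(a * int e + int i + 1) mod int e = int j \<longleftrightarrow> i = pred_runner e j"
  proof
    assume *: "(a * int e + int i + 1) mod int e = int j"
    define a' where "a' = (a * int e + int i + 1) div int e"
    have "a * int e + int i + 1 = a' * int e + int j" using * unfolding a'_def by (metis div_mult_mod_eq)
    then have "a * int e + int i = (a' - wrap j) * int e + int (pred_runner e j)"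
      using pos_before[OF e, of a'] by linarith
    then show "i = pred_runner e j"
      using runner_pos_eq_iff[OF i, of "pred_runner e j" a "a' - wrap j"] pred_runner[OF e] by blast
  next
    assume "i = pred_runner e j"
    then show "(a * int e + int i + 1) mod int e = int j"
      using pos_after[OF e, of a] pos_mod[OF e(2)] by simp
  qed
  show ?thesis
    using 2 pos_mod[OF i, of a] pos_before[OF e, of a] pos_after[OF e, of a]
    unfolding swap_pos_def by auto
qed

lemma swap_pos_invol:
  assumes e: "e \<ge> 2" "j < e"
  shows "swap_pos e j (swap_pos e j z) = z"
proof -
  have "e > 0" using e by simp
  then obtain a i where z: "i < e" "z = a * int e + int i" by (rule pos_decomp)
  show ?thesis using pred_runner[OF e] z e by (auto simp: swap_pos_runner)
qed

lemma mem_swap_image: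
  assumes e: "e \<ge> 2" "j < e"
  shows "z \<in> swap_pos e j ` B \<longleftrightarrow> swap_pos e j z \<in> B"
proof
  assume "z \<in> swap_pos e j ` B"
  then show "swap_pos e j z \<in> B" using swap_pos_invol[OF e] by auto
next
  assume "swap_pos e j z \<in> B"
  then have "swap_pos e j (swap_pos e j z) \<in> swap_pos e j ` B" by (rule imageI)
  then show "z \<in> swap_pos e j ` B" by (simp only: swap_pos_invol[OF e])
qed

lemma shift_image_eq: "(\<lambda>z. z + k) ` B = {z. z - k \<in> B}" for k :: int
  by (auto simp: image_iff) (metis diff_add_cancel)

lemma runner_swap:
  assumes e: "e \<ge> 2" "j < e" and i: "i < e"
  shows "runner e (swap_pos e j ` B) i =
    (if i = j then (\<lambda>z. z + wrap j) ` runner e B (pred_runner e j)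
     else if i = pred_runner e j then (\<lambda>z. z + - wrap j) ` runner e B j
     else runner e B i)"
  unfolding shift_image_eq runner_def using e i by (auto simp: mem_swap_image swap_pos_runner)

text \<open>
  The action of \<open>s\<^sub>j\<close> on the charges of the interleaved runners. A change of level by one in both
  components shifts an interleaved set by two, whence the factor 2.
\<close>

definition swap_charge :: "nat \<Rightarrow> nat \<Rightarrow> (nat \<Rightarrow> int) \<Rightarrow> nat \<Rightarrow> int" where
  "swap_charge e j c i = (if i = j then c (pred_runner e j) + 2 * wrap j
     else if i = pred_runner e j then c j - 2 * wrap j else c i)"

lemmas bsize_shift_down = bsize_shift[of _ "- k" for k, simplified]

lemma interleave_shift_down:
  "interleave ((\<lambda>z. z - k) ` C) ((\<lambda>z. z - k) ` D) = (\<lambda>z. z - 2 * k) ` interleave C D"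
  using interleave_shift[of "- k" C D] by simp

lemma charge_runner_swap:
  assumes e: "e \<ge> 2" "j < e" and i: "i < e" and B: "beta_set B"
  shows "charge (runner e (swap_pos e j ` B) i) =
    (if i = j then charge (runner e B (pred_runner e j)) + wrap j
     else if i = pred_runner e j then charge (runner e B j) - wrap j
     else charge (runner e B i))"
  using assms pred_runner[OF e] by (simp add: runner_swap beta_set_runner bsize_shift bsize_shift_down)

lemma sum_swap:
  assumes e: "e \<ge> 2" "j < e"
  shows "(\<Sum>i<e. if i = j then f (pred_runner e j) else if i = pred_runner e j then f j else f i)
    = (\<Sum>i<e. f i)"
  by (rule sum.reindex_bij_witness[of _ "Transposition.transpose j (pred_runner e j)"
        "Transposition.transpose j (pred_runner e j)"])
    (use e pred_runner[OF e] in \<open>auto simp: Transposition.transpose_def\<close>)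

lemma pair_charge_swap:
  assumes "e \<ge> 2" "j < e" "i < e" "beta_set C" "beta_set D"
  shows "pair_charge e (swap_pos e j ` C) (swap_pos e j ` D) i = swap_charge e j (pair_charge e C D) i"
  using assms by (simp add: pair_charge_def swap_charge_def charge_runner_swap)

lemma pair_wt_swap:
  assumes e: "e \<ge> 2" "j < e" and CD: "beta_set C" "beta_set D"
  shows "pair_wt e (swap_pos e j ` C) (swap_pos e j ` D) = pair_wt e C D"
proof -
  let ?q = "\<lambda>C D i. interleave (runner e C i) (runner e D i)" and ?p = "pred_runner e j"
  let ?f = "\<lambda>i. bsize (?q C D i)"
  have "bsize (?q (swap_pos e j ` C) (swap_pos e j ` D) i) =
      (if i = j then ?f ?p else if i = ?p then ?f j else ?f i)" if "i < e" for i
    using that e CD pred_runner[OF e]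
    unfolding runner_swap[OF e that]
    by (auto simp: interleave_shift interleave_shift_down bsize_shift bsize_shift_down interleave_beta beta_set_runner)
  then show ?thesis unfolding pair_wt_def using sum_swap[OF e, of ?f] by simp
qed

section \<open>Cores on the abacus and the exchange of beads\<close>

text \<open>
  Being an \<open>e\<close>-core, expressed for the beta-set: every bead has a bead directly below it on its
  runner. This form is visibly invariant under shifts, hence independent of the charge.
\<close>

definition pos_core :: "nat \<Rightarrow> int set \<Rightarrow> bool" where
  "pos_core e B \<longleftrightarrow> (\<forall>z\<in>B. z - int e \<in> B)"

lemma pos_core_runner:
  assumes "e > 0" "beta_set B"
  shows "pos_core e B \<longleftrightarrow> (\<forall>i<e. runner e B i = {..<charge (runner e B i)})"
proof -
  have "pos_core e B \<longleftrightarrow> (\<forall>i<e. \<forall>a\<in>runner e B i. a - 1 \<in> runner e B i)"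
  proof
    assume "pos_core e B"
    then show "\<forall>i<e. \<forall>a\<in>runner e B i. a - 1 \<in> runner e B i"
      by (auto simp: pos_core_def runner_def algebra_simps)
  next
    assume *: "\<forall>i<e. \<forall>a\<in>runner e B i. a - 1 \<in> runner e B i"
    show "pos_core e B" unfolding pos_core_def
    proof
      fix z assume z: "z \<in> B"
      obtain a i where ai: "i < e" "z = a * int e + int i" using pos_decomp[OF assms(1)] .
      then show "z - int e \<in> B" using * z by (auto simp: runner_def algebra_simps)
    qed
  qed
  then show ?thesis using down_closed_iff[OF beta_set_runner[OF assms(2)]] by auto
qed

lemma partition_wt_eq_0_iff:
  assumes e: "e > 0" and p: "is_partition p"
  shows "partition_wt e p = 0 \<longleftrightarrow> pos_core e (beta t p)"
proof -
  have "partition_wt e p = 0 \<longleftrightarrow> pos_core e (beta 0 p)"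
    unfolding partition_wt_def wt_runner pos_core_runner[OF e beta_set_beta[OF p]]
    using beta_set_runner[OF beta_set_beta[OF p]] bsize_eq_0_iff by auto
  also have "\<dots> \<longleftrightarrow> pos_core e (beta t p)"
    using beta_shift[of 0 t p] by (auto simp: pos_core_def)
  finally show ?thesis .
qed

lemma pos_core_swap:
  assumes e: "e \<ge> 2" "j < e" and B: "beta_set B"
  shows "pos_core e (swap_pos e j ` B) \<longleftrightarrow> pos_core e B"
proof -
  have s: "swap_pos e j (z - int e) = swap_pos e j z - int e" for z
  proof -
    have "(z - int e + 1) mod int e = (z + 1) mod int e" by (metis add_diff_eq diff_add_eq minus_mod_self2)
    then show ?thesis by (auto simp: swap_pos_def)
  qed
  show ?thesis unfolding pos_core_def
    using swap_pos_invol[OF e] mem_swap_image[OF e] s by (metis imageI)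
qed

lemma runner_insert:
  assumes "i < e" "b < e"
  shows "runner e (insert (a * int e + int b) B) i =
    (if i = b then insert a (runner e B i) else runner e B i)"
  using runner_pos_eq_iff[OF assms] by (auto simp: runner_def)

lemma runner_remove:
  assumes "i < e" "b < e"
  shows "runner e (B - {a * int e + int b}) i =
    (if i = b then runner e B i - {a} else runner e B i)"
  using runner_pos_eq_iff[OF assms] by (auto simp: runner_def)

text \<open>
  If two runners \<open>a\<close>, \<open>b\<close> of a pair of cores have differences \<open>x - y\<close> more than 2 apart, then
  moving one bead of the first component from \<open>a\<close> to \<open>b\<close> and one bead of the second component from
  \<open>b\<close> to \<open>a\<close> preserves all charges and saves weight. The saving is even, and raising the bead just
  placed on runner \<open>b\<close> by \<open>h\<close> further levels spends it exactly, which destroys the core property.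
\<close>

lemma exchange:
  assumes C: "beta_set C" and D: "beta_set D"
    and cC: "\<And>i. i < e \<Longrightarrow> runner e C i = {..<x i}" and cD: "\<And>i. i < e \<Longrightarrow> runner e D i = {..<y i}"
    and ab: "a < e" "b < e" and d: "(x a - y a) - (x b - y b) > 2"
  shows "\<exists>C' D'. beta_set C' \<and> beta_set D' \<and> charge C' = charge C \<and> charge D' = charge D \<and>
     (\<forall>i<e. pair_charge e C' D' i = pair_charge e C D i) \<and> pair_wt e C' D' = pair_wt e C D \<and>
     \<not> pos_core e C'"
proof -
  \<comment> \<open>the plain exchange lowers the weight by \<open>2 * h\<close>, and raising a bead by \<open>h\<close> levels in the
  first component restores \<open>2 * h\<close>\<close>
  define h where "h = (x a - y a) - (x b - y b) - 2"
  have h: "h > 0" using d by (simp add: h_def)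
  have ne: "a \<noteq> b" using d by auto
  define C' where "C' = insert ((x b + h) * int e + int b) (C - {(x a - 1) * int e + int a})"
  define D' where "D' = insert (y a * int e + int a) (D - {(y b - 1) * int e + int b})"
  have mC: "u * int e + int i \<in> C \<longleftrightarrow> u < x i" if "i < e" for u i
    using cC[OF that] by (auto simp: runner_def)
  have mD: "u * int e + int i \<in> D \<longleftrightarrow> u < y i" if "i < e" for u i
    using cD[OF that] by (auto simp: runner_def)
  have C': "beta_set C'" "charge C' = charge C"
    unfolding C'_def using C mC ab h by (intro bead_move; simp)+
  have D': "beta_set D'" "charge D' = charge D"
    unfolding D'_def using D mD ab h by (intro bead_move; simp)+
  have r: "runner e C' i = (if i = a then {..<x a} - {x a - 1} else if i = b then insert (x b + h) {..<x b}
      else {..<x i})"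
    "runner e D' i = (if i = a then insert (y a) {..<y a} else if i = b then {..<y b} - {y b - 1}
      else {..<y i})" if "i < e" for i
    unfolding C'_def D'_def using that ab ne cC cD by (simp_all add: runner_insert runner_remove)
  let ?Q = "\<lambda>i. interleave (runner e C i) (runner e D i)"
  let ?Q' = "\<lambda>i. interleave (runner e C' i) (runner e D' i)"
  have Q: "beta_set (?Q i)" "charge (?Q i) = pair_charge e C D i" if "i < e" for i
    using that C D by (auto simp: interleave_beta beta_set_runner pair_charge_def)
  have Q': "charge (?Q' i) = pair_charge e C' D' i" if "i < e" for i
    using that C' D' by (auto simp: interleave_beta beta_set_runner pair_charge_def)
  have mQ: "2 * u + 1 \<in> ?Q i \<longleftrightarrow> u < x i" "2 * u \<in> ?Q i \<longleftrightarrow> u < y i" if "i < e" for u i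
    using that by (auto simp: cC cD)
  have Qa: "?Q' a = insert (2 * y a) (?Q a - {2 * (x a - 1) + 1})"
    using ab by (simp add: r cC cD interleave_move_down)
  have Qb: "?Q' b = insert (2 * (x b + h) + 1) (?Q b - {2 * (y b - 1)})"
    using ab ne by (simp add: r cC cD interleave_move_up)
  have sa: "charge (?Q' a) = charge (?Q a)"
      "int (bsize (?Q' a)) = int (bsize (?Q a)) + 2 * y a - (2 * (x a - 1) + 1)"
    unfolding Qa using bead_move[OF Q(1)[OF ab(1)], of "2 * (x a - 1) + 1" "2 * y a"]
      mQ(1)[OF ab(1), of "x a - 1"] mQ(2)[OF ab(1), of "y a"] by auto
  have sb: "charge (?Q' b) = charge (?Q b)"
      "int (bsize (?Q' b)) = int (bsize (?Q b)) + (2 * (x b + h) + 1) - 2 * (y b - 1)"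
    unfolding Qb using bead_move[OF Q(1)[OF ab(2)], of "2 * (y b - 1)" "2 * (x b + h) + 1"]
      mQ(1)[OF ab(2), of "x b + h"] mQ(2)[OF ab(2), of "y b - 1"] h by auto
  have other: "?Q' i = ?Q i" if "i < e" "i \<noteq> a" "i \<noteq> b" for i
    using that by (simp add: r cC cD)
  have "pair_charge e C' D' i = pair_charge e C D i" if "i < e" for i
    using Q(2)[OF that] Q'[OF that] sa(1) sb(1) other[OF that] by (cases "i = a"; cases "i = b") auto
  moreover have "pair_wt e C' D' = pair_wt e C D"
  proof -
    have split: "(\<Sum>i<e. f i) = f a + f b + (\<Sum>i\<in>{..<e} - {a, b}. f i)" for f :: "nat \<Rightarrow> nat"
      using ab ne by (subst sum.subset_diff[of "{a, b}"]) auto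
    have "bsize (?Q' a) + bsize (?Q' b) = bsize (?Q a) + bsize (?Q b)"
      using sa(2) sb(2) by (simp add: h_def)
    then show ?thesis unfolding pair_wt_def split using other by simp
  qed
  moreover have "\<not> pos_core e C'"
  proof
    assume "pos_core e C'"
    then have "runner e C' b = {..<charge (runner e C' b)}"
      using ab C' pos_core_runner[of e C'] by simp
    then obtain k where "runner e C' b = {..<k}" by blast
    moreover have "x b + h \<in> runner e C' b" "x b + h - 1 \<notin> runner e C' b" using ab ne h by (auto simp: r)
    ultimately show False by auto
  qed
  ultimately show ?thesis using C' D' by blast
qed

section \<open>Addable and removable nodes as bead moves\<close>

lemma mem_nodes [simp]: "(a, b, i) \<in> nodes lam \<longleftrightarrow> i < length lam \<and> b < (lam ! i) a"
  by (simp add: nodes_def)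

lemma nodes_inj:
  assumes "length lam = length mu" "nodes lam = nodes mu"
  shows "lam = mu"
proof (rule nth_equalityI[OF assms(1)], rule ext)
  fix i a assume i: "i < length lam"
  have "b < (lam ! i) a \<longleftrightarrow> b < (mu ! i) a" for b
    using assms i mem_nodes[of a b i lam] mem_nodes[of a b i mu] by simp
  then show "(lam ! i) a = (mu ! i) a" by (metis less_irrefl linorder_neqE_nat)
qed

lemma multipartition_nth: "lam \<in> multipartitions l \<Longrightarrow> i < l \<Longrightarrow> is_partition (lam ! i)"
  by (auto simp: multipartitions_def)

lemma multipartition_length: "lam \<in> multipartitions l \<Longrightarrow> length lam = l"
  by (auto simp: multipartitions_def)

lemma partition_antimono: "is_partition p \<Longrightarrow> a \<le> a' \<Longrightarrow> p a' \<le> p a"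
  using antimonoD[of p a a'] by (simp add: is_partition_def)

lemma partition_update:
  assumes p: "is_partition p" and "\<And>a'. a' < a \<Longrightarrow> b \<le> p a'" "\<And>a'. a < a' \<Longrightarrow> p a' \<le> b"
  shows "is_partition (p(a := b))"
proof -
  have "finite {x. (p(a := b)) x \<noteq> 0}"
    by (rule finite_subset[of _ "insert a {x. p x \<noteq> 0}"]) (use p in \<open>auto simp: is_partition_def\<close>)
  moreover have "antimono (p(a := b))"
    by (rule antimonoI) (use partition_antimono[OF p] assms(2,3) in \<open>auto simp: le_less\<close>)
  ultimately show ?thesis by (simp add: is_partition_def)
qed

lemma addable_iff:
  assumes lam: "lam \<in> multipartitions l"
  shows "(a, b, i) \<in> addable lam \<longleftrightarrow>
    i < l \<and> b = (lam ! i) a \<and> (a = 0 \<or> (lam ! i) a < (lam ! i) (a - 1))" (is "?L \<longleftrightarrow> ?R")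
proof
  have len: "length lam = l" using lam by (simp add: multipartitions_def)
  assume ?L
  then obtain mu where mu: "mu \<in> multipartitions l" "nodes mu = insert (a, b, i) (nodes lam)"
    and notin: "(a, b, i) \<notin> nodes lam"
    unfolding addable_def len by auto
  have mem: "i' < l \<and> b' < (mu ! i') a' \<longleftrightarrow> (a', b', i') = (a, b, i) \<or> (i' < l \<and> b' < (lam ! i') a')"
    for a' b' i'
    using mu(2) multipartition_length[OF mu(1)] len
    by (metis insert_iff mem_nodes)
  have i: "i < l" and b: "b < (mu ! i) a" using mem[of i b a] by auto
  have "b = (lam ! i) a"
    using mem[of i "(lam ! i) a" a] i b notin len by (cases "b = (lam ! i) a") auto
  moreover have "(lam ! i) a < (lam ! i) (a - 1)" if "a > 0"
  proof -
    have "b < (mu ! i) (a - 1)"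
      using b partition_antimono[OF multipartition_nth[OF mu(1) i], of "a - 1" a] by simp
    then show ?thesis using mem[of i b "a - 1"] i that \<open>b = (lam ! i) a\<close> by auto
  qed
  ultimately show ?R using i by auto
next
  assume R: ?R
  have len: "length lam = l" using lam by (simp add: multipartitions_def)
  have p: "is_partition (lam ! i)" using lam R by (auto simp: multipartitions_def)
  have "is_partition ((lam ! i)(a := Suc b))"
  proof (rule partition_update[OF p])
    fix a' assume "a' < a"
    then have "(lam ! i) (a - 1) \<le> (lam ! i) a'" using partition_antimono[OF p, of a' "a - 1"] by simp
    then show "Suc b \<le> (lam ! i) a'" using R \<open>a' < a\<close> by auto
  next
    fix a' assume "a < a'"
    then show "(lam ! i) a' \<le> Suc b" using partition_antimono[OF p, of a a'] R by simp
  qed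
  then have "lam[i := (lam ! i)(a := Suc b)] \<in> multipartitions l"
    using lam set_update_subset_insert[of lam i "(lam ! i)(a := Suc b)"]
    by (auto simp: multipartitions_def)
  moreover have "nodes (lam[i := (lam ! i)(a := Suc b)]) = insert (a, b, i) (nodes lam)"
    using R len by (auto simp: nodes_def nth_list_update split: if_splits)
  ultimately show ?L using R len unfolding addable_def by auto
qed

lemma removable_iff:
  assumes lam: "lam \<in> multipartitions l"
  shows "(a, b, i) \<in> removable lam \<longleftrightarrow>
    i < l \<and> (lam ! i) a = Suc b \<and> (lam ! i) (Suc a) \<le> b" (is "?L \<longleftrightarrow> ?R")
proof
  have len: "length lam = l" using lam by (simp add: multipartitions_def)
  assume ?L
  then obtain mu where mu: "mu \<in> multipartitions l" "nodes mu = nodes lam - {(a, b, i)}"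
    and isin: "(a, b, i) \<in> nodes lam"
    unfolding removable_def len by auto
  have mem: "i' < l \<and> b' < (mu ! i') a' \<longleftrightarrow> (a', b', i') \<noteq> (a, b, i) \<and> (i' < l \<and> b' < (lam ! i') a')"
    for a' b' i'
    using mu(2) multipartition_length[OF mu(1)] len
    by (metis Diff_iff singleton_iff mem_nodes)
  have i: "i < l" and b: "b < (lam ! i) a" using isin len by auto
  have nb: "\<not> b < (mu ! i) a" using mem[of i b a] i by auto
  have "(lam ! i) a = Suc b"
    using mem[of i "Suc b" a] i b nb by (cases "(lam ! i) a = Suc b") auto
  moreover have "(lam ! i) (Suc a) \<le> b"
  proof (rule ccontr)
    assume "\<not> ?thesis"
    then have "b < (mu ! i) (Suc a)" using mem[of i b "Suc a"] i by auto
    then show False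
      using nb partition_antimono[OF multipartition_nth[OF mu(1) i], of a "Suc a"] by simp
  qed
  ultimately show ?R using i by auto
next
  assume R: ?R
  have len: "length lam = l" using lam by (simp add: multipartitions_def)
  have p: "is_partition (lam ! i)" using lam R by (auto simp: multipartitions_def)
  have "is_partition ((lam ! i)(a := b))"
  proof (rule partition_update[OF p])
    fix a' assume "a' < a"
    then show "b \<le> (lam ! i) a'" using partition_antimono[OF p, of a' a] R by simp
  next
    fix a' assume "a < a'"
    then show "(lam ! i) a' \<le> b" using partition_antimono[OF p, of "Suc a" a'] R by simp
  qed
  then have "lam[i := (lam ! i)(a := b)] \<in> multipartitions l"
    using lam set_update_subset_insert[of lam i "(lam ! i)(a := b)"]
    by (auto simp: multipartitions_def)
  moreover have "nodes (lam[i := (lam ! i)(a := b)]) = nodes lam - {(a, b, i)}"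
    using R len by (auto simp: nodes_def nth_list_update split: if_splits)
  ultimately show ?L using R len unfolding removable_def by auto
qed

text \<open>
  A node can be added to row \<open>a\<close> exactly when the position after the bead of that row is free, and
  removed exactly when the position before it is free.
\<close>

lemma bead_succ_mem_iff:
  assumes p: "is_partition p"
  shows "bead t p a + 1 \<in> beta t p \<longleftrightarrow> \<not> (a = 0 \<or> p a < p (a - 1))"
proof
  assume "bead t p a + 1 \<in> beta t p"
  then obtain a' where a': "bead t p a' = bead t p a + 1" by (auto simp: beta_range)
  then have "a' < a" using bead_less_iff[OF p, of t a a'] by simp
  moreover have "\<not> a' < a - 1"
  proof
    assume "a' < a - 1"
    then have "bead t p (a - 1) < bead t p a'" "bead t p a < bead t p (a - 1)"
      by (auto intro!: bead_strict[OF p])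
    then show False using a' by simp
  qed
  ultimately have "a' = a - 1" by simp
  then show "\<not> (a = 0 \<or> p a < p (a - 1))" using a' \<open>a' < a\<close> by (auto simp: bead_def)
next
  assume *: "\<not> (a = 0 \<or> p a < p (a - 1))"
  then have "p (a - 1) = p a" using partition_antimono[OF p, of "a - 1" a] by simp
  then have "bead t p (a - 1) = bead t p a + 1" using * by (simp add: bead_def of_nat_diff)
  then show "bead t p a + 1 \<in> beta t p" by (metis beta_range rangeI)
qed

lemma bead_pred_mem_iff:
  assumes p: "is_partition p"
  shows "bead t p a - 1 \<in> beta t p \<longleftrightarrow> \<not> p (Suc a) < p a"
proof
  assume "bead t p a - 1 \<in> beta t p"
  then obtain a' where a': "bead t p a' = bead t p a - 1" by (auto simp: beta_range)
  then have "a < a'" using bead_less_iff[OF p, of t a' a] by simp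
  moreover have "\<not> Suc a < a'"
  proof
    assume "Suc a < a'"
    then have "bead t p a' < bead t p (Suc a)" "bead t p (Suc a) < bead t p a"
      by (auto intro!: bead_strict[OF p])
    then show False using a' by simp
  qed
  ultimately have "a' = Suc a" by simp
  then show "\<not> p (Suc a) < p a" using a' by (auto simp: bead_def)
next
  assume *: "\<not> p (Suc a) < p a"
  then have "p (Suc a) = p a" using partition_antimono[OF p, of a "Suc a"] by simp
  then have "bead t p (Suc a) = bead t p a - 1" by (simp add: bead_def)
  then show "bead t p a - 1 \<in> beta t p" by (metis beta_range rangeI)
qed

lemma nat_mod_eq_iff: "e > 0 \<Longrightarrow> nat (z mod int e) = j \<longleftrightarrow> z mod int e = int j"
  by (simp add: nat_eq_iff)

text \<open>
  The residue of an addable node is that of the position which its bead would move to; the residue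
  of a removable node is that of the position of its bead.
\<close>

lemma addable_residue_iff:
  assumes lam: "lam \<in> multipartitions l" and e: "e > 0"
  shows "(a, b, i) \<in> addable lam \<and> residue e t (a, b, i) = j \<longleftrightarrow>
    i < l \<and> b = (lam ! i) a \<and> bead (t ! i) (lam ! i) a + 1 \<notin> beta (t ! i) (lam ! i)
      \<and> (bead (t ! i) (lam ! i) a + 1) mod int e = int j"
proof (cases "i < l \<and> b = (lam ! i) a")
  case True
  then have "int b - int a + t ! i = bead (t ! i) (lam ! i) a + 1" by (simp add: bead_def)
  then have "residue e t (a, b, i) = j \<longleftrightarrow> (bead (t ! i) (lam ! i) a + 1) mod int e = int j"
    using e by (simp add: residue_def nat_mod_eq_iff)
  then show ?thesis
    using True addable_iff[OF lam, of a b i] bead_succ_mem_iff[OF multipartition_nth[OF lam], of i] by auto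
qed (use addable_iff[OF lam] in auto)

lemma removable_residue_iff:
  assumes lam: "lam \<in> multipartitions l" and e: "e > 0"
  shows "(a, b, i) \<in> removable lam \<and> residue e t (a, b, i) = j \<longleftrightarrow>
    i < l \<and> (lam ! i) a = Suc b \<and> bead (t ! i) (lam ! i) a - 1 \<notin> beta (t ! i) (lam ! i)
      \<and> bead (t ! i) (lam ! i) a mod int e = int j"
proof (cases "i < l \<and> (lam ! i) a = Suc b")
  case True
  then have "int b - int a + t ! i = bead (t ! i) (lam ! i) a" by (simp add: bead_def)
  then have "residue e t (a, b, i) = j \<longleftrightarrow> bead (t ! i) (lam ! i) a mod int e = int j"
    using e by (simp add: residue_def nat_mod_eq_iff)
  then show ?thesis
    using True removable_iff[OF lam, of a b i] bead_pred_mem_iff[OF multipartition_nth[OF lam], of i] by auto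
qed (use removable_iff[OF lam] in auto)

text \<open>
  The result of \<open>s\<^sub>j\<close> on one component, row by row. In row \<open>a\<close> the bead moves by one exactly when
  the position which \<open>s\<^sub>j\<close> assigns to it is free.
\<close>

definition refl_part :: "nat \<Rightarrow> int \<Rightarrow> nat \<Rightarrow> partition \<Rightarrow> partition" where
  "refl_part e t j p = (\<lambda>a.
     if bead t p a + 1 \<notin> beta t p \<and> (bead t p a + 1) mod int e = int j then p a + 1
     else if bead t p a - 1 \<notin> beta t p \<and> bead t p a mod int e = int j then p a - 1
     else p a)"

lemma succ_mod_ne:
  assumes "e \<ge> 2"
  shows "\<not> (z mod int e = int j \<and> (z + 1) mod int e = int j)"
proof
  assume "z mod int e = int j \<and> (z + 1) mod int e = int j"
  then have "int e dvd (z + 1) - z" by (metis mod_eq_dvd_iff)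
  then show False using assms by (simp add: zdvd1_eq)
qed

text \<open>
  Two beads that exchange their positions leave the set unchanged, so moving only beads with a
  free target yields the same set as applying \<open>s\<^sub>j\<close> to all beads. Neighbouring beads keep their
  order because positions of residue \<open>j\<close> are at least \<open>e\<close>, hence at least 2, apart.
\<close>

lemma refl_part:
  assumes e: "e \<ge> 2" and p: "is_partition p"
  shows "is_partition (refl_part e t j p)" (is ?part)
    "j < e \<Longrightarrow> beta t (refl_part e t j p) = swap_pos e j ` beta t p" (is "_ \<Longrightarrow> ?beta")
proof -
  let ?B = "beta t p" and ?p = "refl_part e t j p" and ?s = "swap_pos e j"
  have mem: "bead t p a \<in> ?B" for a by (simp add: beta_range)
  have pos: "p a > 0" if "bead t p a - 1 \<notin> ?B" for a
    using that bead_pred_mem_iff[OF p, of t a] by simp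
  have b: "bead t ?p a = (if ?s (bead t p a) \<in> ?B then bead t p a else ?s (bead t p a))" for a
    using succ_mod_ne[OF e, of "bead t p a" j] mem[of a] pos[of a]
    by (auto simp: refl_part_def bead_def swap_pos_def algebra_simps of_nat_diff)
  have near: "bead t ?p a \<le> bead t p a + 1" "bead t ?p a \<ge> bead t p a - 1" for a
    by (auto simp: b swap_pos_def)
  have strict: "bead t ?p (Suc a) < bead t ?p a" for a
  proof -
    have lt: "bead t p (Suc a) < bead t p a" by (rule bead_strict[OF p]) simp
    consider "bead t p a = bead t p (Suc a) + 1" | "bead t p a = bead t p (Suc a) + 2"
      | "bead t p a > bead t p (Suc a) + 2" using lt by linarith
    then show ?thesis
    proof cases
      case 1
      then have "bead t ?p (Suc a) \<le> bead t p (Suc a)" "bead t ?p a \<ge> bead t p a"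
        using mem[of a] mem[of "Suc a"] by (auto simp: b swap_pos_def)
      then show ?thesis using 1 by simp
    next
      case 2
      then show ?thesis using succ_mod_ne[OF e, of "bead t p (Suc a) + 1" j] by (auto simp: b swap_pos_def algebra_simps)
    next
      case 3
      then show ?thesis using near(1)[of "Suc a"] near(2)[of a] by simp
    qed
  qed
  have "antimono ?p"
  proof (rule antimono_iff_le_Suc[THEN iffD2], rule allI)
    show "?p (Suc a) \<le> ?p a" for a using strict[of a] by (simp add: bead_def)
  qed
  moreover obtain n where n: "\<And>a. a \<ge> n \<Longrightarrow> p a = 0" using partition_support[OF p] by blast
  have "?p a = 0" if "a \<ge> Suc n" for a
  proof -
    have "p a = 0" "p (a - 1) = 0" using n that by auto
    then show ?thesis using bead_succ_mem_iff[OF p, of t a] that by (auto simp: refl_part_def)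
  qed
  then have "{a. ?p a \<noteq> 0} \<subseteq> {..<Suc n}" using not_less by blast
  then have "finite {a. ?p a \<noteq> 0}" using finite_subset by blast
  ultimately show ?part by (simp add: is_partition_def)
  assume j: "j < e"
  show ?beta
  proof (intro equalityI subsetI)
    fix z assume "z \<in> beta t ?p"
    then obtain a where "z = bead t ?p a" by (auto simp: beta_range)
    then show "z \<in> ?s ` ?B" using b[of a] mem[of a] mem_swap_image[OF e j] swap_pos_invol[OF e j] by auto
  next
    fix z assume "z \<in> ?s ` ?B"
    then have z: "?s z \<in> ?B" by (simp add: mem_swap_image[OF e j])
    show "z \<in> beta t ?p"
    proof (cases "z \<in> ?B")
      case True
      then obtain a where "z = bead t p a" by (auto simp: beta_range)
      then have "z = bead t ?p a" using b[of a] z by simp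
      then show ?thesis by (simp add: beta_range)
    next
      case False
      obtain a where "?s z = bead t p a" using z by (auto simp: beta_range)
      then have "z = bead t ?p a" using b[of a] False swap_pos_invol[OF e j, of z] by simp
      then show ?thesis by (simp add: beta_range)
    qed
  qed
qed

lemma node_refl_eq:
  assumes e: "e \<ge> 2" and lam: "lam \<in> multipartitions l"
  shows "node_refl e t j lam = map (\<lambda>i. refl_part e (t ! i) j (lam ! i)) [0..<l]" (is "_ = ?mu")
proof -
  have len: "length lam = l" using lam by (simp add: multipartitions_def)
  have mu: "?mu \<in> multipartitions l"
    using refl_part(1)[OF e] lam by (auto simp: multipartitions_def)
  have "nodes ?mu = (nodes lam - {x \<in> removable lam. residue e t x = j})
      \<union> {x \<in> addable lam. residue e t x = j}"
  proof (rule Set.set_eqI)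
    fix x :: node
    obtain a b i where x: "x = (a, b, i)" by (cases x)
    show "x \<in> nodes ?mu \<longleftrightarrow> x \<in> (nodes lam - {x \<in> removable lam. residue e t x = j})
      \<union> {x \<in> addable lam. residue e t x = j}"
    proof (cases "i < l")
      case True
      let ?p = "lam ! i" and ?t = "t ! i"
      define A where "A \<longleftrightarrow> bead ?t ?p a + 1 \<notin> beta ?t ?p \<and> (bead ?t ?p a + 1) mod int e = int j"
      define R where "R \<longleftrightarrow> bead ?t ?p a - 1 \<notin> beta ?t ?p \<and> bead ?t ?p a mod int e = int j"
      have "R \<Longrightarrow> ?p a > 0"
        using bead_pred_mem_iff[OF multipartition_nth[OF lam True], of ?t a] by (simp add: R_def)
      moreover have "\<not> (A \<and> R)" using succ_mod_ne[OF e, of "bead ?t ?p a" j] by (auto simp: A_def R_def)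
      moreover have "x \<in> nodes ?mu \<longleftrightarrow> b < (if A then ?p a + 1 else if R then ?p a - 1 else ?p a)"
        using True by (simp add: x refl_part_def A_def R_def)
      moreover have "x \<in> {x \<in> addable lam. residue e t x = j} \<longleftrightarrow> b = ?p a \<and> A"
        using addable_residue_iff[OF lam, of e a b i t j] e True by (simp add: x A_def)
      moreover have "x \<in> {x \<in> removable lam. residue e t x = j} \<longleftrightarrow> ?p a = Suc b \<and> R"
        using removable_residue_iff[OF lam, of e a b i t j] e True by (simp add: x R_def)
      moreover have "x \<in> nodes lam \<longleftrightarrow> b < ?p a" using True len by (simp add: x)
      ultimately show ?thesis by auto
    next
      case False
      then show ?thesis using len addable_iff[OF lam, of a b i] by (simp add: x)
    qed
  qed
  then show ?thesis unfolding node_refl_def len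
    using mu nodes_inj multipartition_length by (intro the_equality) (metis | blast)+
qed

text \<open>
  For a pair of cores, an addable node of residue \<open>j\<close> is a bead on the runner before \<open>j\<close> at a
  level that runner \<open>j\<close> does not reach.
\<close>

lemma no_addable:
  assumes e: "e \<ge> 2" and j: "j < e" and lam: "lam \<in> multipartitions l"
    and core: "\<And>i b. i < l \<Longrightarrow> b < e \<Longrightarrow> runner e (beta (t ! i) (lam ! i)) b = {..<x i b}"
    and le: "\<And>i. i < l \<Longrightarrow> x i (pred_runner e j) + wrap j \<le> x i j"
    and y: "y \<in> addable lam"
  shows "residue e t y \<noteq> j"
proof
  assume "residue e t y = j"
  then obtain a b i where "y = (a, b, i)" and i: "i < l"
    and z: "bead (t ! i) (lam ! i) a + 1 \<notin> beta (t ! i) (lam ! i)"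
      "(bead (t ! i) (lam ! i) a + 1) mod int e = int j"
    using addable_residue_iff[OF lam, of e _ _ _ t j] e y by (cases y) auto
  define z0 where "z0 = bead (t ! i) (lam ! i) a + 1"
  define k where "k = z0 div int e"
  have z0: "z0 = k * int e + int j" using z(2) by (simp add: k_def z0_def minus_mod_eq_div_mult[symmetric])
  have "z0 - 1 = (k - wrap j) * int e + int (pred_runner e j)" using pos_before[OF e j, of k] z0 by simp
  moreover have "z0 - 1 \<in> beta (t ! i) (lam ! i)" by (simp add: z0_def beta_range)
  ultimately have "k - wrap j < x i (pred_runner e j)"
    using core[OF i, of "pred_runner e j"] pred_runner[OF e j] by (auto simp: runner_def)
  then have "k < x i j" using le[OF i] by simp
  then have "z0 \<in> beta (t ! i) (lam ! i)" using core[OF i j] z0 by (auto simp: runner_def)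
  then show False using z(1) by (simp add: z0_def)
qed

lemma no_removable:
  assumes e: "e \<ge> 2" and j: "j < e" and lam: "lam \<in> multipartitions l"
    and core: "\<And>i b. i < l \<Longrightarrow> b < e \<Longrightarrow> runner e (beta (t ! i) (lam ! i)) b = {..<x i b}"
    and le: "\<And>i. i < l \<Longrightarrow> x i j \<le> x i (pred_runner e j) + wrap j"
    and y: "y \<in> removable lam"
  shows "residue e t y \<noteq> j"
proof
  assume "residue e t y = j"
  then obtain a b i where "y = (a, b, i)" and i: "i < l"
    and z: "bead (t ! i) (lam ! i) a - 1 \<notin> beta (t ! i) (lam ! i)"
      "bead (t ! i) (lam ! i) a mod int e = int j"
    using removable_residue_iff[OF lam, of e _ _ _ t j] e y by (cases y) auto
  define z0 where "z0 = bead (t ! i) (lam ! i) a"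
  define k where "k = z0 div int e"
  have z0: "z0 = k * int e + int j" using z(2) by (simp add: k_def z0_def minus_mod_eq_div_mult[symmetric])
  moreover have "z0 \<in> beta (t ! i) (lam ! i)" by (simp add: z0_def beta_range)
  ultimately have "k < x i j" using core[OF i j] by (auto simp: runner_def)
  then have "k - wrap j < x i (pred_runner e j)" using le[OF i] by simp
  moreover have "z0 - 1 = (k - wrap j) * int e + int (pred_runner e j)" using pos_before[OF e j, of k] z0 by simp
  ultimately have "z0 - 1 \<in> beta (t ! i) (lam ! i)"
    using core[OF i, of "pred_runner e j"] pred_runner[OF e j] by (auto simp: runner_def)
  then show False using z(1) by (simp add: z0_def)
qed

section \<open>Orbits of charge vectors\<close>

text \<open>
  The entries below \<open>e\<close> stand for the runners; the remaining values of the function are left free.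
\<close>

definition swap_step :: "nat \<Rightarrow> (nat \<Rightarrow> int) \<Rightarrow> (nat \<Rightarrow> int) \<Rightarrow> bool" where
  "swap_step e c c' \<longleftrightarrow> (\<exists>j<e. \<forall>i<e. c' i = swap_charge e j c i)"

lemma swap_step_transpose:
  assumes "p < e" "q < e"
  shows "(swap_step e)\<^sup>*\<^sup>* c (c \<circ> Transposition.transpose p q)"
proof -
  have adj: "(swap_step e)\<^sup>*\<^sup>* c (c \<circ> Transposition.transpose p (Suc p))" if "Suc p < e" for p c
  proof (rule r_into_rtranclp)
    show "swap_step e c (c \<circ> Transposition.transpose p (Suc p))"
      unfolding swap_step_def using that
      by (intro exI[of _ "Suc p"])
        (auto simp: swap_charge_def pred_runner_def wrap_def Transposition.transpose_def)
  qed
  have less: "(swap_step e)\<^sup>*\<^sup>* c (c \<circ> Transposition.transpose p q)" if "p < q" "q < e" for p q c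
    using that
  proof (induction q arbitrary: c)
    case (Suc q)
    show ?case
    proof (cases "p = q")
      case True
      show ?thesis unfolding True by (rule adj[OF Suc.prems(2)])
    next
      case False
      let ?t = "Transposition.transpose q (Suc q)"
      have 1: "(swap_step e)\<^sup>*\<^sup>* c (c \<circ> ?t)" for c by (rule adj[OF Suc.prems(2)])
      have 2: "(swap_step e)\<^sup>*\<^sup>* (c \<circ> ?t) (c \<circ> ?t \<circ> Transposition.transpose p q)"
        by (rule Suc.IH) (use False Suc.prems in auto)
      have "(swap_step e)\<^sup>*\<^sup>* c (c \<circ> ?t \<circ> Transposition.transpose p q \<circ> ?t)"
        by (rule rtranclp_trans[OF 1 rtranclp_trans[OF 2 1]])
      moreover have "c \<circ> ?t \<circ> Transposition.transpose p q \<circ> ?t = c \<circ> Transposition.transpose p (Suc q)"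
        using False Suc.prems by (auto simp: fun_eq_iff Transposition.transpose_def)
      ultimately show ?thesis by (simp only:)
    qed
  qed simp
  consider "p < q" | "p = q" | "q < p" by linarith
  then show ?thesis
  proof cases
    case 1
    then show ?thesis using assms by (intro less)
  next
    case 2
    then show ?thesis by simp
  next
    case 3
    then show ?thesis using assms by (subst transpose_commute) (intro less)
  qed
qed

text \<open>
  Reflecting twice returns to the same entries below \<open>e\<close>, with the second step free to choose the
  other entries.
\<close>

lemma swap_step_eq:
  assumes "e \<ge> 2" "\<And>i. i < e \<Longrightarrow> c i = c' i"
  shows "(swap_step e)\<^sup>*\<^sup>* c c'"
proof -
  have "swap_step e c (swap_charge e 0 c)" unfolding swap_step_def using assms by (intro exI[of _ 0]) auto
  moreover have "swap_step e (swap_charge e 0 c) c'" unfolding swap_step_def using assms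
    by (intro exI[of _ 0]) (auto simp: swap_charge_def pred_runner_def wrap_def)
  ultimately show ?thesis by auto
qed

text \<open>
  \<open>s\<^sub>0\<close> followed by the transposition of the two end runners is the translation by \<open>2 * (\<epsilon>\<^sub>e\<^sub>-\<^sub>1 -
  \<epsilon>\<^sub>0)\<close>; conjugation with permutations gives all translations by twice a root.
\<close>

lemma swap_step_translate:
  assumes e: "e \<ge> 2" and pq: "p < e" "q < e" "p \<noteq> q"
  shows "(swap_step e)\<^sup>*\<^sup>* c (c(p := c p - 2, q := c q + 2))"
proof -
  \<comment> \<open>\<open>\<sigma> \<circ> \<tau>\<close> sends 0 to \<open>p\<close> and \<open>e - 1\<close> to \<open>q\<close>\<close>
  define \<sigma> where "\<sigma> = Transposition.transpose 0 p"
  define \<tau> where "\<tau> = Transposition.transpose (e - 1) (\<sigma> q)"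
  have \<sigma>: "\<sigma> q < e" "\<sigma> q \<noteq> 0" "\<sigma> \<circ> \<sigma> = id" "\<sigma> 0 = p"
    using pq e by (auto simp: \<sigma>_def Transposition.transpose_def)
  have \<tau>: "\<tau> \<circ> \<tau> = id" "\<tau> 0 = 0" "\<tau> (e - 1) = \<sigma> q"
    using \<sigma> e by (auto simp: \<tau>_def Transposition.transpose_def)
  have \<sigma>\<sigma>: "\<sigma> (\<sigma> i) = i" and \<tau>\<tau>: "\<tau> (\<tau> i) = i" for i using \<sigma> \<tau> by (metis comp_apply id_apply)+
  define c1 where "c1 = c \<circ> \<sigma> \<circ> \<tau>"
  define c2 where "c2 = swap_charge e 0 c1"
  define c3 where "c3 = c2 \<circ> Transposition.transpose 0 (e - 1)"
  have s1: "(swap_step e)\<^sup>*\<^sup>* c (c \<circ> \<sigma>)" unfolding \<sigma>_def using pq e by (intro swap_step_transpose) auto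
  have s2: "(swap_step e)\<^sup>*\<^sup>* (c \<circ> \<sigma>) c1"
    unfolding c1_def \<tau>_def using \<sigma> e by (intro swap_step_transpose) auto
  have s3: "(swap_step e)\<^sup>*\<^sup>* c1 c2"
    unfolding swap_step_def c2_def using e by (intro r_into_rtranclp exI[of _ 0]) auto
  have s4: "(swap_step e)\<^sup>*\<^sup>* c2 c3" unfolding c3_def using e by (intro swap_step_transpose) auto
  have s5: "(swap_step e)\<^sup>*\<^sup>* c3 (c3 \<circ> \<tau>)"
    unfolding \<tau>_def using \<sigma> e by (intro swap_step_transpose) auto
  have s6: "(swap_step e)\<^sup>*\<^sup>* (c3 \<circ> \<tau>) (c3 \<circ> \<tau> \<circ> \<sigma>)"
    unfolding \<sigma>_def using pq e by (intro swap_step_transpose) auto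
  have eq: "c3 \<circ> \<tau> \<circ> \<sigma> = c(p := c p - 2, q := c q + 2)"
  proof
    fix i
    have c3: "c3 k = (if k = 0 then c1 0 - 2 else if k = e - 1 then c1 k + 2 else c1 k)" for k
      using e by (auto simp: c3_def c2_def swap_charge_def pred_runner_def wrap_def Transposition.transpose_def)
    have 1: "\<tau> (\<sigma> i) = 0 \<longleftrightarrow> i = p" using \<sigma>\<sigma> \<tau>\<tau> \<sigma>(4) \<tau>(2) by metis
    have 2: "\<tau> (\<sigma> i) = e - 1 \<longleftrightarrow> i = q" using \<sigma>\<sigma> \<tau>\<tau> \<tau>(3) by metis
    have c1: "c1 (\<tau> (\<sigma> i)) = c i" "c1 0 = c p" by (simp_all add: c1_def \<sigma>\<sigma> \<tau>\<tau> \<tau>(2) \<sigma>(4))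
    show "(c3 \<circ> \<tau> \<circ> \<sigma>) i = (c(p := c p - 2, q := c q + 2)) i"
      unfolding comp_apply c3 1 2 c1 using pq(3) by auto
  qed
  show ?thesis unfolding eq[symmetric]
    by (rule rtranclp_trans[OF s1 rtranclp_trans[OF s2 rtranclp_trans[OF s3
      rtranclp_trans[OF s4 rtranclp_trans[OF s5 s6]]]]])
qed

lemma odd_card_split:
  fixes e :: nat and c :: "nat \<Rightarrow> int"
  shows "card {i. i < e \<and> odd (c i)} =
    card {i. i < e \<and> odd (c i) \<and> P i} + card {i. i < e \<and> odd (c i) \<and> \<not> P i}"
  by (subst card_Un_disjoint[symmetric]) (auto intro!: arg_cong[of _ _ card])

lemma swap_step_same_parity:
  assumes e: "e \<ge> 2" and "\<And>i. i < e \<Longrightarrow> even (c i - c' i)" "(\<Sum>i<e. c i) = (\<Sum>i<e. c' i)"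
  shows "(swap_step e)\<^sup>*\<^sup>* c c'"
  using assms(2,3)
proof (induction "nat (\<Sum>i<e. \<bar>c i - c' i\<bar>)" arbitrary: c rule: less_induct)
  case less
  show ?case
  proof (cases "\<forall>i<e. c i = c' i")
    case True
    then show ?thesis using swap_step_eq[OF e] by blast
  next
    case False
    have "\<exists>p<e. c p > c' p"
    proof (rule ccontr)
      assume "\<not> ?thesis"
      then have le: "c i \<le> c' i" if "i < e" for i using that by (meson not_less)
      obtain i where "i < e" "c i < c' i" using False le by (meson order_less_le)
      then have "(\<Sum>i<e. c i) < (\<Sum>i<e. c' i)" using le
        by (intro sum_strict_mono_ex1) auto
      then show False using less.prems by simp
    qed
    then obtain p where p: "p < e" "c p > c' p" by blast
    have "\<exists>q<e. c q < c' q"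
    proof (rule ccontr)
      assume "\<not> ?thesis"
      then have "c' i \<le> c i" if "i < e" for i using that by (meson not_less)
      then have "(\<Sum>i<e. c' i) < (\<Sum>i<e. c i)" using p
        by (intro sum_strict_mono_ex1) auto
      then show False using less.prems by simp
    qed
    then obtain q where q: "q < e" "c q < c' q" by blast
    have ne: "p \<noteq> q" using p q by auto
    define c1 where "c1 = c(p := c p - 2, q := c q + 2)"
    have split: "(\<Sum>i<e. f i) = f p + f q + (\<Sum>i\<in>{..<e} - {p, q}. f i)" for f :: "nat \<Rightarrow> int"
      using p q ne by (subst sum.subset_diff[of "{p, q}"]) auto
    have rest: "(\<Sum>i\<in>{..<e} - {p, q}. f (c1 i) i) = (\<Sum>i\<in>{..<e} - {p, q}. f (c i) i)"
      for f :: "int \<Rightarrow> nat \<Rightarrow> int" by (intro sum.cong) (auto simp: c1_def)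
    have 1: "(\<Sum>i<e. c1 i) = (\<Sum>i<e. c i)"
      unfolding split using rest[of "\<lambda>x _. x"] ne by (simp add: c1_def)
    have ev: "even (c p - c' p)" "even (c q - c' q)" using less.prems p q by auto
    have "c p - c' p \<ge> 2" "c' q - c q \<ge> 2" using p(2) q(2) ev by presburger+
    then have 2: "(\<Sum>i<e. \<bar>c1 i - c' i\<bar>) < (\<Sum>i<e. \<bar>c i - c' i\<bar>)"
      unfolding split using rest[of "\<lambda>x i. \<bar>x - c' i\<bar>"] ne by (simp add: c1_def)
    have "(\<Sum>i<e. \<bar>c1 i - c' i\<bar>) \<ge> 0" by (intro sum_nonneg) simp
    with 2 have 3: "nat (\<Sum>i<e. \<bar>c1 i - c' i\<bar>) < nat (\<Sum>i<e. \<bar>c i - c' i\<bar>)" by linarith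
    have 4: "even (c1 i - c' i)" if "i < e" for i
      using less.prems(1)[OF that] by (auto simp: c1_def)
    have "(swap_step e)\<^sup>*\<^sup>* c1 c'"
      by (rule less.hyps[OF 3 4]) (use 1 less.prems(2) in simp_all)
    then show ?thesis
      using swap_step_translate[OF e p(1) q(1) ne, of c] unfolding c1_def by (rule rtranclp_trans[rotated])
  qed
qed

lemma sum_comp_transpose:
  fixes c :: "nat \<Rightarrow> 'a::comm_monoid_add"
  assumes "p < e" "q < e"
  shows "(\<Sum>i<e. (c \<circ> Transposition.transpose p q) i) = (\<Sum>i<e. c i)"
  using assms by (intro sum.permute[symmetric] permutes_swap_id) auto

lemma card_odd_sum: "card {i. i < e \<and> odd (c i)} = (\<Sum>i<e. if odd (c i) then 1 else 0)"
  for e :: nat and c :: "nat \<Rightarrow> int"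
proof -
  have "{i. i < e \<and> odd (c i)} = {..<e} \<inter> {i. odd (c i)}" by auto
  then show ?thesis by (simp add: sum.If_cases)
qed

text \<open>
  The orbits of vectors with a given sum are classified by the number of odd entries: permutations
  align the parities, and vectors with equal parities and equal sums differ by twice an element of
  the root lattice.
\<close>

lemma swap_step_connected:
  assumes e: "e \<ge> 2" and "(\<Sum>i<e. c i) = (\<Sum>i<e. c' i)"
    and "card {i. i < e \<and> odd (c i)} = card {i. i < e \<and> odd (c' i)}"
  shows "(swap_step e)\<^sup>*\<^sup>* c c'"
  using assms(2,3)
proof (induction "card {i. i < e \<and> odd (c i - c' i)}" arbitrary: c rule: less_induct)
  case less
  show ?case
  proof (cases "\<forall>i<e. even (c i - c' i)")
    case True
    then show ?thesis using swap_step_same_parity[OF e] less.prems by blast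
  next
    case False
    then obtain i0 where i0: "i0 < e" "odd (c i0 - c' i0)" by blast
    let ?A = "{i. i < e \<and> odd (c i) \<and> even (c' i)}" and ?B = "{i. i < e \<and> odd (c' i) \<and> even (c i)}"
    have "{i. i < e \<and> odd (c i) \<and> odd (c' i)} = {i. i < e \<and> odd (c' i) \<and> odd (c i)}" by auto
    then have "card ?A = card ?B"
      using less.prems(2) odd_card_split[of e c "\<lambda>i. odd (c' i)"] odd_card_split[of e c' "\<lambda>i. odd (c i)"]
      by simp
    moreover have "i0 \<in> ?A \<or> i0 \<in> ?B" using i0 by auto
    then have "card ?A > 0 \<or> card ?B > 0" by (auto simp: card_gt_0_iff)
    ultimately have "card ?A > 0" "card ?B > 0" by auto
    then have "?A \<noteq> {}" "?B \<noteq> {}" by (metis card.empty less_irrefl)+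
    then obtain p q where p: "p < e" "odd (c p)" "even (c' p)" and q: "q < e" "odd (c' q)" "even (c q)"
      by blast
    let ?t = "Transposition.transpose p q"
    let ?c1 = "c \<circ> ?t"
    have "{i. i < e \<and> odd (?c1 i - c' i)} \<subset> {i. i < e \<and> odd (c i - c' i)}"
    proof (intro psubsetI subsetI)
      show "i \<in> {i. i < e \<and> odd (c i - c' i)}" if "i \<in> {i. i < e \<and> odd (?c1 i - c' i)}" for i
        using that p q by (auto simp: Transposition.transpose_def split: if_splits)
      have "p \<in> {i. i < e \<and> odd (c i - c' i)}" "p \<notin> {i. i < e \<and> odd (?c1 i - c' i)}"
        using p q by auto
      then show "{i. i < e \<and> odd (?c1 i - c' i)} \<noteq> {i. i < e \<and> odd (c i - c' i)}" by blast
    qed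
    then have "card {i. i < e \<and> odd (?c1 i - c' i)} < card {i. i < e \<and> odd (c i - c' i)}"
      by (intro psubset_card_mono) auto
    moreover have "card {i. i < e \<and> odd (?c1 i)} = card {i. i < e \<and> odd (c' i)}"
      using sum_comp_transpose[OF p(1) q(1), of "\<lambda>i. if odd (c i) then 1 else 0 :: nat"] less.prems(2)
      unfolding card_odd_sum by (simp add: comp_def)
    moreover have "(\<Sum>i<e. ?c1 i) = (\<Sum>i<e. c' i)"
      using sum_comp_transpose[OF p(1) q(1), of c] less.prems(1) by simp
    ultimately have "(swap_step e)\<^sup>*\<^sup>* ?c1 c'" by (intro less.hyps) auto
    then show ?thesis using swap_step_transpose[OF p(1) q(1), of c] by simp
  qed
qed

section \<open>Weights and moving vectors of pairs of cores\<close>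

lemma mem_interleave: "z \<in> interleave C D \<longleftrightarrow> (if odd z then z div 2 \<in> C else z div 2 \<in> D)"
proof (cases "odd z")
  case True
  then show ?thesis using odd_mem_interleave[of "z div 2" C D] by simp
next
  case False
  then show ?thesis using even_mem_interleave[of "z div 2" C D] by simp
qed

lemma interleave_lessThan:
  fixes x y :: int
  shows "x - y \<in> {0, -1} \<Longrightarrow> interleave {..<x} {..<y} = {..<x + y}"
    and "x - y \<in> {1, -2} \<Longrightarrow> interleave {..<x} {..<y} = insert (x + y) {..<x + y - 1}"
proof -
  assume a: "x - y \<in> {0, -1}"
  have "z \<in> interleave {..<x} {..<y} \<longleftrightarrow> z \<in> {..<x + y}" for z
    using a by (simp add: mem_interleave) presburger
  then show "interleave {..<x} {..<y} = {..<x + y}" by blast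
next
  assume a: "x - y \<in> {1, -2}"
  have "z \<in> interleave {..<x} {..<y} \<longleftrightarrow> z \<in> insert (x + y) {..<x + y - 1}" for z
    using a by (simp add: mem_interleave) presburger
  then show "interleave {..<x} {..<y} = insert (x + y) {..<x + y - 1}" by blast
qed

definition one_box :: partition where
  "one_box = (\<lambda>a. if a = 0 then 1 else 0)"

lemma one_box: "is_partition one_box" "beta c one_box = insert c {..<c - 1}" "psize one_box = 1"
proof -
  show "is_partition one_box" by (auto simp: is_partition_def one_box_def antimono_def)
  have b0: "bead c one_box 0 = c" and bS: "bead c one_box (Suc a) = bead (c - 1) (\<lambda>_. 0) a" for a
    by (auto simp: bead_def one_box_def)
  show "beta c one_box = insert c {..<c - 1}"
  proof (intro equalityI subsetI)
    fix z assume "z \<in> beta c one_box"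
    then obtain a where "z = bead c one_box a" by (auto simp: beta_range)
    then have "z = c \<or> z \<in> beta (c - 1) (\<lambda>_. 0)"
      using b0 bS by (cases a) (auto simp: beta_range)
    then show "z \<in> insert c {..<c - 1}" by (simp add: beta_zero)
  next
    fix z assume "z \<in> insert c {..<c - 1}"
    then have "z = c \<or> z \<in> beta (c - 1) (\<lambda>_. 0)" by (simp add: beta_zero)
    then obtain a where "z = bead c one_box a"
      using b0 bS by (auto simp: beta_range) (metis, metis)
    then show "z \<in> beta c one_box" by (simp add: beta_range)
  qed
  have "{a. one_box a \<noteq> 0} = {0}" by (auto simp: one_box_def)
  then show "psize one_box = 1" by (simp add: psize_def one_box_def)
qed

text \<open>
  A pair of cores, with runners filled up to levels \<open>x b\<close> and \<open>y b\<close>, whose differences \<open>x b - y b\<close>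
  lie within 2 of each other and whose charges lie in the closed alcove. The differences sum to a
  number between \<open>-e\<close> and \<open>0\<close>, which pins them to \<open>{-2..1}\<close>. The interleaved runner is then a
  vacuum for the differences \<open>-1\<close>, \<open>0\<close> and a single box for \<open>-2\<close>, \<open>1\<close>.
\<close>

locale tight_pair =
  fixes e :: nat and C D :: "int set" and x y :: "nat \<Rightarrow> int"
  assumes e: "e > 0" and C: "beta_set C" and D: "beta_set D"
    and runner_C: "b < e \<Longrightarrow> runner e C b = {..<x b}"
    and runner_D: "b < e \<Longrightarrow> runner e D b = {..<y b}"
    and spread: "a < e \<Longrightarrow> b < e \<Longrightarrow> (x a - y a) - (x b - y b) \<le> 2"
    and alcove: "charge C \<le> charge D" "charge D \<le> charge C + int e"
begin

definition high :: nat where "high = card {b. b < e \<and> x b - y b = 1}"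
definition low :: nat where "low = card {b. b < e \<and> x b - y b = -2}"

lemma sum_diff: "(\<Sum>b<e. x b - y b) = charge C - charge D"
proof -
  have "charge C = (\<Sum>b<e. x b)" "charge D = (\<Sum>b<e. y b)"
    using charge_sum_runners[OF e C] charge_sum_runners[OF e D]
    by (simp_all add: runner_C runner_D bsize_lessThan)
  then show ?thesis by (simp add: sum_subtractf)
qed

lemma diff_cases:
  assumes "b < e"
  shows "x b - y b \<in> {-2, -1, 0, 1}"
proof -
  have "x b - y b \<le> 1"
  proof (rule ccontr)
    assume "\<not> ?thesis"
    then have "x a - y a \<ge> 0" if "a < e" for a using spread[OF assms that] by simp
    then have "x b - y b \<le> (\<Sum>b<e. x b - y b)" using assms by (intro member_le_sum) auto
    then show False using sum_diff alcove \<open>\<not> x b - y b \<le> 1\<close> by simp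
  qed
  moreover have "x b - y b \<ge> -2"
  proof (rule ccontr)
    assume *: "\<not> ?thesis"
    then have 1: "x a - y a \<le> -1" if "a < e" for a using spread[OF that assms] by simp
    have "(\<Sum>b<e. x b - y b) < (\<Sum>b<e. -1)"
      by (rule sum_strict_mono_ex1) (use 1 * assms in \<open>auto intro!: bexI[of _ b]\<close>)
    then show False using sum_diff alcove by simp
  qed
  ultimately show ?thesis by auto
qed

text \<open>
  The differences \<open>1\<close> and \<open>-2\<close> are 3 apart, so at most one of them occurs.
\<close>

lemma high_low: "high = 0 \<or> low = 0"
proof (rule ccontr)
  assume "\<not> ?thesis"
  then have "{b. b < e \<and> x b - y b = 1} \<noteq> {}" "{b. b < e \<and> x b - y b = -2} \<noteq> {}"
    unfolding high_def low_def by (metis card.empty)+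
  then obtain a b where "a < e" "x a - y a = 1" "b < e" "x b - y b = -2" by blast
  then show False using spread[of a b] by simp
qed

lemma card_as_sum: "int (card {b. b < e \<and> P b}) = (\<Sum>b<e. if P b then 1 else 0)"
proof -
  have "{b. b < e \<and> P b} = {..<e} \<inter> {b. P b}" by auto
  then show ?thesis by (simp add: sum.If_cases)
qed

text \<open>
  Entries \<open>x b + y b\<close> and \<open>x b - y b\<close> have the same parity, and on \<open>{-2..1}\<close> the indicator of
  oddness plus the difference itself equals twice the indicator of \<open>1\<close> minus twice that of \<open>-2\<close>.
  Thus, for given charges, the number of odd entries and \<open>high - low\<close> determine each other.
\<close>

lemma card_odd: "int (card {b. b < e \<and> odd (x b + y b)}) =
    (charge D - charge C) + 2 * (int high - int low)"
proof -
  have "(\<Sum>b<e. (if odd (x b + y b) then 1 else 0) + (x b - y b)) =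
      (\<Sum>b<e. 2 * (if x b - y b = 1 then 1 else 0) - 2 * (if x b - y b = -2 then 1 else 0))"
  proof (rule sum.cong)
    fix b assume "b \<in> {..<e}"
    then have b: "b < e" by simp
    define d where "d = x b - y b"
    have "d \<in> {-2, -1, 0, 1}" using diff_cases[OF b] unfolding d_def .
    moreover have "odd (x b + y b) \<longleftrightarrow> odd d" unfolding d_def by presburger
    ultimately show "(if odd (x b + y b) then 1 else 0) + (x b - y b) =
        2 * (if x b - y b = 1 then 1 else 0) - 2 * (if x b - y b = -2 then 1 else 0)"
      unfolding d_def[symmetric] by auto
  qed simp
  then show ?thesis
    unfolding high_def low_def card_as_sum using sum_diff
    by (simp add: sum.distrib sum_subtractf flip: sum_distrib_left)
qed

lemma runner_shape:
  assumes "b < e"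
  shows "interleave (runner e C b) (runner e D b) =
    beta (x b + y b) (if x b - y b \<in> {1, -2} then one_box else (\<lambda>_. 0))"
  using diff_cases[OF assms] assms
  by (auto simp: runner_C runner_D interleave_lessThan one_box beta_zero)

lemma zero_partition: "is_partition (\<lambda>_. 0)"
  by (simp add: is_partition_def antimono_def)

lemma beta_inv_runner:
  assumes "b < e"
  shows "beta_inv (interleave (runner e C b) (runner e D b)) =
      (if x b - y b \<in> {1, -2} then one_box else (\<lambda>_. 0))"
    "charge (interleave (runner e C b) (runner e D b)) = x b + y b"
  using zero_partition one_box(1) unfolding runner_shape[OF assms]
  by (auto simp: beta_inv_beta charge_beta)

lemma pair_wt: "pair_wt e C D = high + low"
proof -
  have zero: "psize (\<lambda>_. 0) = 0" by (simp add: psize_def)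
  have "int (pair_wt e C D) = (\<Sum>b<e. (if x b - y b = 1 then 1 else 0) + (if x b - y b = -2 then 1 else 0))"
    unfolding pair_wt_def of_nat_sum
    by (rule sum.cong) (auto simp: bsize_def beta_inv_runner one_box(3) zero)
  then have "int (pair_wt e C D) = int high + int low"
    unfolding high_def low_def card_as_sum by (simp add: sum.distrib)
  then show ?thesis by simp
qed

text \<open>
  The only nodes are single boxes, whose residue is the parity of the charge \<open>x b + y b\<close>: odd for
  the difference \<open>1\<close> and even for \<open>-2\<close>.
\<close>

lemma moving_vector:
  assumes "C = beta t0 p" "D = beta t1 p'"
  shows "moving_vector e [p, p'] [t0, t1] = [high, low]"
proof -
  define Q where "Q = quot e (uglov e (mbeta [t0, t1] [p, p']))"
  have lenQ: "length Q = e" by (simp add: Q_def quot_def)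
  have Q: "Q ! b = interleave (runner e C b) (runner e D b)" if "b < e" for b
    using that by (simp add: Q_def quot_nth mbeta_def runner_uglov assms)
  define N where "N = nodes (map beta_inv Q)"
  have N: "N = (\<lambda>b. (0, 0, b)) ` {b. b < e \<and> x b - y b \<in> {1, -2}}"
    unfolding N_def nodes_def
    by (auto simp: lenQ Q beta_inv_runner one_box_def split: if_splits)
  have res: "residue 2 (map charge Q) (0, 0, b) = (if x b - y b = 1 then 1 else 0)"
    if "b < e" "x b - y b \<in> {1, -2}" for b
  proof -
    have "(x b + y b) mod 2 = (if x b - y b = 1 then 1 else 0)" using that(2) by auto presburger+
    then show ?thesis using that(1) by (simp add: residue_def lenQ Q beta_inv_runner)
  qed
  have "{z \<in> N. residue 2 (map charge Q) z = 1} = (\<lambda>b. (0, 0, b)) ` {b. b < e \<and> x b - y b = 1}"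
    "{z \<in> N. residue 2 (map charge Q) z = 0} = (\<lambda>b. (0, 0, b)) ` {b. b < e \<and> x b - y b = -2}"
    unfolding N using res by auto
  then have "card {z \<in> N. residue 2 (map charge Q) z = 1} = high"
    "card {z \<in> N. residue 2 (map charge Q) z = 0} = low"
    by (simp_all add: high_def low_def card_image inj_on_def)
  then show ?thesis
    by (simp add: moving_vector_def Let_def upt_rec flip: Q_def N_def numeral_2_eq_2)
qed

end

section \<open>Specht modules and block idempotents\<close>

lemma free_algebra_ring: "ring (free_algebra A :: ('f::field free) ring)"
  (is "ring ?R")
proof (rule ringI)
  show "abelian_group ?R"
  proof (rule abelian_groupI)
    fix x :: "'f free" assume "x \<in> carrier ?R"
    then show "\<exists>y\<in>carrier (free_algebra A). y \<oplus>\<^bsub>?R\<^esub> x = \<zero>\<^bsub>?R\<^esub>"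
      by (intro bexI[of _ "- x"]) (auto simp: free_algebra_def)
  qed (use keys_add in \<open>fastforce simp: free_algebra_def algebra_simps\<close>)+
  show "monoid ?R"
  proof (rule monoidI)
    fix x y :: "'f free" assume "x \<in> carrier ?R" "y \<in> carrier ?R"
    then show "x \<otimes>\<^bsub>?R\<^esub> y \<in> carrier ?R"
      using keys_mult[of x y] by (fastforce simp: free_algebra_def plus_word_def)
  next
    show "\<one>\<^bsub>?R\<^esub> \<in> carrier ?R"
      by (auto simp: free_algebra_def zero_word_def)
  qed (auto simp: free_algebra_def algebra_simps)
qed (auto simp: free_algebra_def algebra_simps)

lemma free_algebra_closed:
  shows free_zero: "0 \<in> carrier (free_algebra A)"
    and free_one: "1 \<in> carrier (free_algebra A)"
    and free_add: "x \<in> carrier (free_algebra A) \<Longrightarrow> y \<in> carrier (free_algebra A) \<Longrightarrow> x + y \<in> carrier (free_algebra A)"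
    and free_mult: "x \<in> carrier (free_algebra A) \<Longrightarrow> y \<in> carrier (free_algebra A) \<Longrightarrow> x * y \<in> carrier (free_algebra A)"
    and free_diff: "x \<in> carrier (free_algebra A) \<Longrightarrow> y \<in> carrier (free_algebra A) \<Longrightarrow> x - y \<in> carrier (free_algebra A)"
    and free_lett: "a \<in> A \<Longrightarrow> lett a \<in> carrier (free_algebra A)"
    and free_scal: "scal c \<in> carrier (free_algebra A)"
proof -
  interpret ring "free_algebra A" by (rule free_algebra_ring)
  show "0 \<in> carrier (free_algebra A)" "1 \<in> carrier (free_algebra A)"
    using zero_closed one_closed by (auto simp: free_algebra_def)
  show "x + y \<in> carrier (free_algebra A)" if "x \<in> carrier (free_algebra A)" "y \<in> carrier (free_algebra A)"
    using a_closed[OF that] by (simp add: free_algebra_def)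
  show "x * y \<in> carrier (free_algebra A)" if "x \<in> carrier (free_algebra A)" "y \<in> carrier (free_algebra A)"
    using m_closed[OF that] by (simp add: free_algebra_def)
  show "x - y \<in> carrier (free_algebra A)" if "x \<in> carrier (free_algebra A)" "y \<in> carrier (free_algebra A)"
    using that keys_diff[of x y] by (fastforce simp: free_algebra_def)
  show "lett a \<in> carrier (free_algebra A)" if "a \<in> A"
    using that by (simp add: free_algebra_def lett_def)
  show "scal c \<in> carrier (free_algebra A)"
    by (simp add: free_algebra_def scal_def zero_word_def)
qed

lemma free_prod_list:
  "(\<And>x. x \<in> set xs \<Longrightarrow> f x \<in> carrier (free_algebra A)) \<Longrightarrow> prod_list (map f xs) \<in> carrier (free_algebra A)"
  by (induction xs) (auto intro: free_algebra_closed)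

lemma free_sum:
  "(\<And>x. x \<in> S \<Longrightarrow> f x \<in> carrier (free_algebra A)) \<Longrightarrow> sum f S \<in> carrier (free_algebra A)"
  by (induction S rule: infinite_finite_induct) (auto intro: free_algebra_closed)

lemma hecke_rels_closed: "hecke_rels q r n \<subseteq> carrier (free_algebra (hecke_gens n))"
  unfolding hecke_rels_def
  by (auto simp: hecke_gens_def intro!: free_algebra_closed free_prod_list)

lemma deg_rels_closed: "deg_rels r n \<subseteq> carrier (free_algebra (deg_gens n))"
  unfolding deg_rels_def
  by (auto simp: deg_gens_def intro!: free_algebra_closed free_prod_list)

lemma AK_free_ring: "ring (AK_free e q n)"
  unfolding AK_free_def by (rule free_algebra_ring)

lemma AK_ideal_ideal: "ideal (AK_ideal e q r n) (AK_free e q n)"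
  unfolding AK_ideal_def
  by (rule ring.genideal_ideal[OF AK_free_ring])
     (auto simp: AK_free_def hecke_rels_closed[THEN subsetD] deg_rels_closed[THEN subsetD])

lemma AK_ring: "ring (AK e q r n)"
  unfolding AK_def by (rule ideal.quotient_is_ring[OF AK_ideal_ideal])

lemma hecke_jm_closed: "k < n \<Longrightarrow> hecke_jm q k \<in> carrier (free_algebra (hecke_gens n))"
  by (induction k) (auto simp: hecke_gens_def intro!: free_algebra_closed)

lemma jm_closed: "1 \<le> k \<Longrightarrow> k \<le> n \<Longrightarrow> jm e q k \<in> carrier (AK_free e q n)"
  unfolding jm_def AK_free_def
  by (auto simp: deg_gens_def intro!: hecke_jm_closed free_algebra_closed)

lemma u_elt_closed:
  assumes "length lam = length r" "msize lam = n"
  shows "u_elt e q r lam \<in> carrier (AK_free e q n)"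
proof -
  have "jm e q k - scal (param e q (r ! s)) \<in> carrier (AK_free e q n)"
    if "s < length r" "1 \<le> k" "k < Suc (\<Sum>i<s. psize (lam ! i))" for s k
  proof -
    have "(\<Sum>i<s. psize (lam ! i)) \<le> (\<Sum>i<length lam. psize (lam ! i))"
      using that assms by (intro sum_mono2) auto
    also have "\<dots> = n"
      using assms(2) by (simp add: msize_def sum_list_sum_nth atLeast0LessThan)
    finally have "jm e q k \<in> carrier (AK_free e q n)"
      using that by (intro jm_closed) auto
    then show ?thesis by (auto simp: AK_free_def intro: free_algebra_closed)
  qed
  then show ?thesis unfolding u_elt_def
    unfolding AK_free_def by (auto intro!: free_prod_list)
qed

lemma word_perm_append: "word_perm (ks @ ks') = word_perm ks \<circ> word_perm ks'"
  by (induction ks) (auto simp: word_perm_def)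

lemma word_perm_transpose:
  assumes "1 \<le> a" "a < b" "b \<le> n"
  shows "\<exists>ks. set ks \<subseteq> {1..<n} \<and> word_perm ks = Transposition.transpose a b"
  using assms
proof (induction b)
  case (Suc b)
  show ?case
  proof (cases "a = b")
    case True
    then show ?thesis using Suc.prems
      by (intro exI[of _ "[b]"]) (auto simp: word_perm_def)
  next
    case False
    then obtain ks where ks: "set ks \<subseteq> {1..<n}" "word_perm ks = Transposition.transpose a b"
      using Suc by auto
    have "word_perm ([b] @ ks @ [b]) = Transposition.transpose a (Suc b)"
      unfolding word_perm_append ks(2) using False Suc.prems
      by (auto simp: word_perm_def fun_eq_iff Transposition.transpose_def)
    then show ?thesis using ks Suc.prems
      by (intro exI[of _ "[b] @ ks @ [b]"]) auto
  qed
qed simp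

text \<open>
  The words chosen in \<open>T_perm\<close> exist, since adjacent transpositions generate the symmetric group;
  without this the chosen word, and hence \<open>T_perm\<close>, would be arbitrary.
\<close>

lemma word_perm_surj:
  assumes "w permutes {1..n::nat}"
  shows "\<exists>ks. set ks \<subseteq> {1..<n} \<and> word_perm ks = w"
  using assms finite_atLeastAtMost[of 1 n]
proof (induction rule: permutes_induct)
  case id
  show ?case by (intro exI[of _ "[]"]) (simp add: word_perm_def)
next
  case (swap a b p)
  have "\<exists>ks. set ks \<subseteq> {1..<n} \<and> word_perm ks = Transposition.transpose a b"
    using word_perm_transpose[of a b n] word_perm_transpose[of b a n] swap
    by (cases a b rule: linorder_cases) (auto simp: transpose_commute)
  then obtain ks ks' where "set ks \<subseteq> {1..<n}" "word_perm ks = p"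
      "set ks' \<subseteq> {1..<n}" "word_perm ks' = Transposition.transpose a b"
    using swap by auto
  then show ?case by (intro exI[of _ "ks' @ ks"]) (auto simp: word_perm_append)
qed

lemma T_perm_closed:
  assumes "w permutes {1..n}"
  shows "T_perm n w \<in> carrier (AK_free e q n)"
proof -
  define P where "P = (\<lambda>ks. set ks \<subseteq> {1..<n} \<and> word_perm ks = w)"
  obtain ks where "P ks" using word_perm_surj[OF assms] unfolding P_def by blast
  then have "P (arg_min length P)" by (rule arg_min_natI)
  then have "set (arg_min length P) \<subseteq> {1..<n}" by (simp add: P_def)
  then show ?thesis unfolding T_perm_def P_def[symmetric] AK_free_def
    by (auto simp: hecke_gens_def deg_gens_def intro!: free_prod_list free_algebra_closed)
qed

lemma x_elt_closed:
  assumes "msize lam = n"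
  shows "x_elt lam \<in> carrier (AK_free e q n)"
  using T_perm_closed[of _ "msize lam" e q] assms
  unfolding x_elt_def AK_free_def young_subgroup_def by (auto intro!: free_sum)

lemma m_elt_closed:
  assumes "length lam = length r" "msize lam = n"
  shows "m_elt e q r lam \<in> carrier (AK e q r n)"
proof -
  interpret I: ideal "AK_ideal e q r n" "AK_free e q n" by (rule AK_ideal_ideal)
  have "u_elt e q r lam * x_elt lam \<in> carrier (AK_free e q n)"
    using u_elt_closed[OF assms, of e q] x_elt_closed[OF assms(2), of e q]
    unfolding AK_free_def by (auto intro: free_algebra_closed)
  then show ?thesis
    unfolding m_elt_def AK_def FactRing_def Let_def assms(2)
    by (auto simp: A_RCOSETS_def')
qed

text \<open>
  Primitive central idempotents: \<open>b\<close> is the sum of the orthogonal central idempotents \<open>b b'\<close> and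
  \<open>b - b b'\<close>, one of which vanishes; the same holds with \<open>b\<close> and \<open>b'\<close> exchanged.
\<close>

lemma (in ring) block_idempotent_disjoint:
  assumes "block_idempotent R b" "block_idempotent R b'" "b \<noteq> b'"
  shows "b \<otimes> b' = \<zero>"
proof -
  have split: "b \<otimes> b' = \<zero> \<or> b = b \<otimes> b'"
    if "block_idempotent R b" "central_idempotent R b'" for b b'
  proof -
    have b: "b \<in> carrier R" "b \<otimes> b = b" "\<And>x. x \<in> carrier R \<Longrightarrow> b \<otimes> x = x \<otimes> b"
      and b': "b' \<in> carrier R" "b' \<otimes> b' = b'" "\<And>x. x \<in> carrier R \<Longrightarrow> b' \<otimes> x = x \<otimes> b'"
      using that by (auto simp: block_idempotent_def central_idempotent_def)
    define c d where "c = b \<otimes> b'" and "d = b \<ominus> b \<otimes> b'"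
    have cc: "c \<otimes> c = c"
    proof -
      have "c \<otimes> c = b \<otimes> (b' \<otimes> b) \<otimes> b'" using b(1) b'(1) by (simp add: c_def m_assoc)
      also have "\<dots> = b \<otimes> (b \<otimes> b') \<otimes> b'" using b(3)[OF b'(1)] by simp
      also have "\<dots> = (b \<otimes> b) \<otimes> (b' \<otimes> b')" using b(1) b'(1) by (simp add: m_assoc)
      finally show ?thesis using b(2) b'(2) by (simp add: c_def)
    qed
    have bc: "b \<otimes> c = c" using b(1,2) b'(1) by (simp add: c_def m_assoc[symmetric])
    have cb: "c \<otimes> b = c" using bc b(3)[of c] b(1) b'(1) by (simp add: c_def)
    have cin: "c \<in> carrier R" and din: "d \<in> carrier R" using b(1) b'(1) by (auto simp: c_def d_def)
    have dc: "d = b \<ominus> c" by (simp add: c_def d_def)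
    have cx: "c \<otimes> x = x \<otimes> c" if "x \<in> carrier R" for x
    proof -
      have "c \<otimes> x = b \<otimes> (b' \<otimes> x)" using b(1) b'(1) that by (simp add: c_def m_assoc)
      also have "\<dots> = b \<otimes> (x \<otimes> b')" using b'(3)[OF that] by simp
      also have "\<dots> = (b \<otimes> x) \<otimes> b'" using b(1) b'(1) that by (simp add: m_assoc)
      also have "\<dots> = (x \<otimes> b) \<otimes> b'" using b(3)[OF that] by simp
      finally show ?thesis using b(1) b'(1) that by (simp add: c_def m_assoc)
    qed
    have "central_idempotent R c"
      unfolding central_idempotent_def by (intro conjI ballI cin cc cx)
    moreover have "central_idempotent R d"
      unfolding central_idempotent_def
    proof (intro conjI ballI)
      have "d \<otimes> b = d" using b(1,2) cin cb by (simp add: dc a_minus_def l_distr l_minus)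
      moreover have "d \<otimes> c = \<zero>" using b(1) cin bc cc by (simp add: dc a_minus_def l_distr l_minus r_neg)
      moreover have "d \<otimes> d = d \<otimes> b \<oplus> \<ominus> (d \<otimes> c)"
        using b(1) cin din by (subst (2) dc) (simp add: a_minus_def r_distr r_minus)
      ultimately show "d \<otimes> d = d" using din by simp
      show "d \<otimes> x = x \<otimes> d" if "x \<in> carrier R" for x
        using that b(1) b(3)[OF that] cin cx[OF that]
        by (simp add: dc a_minus_def l_distr r_distr l_minus r_minus)
    qed (rule din)
    moreover have "c \<otimes> d = \<zero>" using b(1) cin cb cc
      by (simp add: dc a_minus_def r_distr r_minus r_neg)
    moreover have "c \<oplus> d = b" using b(1) cin
      by (simp add: dc a_minus_def a_lcomm[of c b] r_neg)
    ultimately have "c = \<zero> \<or> d = \<zero>" using that(1) unfolding block_idempotent_def by blast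
    moreover have "d \<oplus> c = b" using b(1) cin by (simp add: dc a_minus_def a_assoc l_neg)
    ultimately show ?thesis using cin unfolding c_def[symmetric] by auto
  qed
  have c: "central_idempotent R b" "central_idempotent R b'"
    using assms by (auto simp: block_idempotent_def)
  then have "b \<otimes> b' = b' \<otimes> b" unfolding central_idempotent_def by blast
  with split[OF assms(1) c(2)] split[OF assms(2) c(1)] assms(3) show ?thesis by metis
qed

lemma mem_specht_upper:
  assumes "length lam = length r"
  shows "m_elt e q r lam \<in> specht_upper e q r lam"
proof -
  define H where "H = AK e q r (msize lam)"
  interpret ring H unfolding H_def by (rule AK_ring)
  interpret N: ideal "specht_lower e q r lam" H
    unfolding specht_lower_def H_def
    using m_elt_closed[of _ r] by (intro ring.genideal_ideal[OF AK_ring]) (auto simp: multipartitions_def)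
  have "m_elt e q r lam \<in> carrier H" unfolding H_def using assms by (intro m_elt_closed) auto
  then have "m_elt e q r lam = (m_elt e q r lam \<otimes>\<^bsub>H\<^esub> \<one>\<^bsub>H\<^esub>) \<oplus>\<^bsub>H\<^esub> \<zero>\<^bsub>H\<^esub>" by simp
  then show ?thesis unfolding specht_upper_def Let_def H_def[symmetric]
    using N.zero_closed by blast
qed

lemma specht_lower_ideal: "ideal (specht_lower e q r lam) (AK e q r (msize lam))"
  unfolding specht_lower_def
  using m_elt_closed[of _ r] by (intro ring.genideal_ideal[OF AK_ring]) (auto simp: multipartitions_def)

lemma specht_upper_closed:
  assumes "length lam = length r"
  shows "specht_upper e q r lam \<subseteq> carrier (AK e q r (msize lam))"
proof -
  interpret N: ideal "specht_lower e q r lam" "AK e q r (msize lam)" by (rule specht_lower_ideal)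
  show ?thesis using m_elt_closed[OF assms, of "msize lam" e q]
    by (auto simp: specht_upper_def Let_def)
qed

lemma specht_lower_upper:
  assumes "length lam = length r"
  shows "specht_lower e q r lam \<subseteq> specht_upper e q r lam"
proof
  fix y assume y: "y \<in> specht_lower e q r lam"
  define H where "H = AK e q r (msize lam)"
  interpret N: ideal "specht_lower e q r lam" H unfolding H_def by (rule specht_lower_ideal)
  have "m_elt e q r lam \<in> carrier H" unfolding H_def using assms by (intro m_elt_closed) auto
  then have "y = (m_elt e q r lam \<otimes>\<^bsub>H\<^esub> \<zero>\<^bsub>H\<^esub>) \<oplus>\<^bsub>H\<^esub> y" using y by simp
  then show "y \<in> specht_upper e q r lam" unfolding specht_upper_def Let_def H_def[symmetric]
    using y by blast
qed

text \<open>
  If two orthogonal idempotents both act as the identity on the Specht module, then so does their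
  product \<open>0\<close>, and the module vanishes.
\<close>

lemma lies_in_unique:
  assumes "B \<in> blocks e q r" "B' \<in> blocks e q r" "lies_in e q r lam B" "lies_in e q r lam B'"
  shows "B = B'"
proof (rule ccontr)
  assume ne: "B \<noteq> B'"
  obtain n b b' where B: "B = (n, b)" "B' = (n, b')" "msize lam = n" "length lam = length r"
    using assms by (cases B, cases B') (auto simp: lies_in_def multipartitions_def)
  define H where "H = AK e q r n"
  define N where "N = specht_lower e q r lam"
  interpret ring H unfolding H_def by (rule AK_ring)
  interpret N: ideal N H unfolding H_def N_def using specht_lower_ideal B by metis
  have bb: "block_idempotent H b" "block_idempotent H b'"
    using assms B by (auto simp: blocks_def H_def)
  then have bbc: "b \<in> carrier H" "b' \<in> carrier H"
    by (auto simp: block_idempotent_def central_idempotent_def)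
  have 0: "b \<otimes>\<^bsub>H\<^esub> b' = \<zero>\<^bsub>H\<^esub>" using bb ne B by (intro block_idempotent_disjoint) auto
  have "x \<in> N" if x: "x \<in> specht_upper e q r lam" for x
  proof -
    have xc: "x \<in> carrier H" using specht_upper_closed[of lam r e q] B x by (auto simp: H_def)
    have 1: "x \<otimes>\<^bsub>H\<^esub> b \<ominus>\<^bsub>H\<^esub> x \<in> N" "x \<otimes>\<^bsub>H\<^esub> b' \<ominus>\<^bsub>H\<^esub> x \<in> N"
      using assms(3,4) x by (auto simp: lies_in_def B H_def N_def)
    have "(x \<otimes>\<^bsub>H\<^esub> b \<ominus>\<^bsub>H\<^esub> x) \<otimes>\<^bsub>H\<^esub> b' \<in> N" using 1 bbc by (intro N.I_r_closed)
    moreover have "(x \<otimes>\<^bsub>H\<^esub> b \<ominus>\<^bsub>H\<^esub> x) \<otimes>\<^bsub>H\<^esub> b' = \<ominus>\<^bsub>H\<^esub> (x \<otimes>\<^bsub>H\<^esub> b')"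
      using xc bbc 0 by (simp add: a_minus_def l_distr l_minus m_assoc)
    ultimately have "(\<ominus>\<^bsub>H\<^esub> (x \<otimes>\<^bsub>H\<^esub> b')) \<oplus>\<^bsub>H\<^esub> (x \<otimes>\<^bsub>H\<^esub> b' \<ominus>\<^bsub>H\<^esub> x) \<in> N"
      using 1 N.a_closed by simp
    moreover have "(\<ominus>\<^bsub>H\<^esub> (x \<otimes>\<^bsub>H\<^esub> b')) \<oplus>\<^bsub>H\<^esub> (x \<otimes>\<^bsub>H\<^esub> b' \<ominus>\<^bsub>H\<^esub> x) = \<ominus>\<^bsub>H\<^esub> x"
      using xc bbc by (simp add: a_minus_def a_assoc[symmetric] l_neg)
    ultimately have "(\<ominus>\<^bsub>H\<^esub> x) \<otimes>\<^bsub>H\<^esub> (\<ominus>\<^bsub>H\<^esub> \<one>\<^bsub>H\<^esub>) \<in> N"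
      by (intro N.I_r_closed) auto
    then show "x \<in> N" using xc by (simp add: l_minus r_minus)
  qed
  then show False using specht_lower_upper[of lam r e q] assms(3) B
    by (auto simp: lies_in_def N_def)
qed

lemma partition_part_le_psize:
  assumes "is_partition p" "p a \<noteq> 0"
  shows "a < psize p"
proof -
  have "{..a} \<subseteq> {i. p i \<noteq> 0}"
    using assms antimonoD[of p _ a] by (fastforce simp: is_partition_def)
  then have "(\<Sum>i\<in>{..a}. p i) \<le> psize p"
    unfolding psize_def using assms(1) by (intro sum_mono2) (auto simp: is_partition_def)
  moreover have "(\<Sum>i\<in>{..a}. 1) \<le> (\<Sum>i\<in>{..a}. p i)"
    using \<open>{..a} \<subseteq> {i. p i \<noteq> 0}\<close> by (intro sum_mono) auto
  ultimately show ?thesis by simp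
qed

text \<open>
  A numerical measure that is strictly monotone for dominance and bounded on the multipartitions
  of \<open>n\<close>; it serves for induction from the most dominant multipartition downwards.
\<close>

definition dominance_rank :: "nat \<Rightarrow> multipartition \<Rightarrow> nat" where
  "dominance_rank n lam =
     (\<Sum>s<length lam. \<Sum>k\<le>n. (\<Sum>i<s. psize (lam ! i)) + (\<Sum>a<k. (lam ! s) a))"

lemma partial_sum_le_psize:
  assumes "is_partition p"
  shows "(\<Sum>a<k. p a) \<le> psize p"
proof -
  have "(\<Sum>a<k. p a) = (\<Sum>a\<in>{..<k} \<inter> {a. p a \<noteq> 0}. p a)"
    by (intro sum.mono_neutral_right) auto
  also have "\<dots> \<le> psize p" unfolding psize_def using assms
    by (intro sum_mono2) (auto simp: is_partition_def)
  finally show ?thesis .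
qed

lemma msize_nth: "msize lam = (\<Sum>i<length lam. psize (lam ! i))"
  by (simp add: msize_def sum_list_sum_nth atLeast0LessThan)

lemma dominance_rank_le:
  assumes "lam \<in> multipartitions l" "msize lam = n"
  shows "dominance_rank n lam \<le> l * (n + 1) * n"
proof -
  have "(\<Sum>i<s. psize (lam ! i)) + (\<Sum>a<k. (lam ! s) a) \<le> n" if "s < length lam" for s k
  proof -
    have "(\<Sum>i<s. psize (lam ! i)) + (\<Sum>a<k. (lam ! s) a) \<le> (\<Sum>i<Suc s. psize (lam ! i))"
      using that assms by (auto simp: multipartitions_def intro!: partial_sum_le_psize)
    also have "\<dots> \<le> (\<Sum>i<length lam. psize (lam ! i))" using that by (intro sum_mono2) auto
    finally show ?thesis using assms by (simp add: msize_nth)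
  qed
  then have "dominance_rank n lam \<le> (\<Sum>s<length lam. \<Sum>k\<le>n. n)"
    unfolding dominance_rank_def by (intro sum_mono) auto
  then show ?thesis using assms by (simp add: multipartitions_def algebra_simps)
qed

lemma dominance_rank_less:
  assumes lam: "lam \<in> multipartitions l" "msize lam = n"
    and mu: "mu \<in> multipartitions l" "msize mu = n"
    and dom: "dominates mu lam" "mu \<noteq> lam"
  shows "dominance_rank n lam < dominance_rank n mu"
proof (rule ccontr)
  let ?f = "\<lambda>lam s k. (\<Sum>i<s. psize (lam ! i)) + (\<Sum>a<k. (lam ! s) a)"
  have len: "length lam = l" "length mu = l" using lam mu by (auto simp: multipartitions_def)
  have le: "?f lam s k \<le> ?f mu s k" if "s < l" for s k
    using dom that len by (auto simp: dominates_def)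
  assume "\<not> dominance_rank n lam < dominance_rank n mu"
  then have eq: "(\<Sum>s<l. \<Sum>k\<le>n. ?f lam s k) = (\<Sum>s<l. \<Sum>k\<le>n. ?f mu s k)"
    using le unfolding dominance_rank_def len not_less by (intro antisym) (auto intro!: sum_mono)
  have "(\<Sum>k\<le>n. ?f lam s k) = (\<Sum>k\<le>n. ?f mu s k)" if "s < l" for s
    by (rule sum_mono_inv[OF eq]) (use le that in \<open>auto intro!: sum_mono\<close>)
  then have eq2: "?f lam s k = ?f mu s k" if "s < l" "k \<le> n" for s k
    by (rule sum_mono_inv[of _ "{..n}"]) (use le that in auto)
  have "lam ! s = mu ! s" if s: "s < l" for s
  proof
    fix a
    show "(lam ! s) a = (mu ! s) a"
    proof (cases "a < n")
      case True
      then show ?thesis using eq2[OF s, of a] eq2[OF s, of 0] eq2[OF s, of "Suc a"] by simp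
    next
      case False
      have "psize (lam ! s) \<le> n" "psize (mu ! s) \<le> n"
        using lam mu s len member_le_sum[of s "{..<l}" "\<lambda>i. psize (lam ! i)"]
          member_le_sum[of s "{..<l}" "\<lambda>i. psize (mu ! i)"] by (auto simp: msize_nth)
      moreover have "is_partition (lam ! s)" "is_partition (mu ! s)"
        using lam mu s len by (auto simp: multipartitions_def)
      ultimately show ?thesis using False partition_part_le_psize by (metis le_trans not_le)
    qed
  qed
  then show False using dom(2) len by (auto intro: nth_equalityI)
qed

lemma T_perm_id: "T_perm n id = 1"
proof -
  define P where "P = (\<lambda>ks. set ks \<subseteq> {1..<n} \<and> word_perm ks = id)"
  have "P []" by (simp add: P_def word_perm_def)
  then have "length (arg_min length P) \<le> 0" using arg_min_nat_le[of P "[]" length] by simp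
  then show ?thesis unfolding T_perm_def P_def[symmetric] by simp
qed

text \<open>
  For the bipartition with empty first component and a single column in the second, the product
  over the first component is empty and the Young subgroup is trivial.
\<close>

lemma m_elt_column:
  assumes "length r = 2"
  shows "m_elt e q r [\<lambda>_. 0, \<lambda>a. if a < n then 1 else 0] = \<one>\<^bsub>AK e q r n\<^esub>"
proof -
  let ?p = "\<lambda>a::nat. if a < n then 1 else 0 :: nat"
  let ?lam = "[\<lambda>_. 0, ?p]"
  have sz: "psize (\<lambda>_. 0) = 0" "psize ?p = n" by (auto simp: psize_def)
  then have msz: "msize ?lam = n" by (simp add: msize_def)
  have row: "row_entries ?lam 1 a = {Suc a}" if "a < n" for a
  proof -
    have "(\<Sum>d<a. ?p d) = (\<Sum>d<a. 1)" using that by (intro sum.cong) auto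
    then show ?thesis using that by (simp add: row_entries_def sz)
  qed
  have "young_subgroup ?lam = {id}"
  proof (intro equalityI subsetI)
    fix w assume w: "w \<in> young_subgroup ?lam"
    have "w x = x" for x
    proof (cases "x \<in> {1..n}")
      case True
      then have "w ` row_entries ?lam 1 (x - 1) = row_entries ?lam 1 (x - 1)"
        using w by (auto simp: young_subgroup_def)
      then show ?thesis using row[of "x - 1"] True by auto
    next
      case False
      then show ?thesis using w msz by (auto simp: young_subgroup_def permutes_def)
    qed
    then show "w \<in> {id}" by auto
  qed (auto simp: young_subgroup_def)
  then have x: "x_elt ?lam = (1 :: 'a free)" by (simp add: x_elt_def T_perm_id)
  have u: "u_elt e q r ?lam = 1" using assms sz by (simp add: u_elt_def upt_conv_Cons)
  have "1 = \<one>\<^bsub>AK_free e q n\<^esub>" by (simp add: AK_free_def free_algebra_def)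
  then show ?thesis unfolding m_elt_def Let_def msz x u
    by (simp add: AK_def FactRing_def)
qed

lemma column_multipartition:
  "[\<lambda>_. 0, \<lambda>a. if a < n then 1 else 0] \<in> multipartitions 2"
  "msize [\<lambda>_. 0, \<lambda>a. if a < n then 1 else 0] = n"
  by (auto simp: multipartitions_def is_partition_def antimono_def msize_def psize_def)

text \<open>
  Suppose that no multipartition lies in the block of \<open>b\<close>. Each Specht module belongs to another
  block, so \<open>b\<close> annihilates it, that is, \<open>m\<^sub>\<lambda> b\<close> lies in the ideal generated by the \<open>m\<^sub>\<mu>\<close> with \<open>\<mu>\<close>
  strictly dominating \<open>\<lambda>\<close>. By induction on dominance \<open>b\<close> annihilates those \<open>m\<^sub>\<mu>\<close>, and as \<open>b\<close> is
  central it annihilates the ideal that they generate; hence \<open>m\<^sub>\<lambda> b = m\<^sub>\<lambda> b b = 0\<close>. For the column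
  bipartition \<open>m\<^sub>\<lambda> = 1\<close>, so \<open>b = 0\<close>.
\<close>

lemma block_inhabited:
  assumes len: "length r = 2" and B: "B \<in> blocks e q r"
    and ex: "\<And>lam. lam \<in> multipartitions 2 \<Longrightarrow> \<exists>B \<in> blocks e q r. lies_in e q r lam B"
  shows "\<exists>lam. lies_in e q r lam B"
proof (rule ccontr)
  assume none: "\<not> ?thesis"
  obtain n b where Bnb: "B = (n, b)" by (cases B)
  define H where "H = AK e q r n"
  interpret ring H unfolding H_def by (rule AK_ring)
  have b: "block_idempotent H b" using B by (auto simp: blocks_def Bnb H_def)
  then have bc: "b \<in> carrier H" "b \<otimes>\<^bsub>H\<^esub> b = b" "b \<noteq> \<zero>\<^bsub>H\<^esub>"
      and comm: "\<And>x. x \<in> carrier H \<Longrightarrow> b \<otimes>\<^bsub>H\<^esub> x = x \<otimes>\<^bsub>H\<^esub> b"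
    by (auto simp: block_idempotent_def central_idempotent_def)
  define Ann where "Ann = {x \<in> carrier H. x \<otimes>\<^bsub>H\<^esub> b = \<zero>\<^bsub>H\<^esub>}"
  have Ann: "ideal Ann H"
  proof (rule idealI)
    show "subgroup Ann (add_monoid H)"
    proof (rule add.subgroupI)
      show "Ann \<noteq> {}" using bc(1) by (auto simp: Ann_def intro!: exI[of _ "\<zero>\<^bsub>H\<^esub>"])
      show "\<ominus>\<^bsub>H\<^esub> a \<in> Ann" if "a \<in> Ann" for a
        using that bc(1) by (simp add: Ann_def l_minus)
    qed (use bc(1) in \<open>auto simp: Ann_def l_distr\<close>)
    show "x \<otimes>\<^bsub>H\<^esub> a \<in> Ann" if "a \<in> Ann" "x \<in> carrier H" for a x
      using that bc by (auto simp: Ann_def m_assoc)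
    show "a \<otimes>\<^bsub>H\<^esub> x \<in> Ann" if "a \<in> Ann" "x \<in> carrier H" for a x
    proof -
      have a: "a \<in> carrier H" using that by (simp add: Ann_def)
      have "a \<otimes>\<^bsub>H\<^esub> x \<otimes>\<^bsub>H\<^esub> b = a \<otimes>\<^bsub>H\<^esub> (b \<otimes>\<^bsub>H\<^esub> x)"
        unfolding comm[OF that(2)] by (rule m_assoc[OF a that(2) bc(1)])
      also have "\<dots> = a \<otimes>\<^bsub>H\<^esub> b \<otimes>\<^bsub>H\<^esub> x"
        by (rule m_assoc[OF a bc(1) that(2), symmetric])
      finally have "a \<otimes>\<^bsub>H\<^esub> x \<otimes>\<^bsub>H\<^esub> b = a \<otimes>\<^bsub>H\<^esub> b \<otimes>\<^bsub>H\<^esub> x" .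
      then show ?thesis using that by (auto simp: Ann_def)
    qed
  qed (rule ring_axioms)
  define P where "P = (\<lambda>lam. lam \<in> multipartitions 2 \<and> msize lam = n)"
  have carr: "m_elt e q r lam \<in> carrier H" if "P lam" for lam
    unfolding H_def using that len by (intro m_elt_closed) (auto simp: P_def multipartitions_def)
  have step: "m_elt e q r lam \<in> Ann"
    if lam: "P lam"
      and above: "\<And>mu. P mu \<Longrightarrow> dominates mu lam \<Longrightarrow> mu \<noteq> lam \<Longrightarrow> m_elt e q r mu \<in> Ann" for lam
  proof -
    define N where "N = specht_lower e q r lam"
    have sz: "msize lam = n" "length lam = length r" using lam len by (auto simp: P_def multipartitions_def)
    interpret N: ideal N H unfolding H_def N_def using specht_lower_ideal sz by metis
    have NAnn: "N \<subseteq> Ann" unfolding N_def specht_lower_def sz H_def[symmetric] len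
      by (rule genideal_minimal[OF Ann]) (use above in \<open>auto simp: P_def\<close>)
    obtain B' where B': "B' \<in> blocks e q r" "lies_in e q r lam B'" using ex[of lam] lam unfolding P_def by blast
    obtain b' where Bnb': "B' = (n, b')" using B'(2) sz by (cases B') (auto simp: lies_in_def)
    have "b' \<noteq> b" using B' none Bnb Bnb' by auto
    moreover have b': "block_idempotent H b'" using B' by (auto simp: blocks_def Bnb' H_def)
    ultimately have 0: "b' \<otimes>\<^bsub>H\<^esub> b = \<zero>\<^bsub>H\<^esub>" using b by (intro block_idempotent_disjoint) auto
    have b'c: "b' \<in> carrier H" using b' by (auto simp: block_idempotent_def central_idempotent_def)
    let ?m = "m_elt e q r lam"
    have "?m \<otimes>\<^bsub>H\<^esub> b' \<ominus>\<^bsub>H\<^esub> ?m \<in> N"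
      using B'(2) mem_specht_upper[OF sz(2), of e q] by (auto simp: lies_in_def Bnb' H_def N_def)
    then have "(?m \<otimes>\<^bsub>H\<^esub> b' \<ominus>\<^bsub>H\<^esub> ?m) \<otimes>\<^bsub>H\<^esub> b = \<zero>\<^bsub>H\<^esub>" using NAnn by (auto simp: Ann_def)
    then have "\<ominus>\<^bsub>H\<^esub> (?m \<otimes>\<^bsub>H\<^esub> b) = \<zero>\<^bsub>H\<^esub>"
      using carr[OF lam] bc(1) b'c 0 by (simp add: a_minus_def l_distr l_minus m_assoc)
    then have "?m \<otimes>\<^bsub>H\<^esub> b = \<zero>\<^bsub>H\<^esub>"
      using carr[OF lam] bc(1) by (metis m_closed minus_minus minus_zero)
    then show ?thesis using carr[OF lam] by (simp add: Ann_def)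
  qed
  have "m_elt e q r lam \<in> Ann" if "P lam" for lam
    using that
  proof (induction "2 * (n + 1) * n - dominance_rank n lam" arbitrary: lam rule: less_induct)
    case less
    show ?case
    proof (rule step[OF less.prems])
      fix mu assume mu: "P mu" "dominates mu lam" "mu \<noteq> lam"
      then have "dominance_rank n lam < dominance_rank n mu" "dominance_rank n mu \<le> 2 * (n + 1) * n"
        using less.prems dominance_rank_less[of lam 2 n mu] dominance_rank_le[of mu 2 n]
        by (auto simp: P_def)
      then show "m_elt e q r mu \<in> Ann" by (intro less.hyps mu) auto
    qed
  qed
  moreover have "P [\<lambda>_. 0, \<lambda>a. if a < n then 1 else 0]"
    using column_multipartition by (simp add: P_def)
  ultimately have "\<one>\<^bsub>H\<^esub> \<in> Ann" using m_elt_column[OF len, of e q n] unfolding H_def by metis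
  then show False using bc by (simp add: Ann_def)
qed

section \<open>The action of the extended affine Weyl group\<close>

lemma weyl2_cases:
  assumes "w \<in> ext_affine_weyl 2"
  obtains \<sigma> u0 u1 where "w = (\<sigma>, [u0, u1])" "\<sigma> = id \<or> \<sigma> = Transposition.transpose 0 1"
proof -
  obtain \<sigma> u where w: "w = (\<sigma>, u)" "\<sigma> permutes {..<2}" "length u = 2"
    using assms by (auto simp: ext_affine_weyl_def)
  have "{..<2} = {0, 1::nat}" by auto
  then have "\<sigma> = id \<or> \<sigma> = Transposition.transpose 0 1"
    using w(2) by (simp add: permutes_doubleton_iff)
  moreover obtain u0 u1 where "u = [u0, u1]"
    using w(3) by (metis (no_types, lifting) One_nat_def Suc_length_conv length_0_conv numeral_2_eq_2)
  ultimately show ?thesis using that w(1) by blast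
qed

lemma map_upt_2: "map f [0..<2] = [f 0, f 1]"
  by (simp add: upt_rec numeral_2_eq_2)

lemma weyl2_charge_act:
  assumes "length t = 2"
  shows "charge_act e t (id, [u0, u1]) = [t ! 0 + int e * u0, t ! 1 + int e * u1]"
    "charge_act e t (Transposition.transpose 0 1, [u0, u1]) = [t ! 1 + int e * u0, t ! 0 + int e * u1]"
  using assms by (simp_all add: charge_act_def permute_list_def map_upt_2)

lemma weyl2_mp_act:
  assumes "length lam = 2"
  shows "mp_act lam (id, [u0, u1]) = [lam ! 0, lam ! 1]"
    "mp_act lam (Transposition.transpose 0 1, [u0, u1]) = [lam ! 1, lam ! 0]"
  using assms by (simp_all add: mp_act_def permute_list_def map_upt_2)

lemma runner_shift:
  "runner e ((\<lambda>z. z + int e * u) ` B) b = (\<lambda>z. z + u) ` runner e B b"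
  unfolding shift_image_eq by (simp add: runner_def algebra_simps)

definition rcharge :: "nat \<Rightarrow> int \<Rightarrow> partition \<Rightarrow> nat \<Rightarrow> int" where
  "rcharge e t p b = charge (runner e (beta t p) b)"

lemma rcharge_shift:
  assumes "is_partition p" "b < e"
  shows "rcharge e (t + int e * u) p b = rcharge e t p b + u"
  unfolding rcharge_def beta_shift runner_shift
  using assms by (simp add: bsize_shift beta_set_runner beta_set_beta)

lemma refl_part_shift:
  assumes "e \<ge> 2" "j < e" "is_partition p"
  shows "refl_part e (t + int e * u) j p = refl_part e t j p"
proof -
  have s: "swap_pos e j (z + int e * u) = swap_pos e j z + int e * u" for z
  proof -
    have "(z + int e * u + 1) mod int e = (z + 1) mod int e"
      using mod_mult_self2[of "z + 1" "int e" u] by (simp add: algebra_simps)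
    then show ?thesis by (simp add: swap_pos_def)
  qed
  have "beta (t + int e * u) (refl_part e (t + int e * u) j p) = beta (t + int e * u) (refl_part e t j p)"
    using assms by (simp add: refl_part(2)) (simp add: beta_shift refl_part(2) image_image s)
  then show ?thesis using refl_part(1) assms by (intro beta_inj)
qed

lemma refl_part_core:
  assumes "e \<ge> 2" "j < e" "is_partition p"
  shows "partition_wt e (refl_part e t j p) = 0 \<longleftrightarrow> partition_wt e p = 0"
  using assms partition_wt_eq_0_iff[of e _ t] refl_part[OF assms(1,3)]
  by (simp add: pos_core_swap beta_set_beta)

lemma refl_part_invol:
  assumes "e \<ge> 2" "j < e" "is_partition p"
  shows "refl_part e t j (refl_part e t j p) = p"
proof (rule beta_inj[of _ _ t])
  show "beta t (refl_part e t j (refl_part e t j p)) = beta t p"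
    using assms refl_part[OF assms(1)] by (simp add: image_image swap_pos_invol)
qed (use assms refl_part(1) in auto)

lemma list2_eq: "length xs = 2 \<Longrightarrow> xs = [xs ! 0, xs ! 1]"
  by (cases xs; cases "tl xs") auto

lemma multipartitions2_iff:
  "[p, p'] \<in> multipartitions 2 \<longleftrightarrow> is_partition p \<and> is_partition p'"
  by (auto simp: multipartitions_def)

section \<open>Blocks for a 2-charge\<close>

text \<open>
  Everything about blocks is derived from their classification by cores and weights, together with
  \<open>block_inhabited\<close> and \<open>lies_in_unique\<close>.
\<close>

locale two_charge_blocks =
  fixes e :: nat and q :: "'f::field" and r :: "int list"
  assumes e: "e \<ge> 2" and len: "length r = 2"
    and classification:
      "\<And>lam mu w. \<lbrakk>lam \<in> multipartitions 2; mu \<in> multipartitions 2;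
          w \<in> ext_affine_weyl 2; charge_act e r w \<in> closed_alcove e 2\<rbrakk> \<Longrightarrow>
        (\<exists>B \<in> blocks e q r. lies_in e q r lam B \<and> lies_in e q r mu B) \<longleftrightarrow>
        beta_inv (mcore e (mp_act lam w) (charge_act e r w)) =
          beta_inv (mcore e (mp_act mu w) (charge_act e r w)) \<and>
        mwt e (mp_act lam w) (charge_act e r w) = mwt e (mp_act mu w) (charge_act e r w)"
begin

text \<open>
  The levels are measured with respect to \<open>r\<close> itself. Passing to \<open>r\<^sup>w\<close> shifts all entries of
  \<open>cvec\<close> by one constant, and changes \<open>dvec\<close> by a constant and possibly a sign, so equality of the
  vectors \<open>cvec\<close> and the absolute differences between entries of \<open>dvec\<close> are the same for all \<open>w\<close>.
\<close>

definition xvec where "xvec lam = rcharge e (r ! 0) (lam ! 0)"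
definition yvec where "yvec lam = rcharge e (r ! 1) (lam ! 1)"
definition cvec where "cvec lam b = xvec lam b + yvec lam b"
definition dvec where "dvec lam b = xvec lam b - yvec lam b"

definition betas :: "(nat \<Rightarrow> nat) \<times> int list \<Rightarrow> multipartition \<Rightarrow> nat \<Rightarrow> int set" where
  "betas w lam k = beta (charge_act e r w ! k) (mp_act lam w ! k)"

definition weight where "weight w lam = pair_wt e (betas w lam 0) (betas w lam 1)"

lemma e0: "e > 0" using e by simp

lemma act:
  assumes "lam \<in> multipartitions 2" "w \<in> ext_affine_weyl 2"
  shows "\<exists>\<sigma> u0 u1. w = (\<sigma>, [u0, u1]) \<and>
    (\<sigma> = id \<and> charge_act e r w = [r ! 0 + int e * u0, r ! 1 + int e * u1] \<and> mp_act lam w = [lam ! 0, lam ! 1] \<or>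
     \<sigma> = Transposition.transpose 0 1 \<and>
     charge_act e r w = [r ! 1 + int e * u0, r ! 0 + int e * u1] \<and> mp_act lam w = [lam ! 1, lam ! 0])"
proof -
  have l: "length lam = 2" using assms(1) by (simp add: multipartitions_def)
  obtain \<sigma> u0 u1 where "w = (\<sigma>, [u0, u1])" "\<sigma> = id \<or> \<sigma> = Transposition.transpose 0 1"
    using weyl2_cases[OF assms(2)] .
  then show ?thesis using weyl2_charge_act[OF len] weyl2_mp_act[OF l] by blast
qed

lemma part: "lam \<in> multipartitions 2 \<Longrightarrow> is_partition (lam ! 0) \<and> is_partition (lam ! 1)"
  by (auto simp: multipartitions_def)

lemma betas_beta_set:
  assumes "lam \<in> multipartitions 2" "w \<in> ext_affine_weyl 2"
  shows "beta_set (betas w lam 0)" "beta_set (betas w lam 1)"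
    "charge (betas w lam 0) = charge_act e r w ! 0" "charge (betas w lam 1) = charge_act e r w ! 1"
  using act[OF assms] part[OF assms(1)] by (auto simp: betas_def beta_set_beta charge_beta)

lemma betas_pair_charge:
  assumes "lam \<in> multipartitions 2" "w \<in> ext_affine_weyl 2" "b < e"
  shows "pair_charge e (betas w lam 0) (betas w lam 1) b = cvec lam b + sum_list (snd w)"
  using act[OF assms(1,2)] part[OF assms(1)] assms(3)
  by (auto simp: betas_def pair_charge_def cvec_def xvec_def yvec_def rcharge_shift simp flip: rcharge_def)

lemma uglov_betas:
  assumes "lam \<in> multipartitions 2" "w \<in> ext_affine_weyl 2"
  shows "uglov e (mbeta (charge_act e r w) (mp_act lam w)) = uglov e [betas w lam 0, betas w lam 1]"
  using act[OF assms] by (auto simp: mbeta_def betas_def)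

lemma same_block_iff:
  assumes lam: "lam \<in> multipartitions 2" and mu: "mu \<in> multipartitions 2"
    and w: "w \<in> ext_affine_weyl 2" "charge_act e r w \<in> closed_alcove e 2"
  shows "(\<exists>B \<in> blocks e q r. lies_in e q r lam B \<and> lies_in e q r mu B) \<longleftrightarrow>
    (\<forall>b<e. cvec lam b = cvec mu b) \<and> weight w lam = weight w mu"
proof -
  note bl = betas_beta_set[OF lam w(1)] and bm = betas_beta_set[OF mu w(1)]
  have "beta_inv (mcore e (mp_act lam w) (charge_act e r w)) =
      beta_inv (mcore e (mp_act mu w) (charge_act e r w)) \<longleftrightarrow> (\<forall>b<e. cvec lam b = cvec mu b)"
    unfolding mcore_def uglov_betas[OF lam w(1)] uglov_betas[OF mu w(1)]
    using bl bm betas_pair_charge[OF lam w(1)] betas_pair_charge[OF mu w(1)]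
    by (subst core_uglov_eq_iff[OF e0]) auto
  moreover have "mwt e (mp_act lam w) (charge_act e r w) = weight w lam" if "lam \<in> multipartitions 2" for lam
    unfolding mwt_def uglov_betas[OF that w(1)] weight_def by (rule wt_uglov)
  ultimately show ?thesis unfolding classification[OF lam mu w] using lam mu by simp
qed

text \<open>
  Translating the second charge by a multiple of \<open>e\<close> brings it into \<open>[r\<^sub>1, r\<^sub>1 + e)\<close>.
\<close>

definition w0 :: "(nat \<Rightarrow> nat) \<times> int list" where
  "w0 = (id, [0, - ((r ! 1 - r ! 0) div int e)])"

lemma w0: "w0 \<in> ext_affine_weyl 2" "charge_act e r w0 \<in> closed_alcove e 2"
proof -
  show "w0 \<in> ext_affine_weyl 2" by (simp add: w0_def ext_affine_weyl_def permutes_id)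
  have "r ! 1 - r ! 0 = int e * ((r ! 1 - r ! 0) div int e) + (r ! 1 - r ! 0) mod int e" by simp
  moreover have "0 \<le> (r ! 1 - r ! 0) mod int e" "(r ! 1 - r ! 0) mod int e < int e" using e by auto
  ultimately have "r ! 0 \<le> r ! 1 - int e * ((r ! 1 - r ! 0) div int e)"
    "r ! 1 - int e * ((r ! 1 - r ! 0) div int e) \<le> r ! 0 + int e" by linarith+
  then show "charge_act e r w0 \<in> closed_alcove e 2"
    unfolding w0_def weyl2_charge_act(1)[OF len] by (simp add: closed_alcove_def)
qed

lemma in_some_block:
  assumes "lam \<in> multipartitions 2"
  shows "\<exists>B \<in> blocks e q r. lies_in e q r lam B"
  using same_block_iff[OF assms assms w0] by blast

lemma inhabited: "B \<in> blocks e q r \<Longrightarrow> \<exists>lam. lies_in e q r lam B"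
  using block_inhabited[OF len] in_some_block by blast

lemma lies_in_mp: "lies_in e q r lam B \<Longrightarrow> lam \<in> multipartitions 2"
  by (cases B) (auto simp: lies_in_def len)

text \<open>
  Since a multipartition lies in at most one block, the classification describes the members of a
  block in terms of any one of them.
\<close>

lemma same_block:
  assumes "B \<in> blocks e q r" "lies_in e q r lam B" "w \<in> ext_affine_weyl 2"
    "charge_act e r w \<in> closed_alcove e 2"
  shows "lies_in e q r mu B \<longleftrightarrow>
    mu \<in> multipartitions 2 \<and> (\<forall>b<e. cvec lam b = cvec mu b) \<and> weight w lam = weight w mu"
proof
  assume mu: "lies_in e q r mu B"
  then show "mu \<in> multipartitions 2 \<and> (\<forall>b<e. cvec lam b = cvec mu b) \<and> weight w lam = weight w mu"
    using same_block_iff[OF lies_in_mp[OF assms(2)] lies_in_mp[OF mu] assms(3,4)] assms(1,2) lies_in_mp[OF mu]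
    by blast
next
  assume *: "mu \<in> multipartitions 2 \<and> (\<forall>b<e. cvec lam b = cvec mu b) \<and> weight w lam = weight w mu"
  then obtain B' where B': "B' \<in> blocks e q r" "lies_in e q r lam B'" "lies_in e q r mu B'"
    using same_block_iff[OF lies_in_mp[OF assms(2)] _ assms(3,4)] by blast
  then have "B' = B" using assms by (intro lies_in_unique)
  then show "lies_in e q r mu B" using B' by simp
qed

section \<open>The reflections on blocks\<close>

abbreviation refl_mp where "refl_mp j \<equiv> node_refl e r j"

lemma refl_mp_eq:
  assumes "lam \<in> multipartitions 2"
  shows "refl_mp j lam = [refl_part e (r ! 0) j (lam ! 0), refl_part e (r ! 1) j (lam ! 1)]"
  unfolding node_refl_eq[OF e assms] by (simp add: upt_rec numeral_2_eq_2)

lemma refl_mp: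
  assumes lam: "lam \<in> multipartitions 2" and j: "j < e"
  shows "refl_mp j lam \<in> multipartitions 2" "refl_mp j (refl_mp j lam) = lam"
    "b < e \<Longrightarrow> cvec (refl_mp j lam) b = swap_charge e j (cvec lam) b"
    "w \<in> ext_affine_weyl 2 \<Longrightarrow> weight w (refl_mp j lam) = weight w lam"
    "(\<forall>p\<in>set (refl_mp j lam). partition_wt e p = 0) \<longleftrightarrow> (\<forall>p\<in>set lam. partition_wt e p = 0)"
proof -
  note p = part[OF lam]
  have len_lam: "length lam = 2" using lam by (simp add: multipartitions_def)
  show mp: "refl_mp j lam \<in> multipartitions 2"
    using p refl_part(1)[OF e] by (simp add: refl_mp_eq[OF lam] multipartitions2_iff)
  have "refl_mp j (refl_mp j lam) = [lam ! 0, lam ! 1]"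
    using p by (subst refl_mp_eq[OF mp]) (simp add: refl_mp_eq[OF lam] refl_part_invol[OF e j])
  also have "\<dots> = lam" by (rule list2_eq[OF len_lam, symmetric])
  finally show "refl_mp j (refl_mp j lam) = lam" .
  show "cvec (refl_mp j lam) b = swap_charge e j (cvec lam) b" if "b < e"
    using pair_charge_swap[OF e j that, of "beta (r ! 0) (lam ! 0)" "beta (r ! 1) (lam ! 1)"] p refl_part(2)[OF e _ j]
    by (simp add: refl_mp_eq[OF lam] cvec_def[abs_def] xvec_def yvec_def rcharge_def[abs_def]
        pair_charge_def[abs_def] beta_set_beta)
  show "(\<forall>p\<in>set (refl_mp j lam). partition_wt e p = 0) \<longleftrightarrow> (\<forall>p\<in>set lam. partition_wt e p = 0)"
    using p by (subst (2) list2_eq[OF len_lam]) (simp add: refl_mp_eq[OF lam] refl_part_core[OF e j])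
  show "weight w (refl_mp j lam) = weight w lam" if w: "w \<in> ext_affine_weyl 2"
  proof -
    have "betas w (refl_mp j lam) k = swap_pos e j ` betas w lam k" if k: "k = 0 \<or> k = 1" for k
    proof -
      have *: "beta (t + int e * u) (refl_part e t j p) = swap_pos e j ` beta (t + int e * u) p"
        if "is_partition p" for t u p
        using refl_part(2)[OF e that j, of "t + int e * u"] refl_part_shift[OF e j that, of t u] by simp
      obtain \<sigma> u0 u1 where w': "w = (\<sigma>, [u0, u1])" "\<sigma> = id \<or> \<sigma> = Transposition.transpose 0 1"
        using weyl2_cases[OF w] .
      show ?thesis using w'(2) k p unfolding w'(1) betas_def
        by (elim disjE) (simp_all add: weyl2_charge_act[OF len] weyl2_mp_act len_lam refl_mp_eq[OF lam] * del: One_nat_def)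
    qed
    then show ?thesis
      using betas_beta_set[OF lam w] by (simp add: weight_def pair_wt_swap[OF e j])
  qed
qed

text \<open>
  On multipartitions \<open>s\<^sub>j\<close> is an involution that acts on \<open>cvec\<close> by \<open>swap_charge\<close> and keeps the
  weight, so it maps the members of a block bijectively onto those of another.
\<close>

lemma block_refl:
  assumes B: "B \<in> blocks e q r" and j: "j < e"
  shows "block_refl e q r j B \<in> blocks e q r"
    "lies_in e q r mu (block_refl e q r j B) \<longleftrightarrow> mu \<in> multipartitions 2 \<and> lies_in e q r (refl_mp j mu) B"
proof -
  obtain lam0 where lam0: "lies_in e q r lam0 B" using inhabited[OF B] by blast
  note m0 = lies_in_mp[OF lam0]
  obtain B1 where B1: "B1 \<in> blocks e q r" "lies_in e q r (refl_mp j lam0) B1"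
    using in_some_block[OF refl_mp(1)[OF m0 j]] by blast
  have fwd: "lies_in e q r (refl_mp j lam) B1" if lam: "lies_in e q r lam B" for lam
  proof -
    note m = lies_in_mp[OF lam]
    have "swap_charge e j (cvec lam0) b = swap_charge e j (cvec lam) b" if "b < e" for b
      using same_block[OF B lam0 w0, of lam] lam that pred_runner[OF e j] j by (auto simp: swap_charge_def)
    then show ?thesis
      using same_block[OF B lam0 w0, of lam] lam same_block[OF B1 w0, of "refl_mp j lam"]
        refl_mp(1,3,4)[OF m j] refl_mp(1,3,4)[OF m0 j] w0(1) by simp
  qed
  have bwd: "lies_in e q r (refl_mp j mu) B" if mu: "lies_in e q r mu B1" for mu
  proof -
    note m = lies_in_mp[OF mu]
    have c: "cvec (refl_mp j lam0) b = cvec mu b" if "b < e" for b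
      using same_block[OF B1 w0, of mu] mu that by simp
    have "cvec lam0 b = cvec (refl_mp j mu) b" if b: "b < e" for b
    proof -
      have "cvec lam0 b = swap_charge e j (cvec (refl_mp j lam0)) b"
        using refl_mp(2)[OF m0 j] refl_mp(3)[OF refl_mp(1)[OF m0 j] j b] by simp
      also have "\<dots> = swap_charge e j (cvec mu) b"
        using c pred_runner[OF e j] j b by (auto simp: swap_charge_def)
      also have "\<dots> = cvec (refl_mp j mu) b" using refl_mp(3)[OF m j b] by simp
      finally show ?thesis .
    qed
    then show ?thesis
      using same_block[OF B1 w0, of mu] mu same_block[OF B lam0 w0, of "refl_mp j mu"]
        refl_mp(1,4)[OF m j] refl_mp(4)[OF m0 j] w0(1) by simp
  qed
  have eq: "block_refl e q r j B = B1"
    unfolding block_refl_def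
  proof (rule the_equality)
    show "B1 \<in> blocks e q r \<and> (\<forall>lam. lies_in e q r lam B \<longrightarrow> lies_in e q r (refl_mp j lam) B1)"
      using B1 fwd by blast
    fix B' assume "B' \<in> blocks e q r \<and> (\<forall>lam. lies_in e q r lam B \<longrightarrow> lies_in e q r (refl_mp j lam) B')"
    then show "B' = B1" using lies_in_unique[OF _ B1(1) _ B1(2)] lam0 by blast
  qed
  show "block_refl e q r j B \<in> blocks e q r" using B1 eq by simp
  show "lies_in e q r mu (block_refl e q r j B) \<longleftrightarrow> mu \<in> multipartitions 2 \<and> lies_in e q r (refl_mp j mu) B"
    using bwd fwd[of "refl_mp j mu"] refl_mp(2)[OF _ j, of mu] lies_in_mp[of mu B1] unfolding eq by auto
qed

section \<open>Core blocks and Scopes equivalence\<close>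

abbreviation is_core where "is_core B \<equiv> core_block e q r B"

lemma core_block_refl:
  assumes "is_core B" "j < e"
  shows "is_core (block_refl e q r j B)"
  using assms block_refl[of B j] refl_mp(5)[OF _ assms(2)] unfolding core_block_def by blast

lemma core_runners:
  assumes "is_core B" "lies_in e q r lam B" "b < e"
  shows "runner e (beta (r ! 0) (lam ! 0)) b = {..<xvec lam b}"
    "runner e (beta (r ! 1) (lam ! 1)) b = {..<yvec lam b}"
proof -
  have lam: "lam \<in> multipartitions 2" using lies_in_mp[OF assms(2)] .
  then have "lam ! 0 \<in> set lam" "lam ! 1 \<in> set lam" by (simp_all add: multipartitions_def)
  then have "partition_wt e (lam ! 0) = 0" "partition_wt e (lam ! 1) = 0"
    using assms(1,2) unfolding core_block_def by blast+
  then have "pos_core e (beta (r ! 0) (lam ! 0))" "pos_core e (beta (r ! 1) (lam ! 1))"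
    using partition_wt_eq_0_iff[OF e0] part[OF lam] by blast+
  then show "runner e (beta (r ! 0) (lam ! 0)) b = {..<xvec lam b}"
    "runner e (beta (r ! 1) (lam ! 1)) b = {..<yvec lam b}"
    using pos_core_runner[OF e0 beta_set_beta] part[OF lam] assms(3)
    unfolding xvec_def yvec_def rcharge_def by blast+
qed

lemma runner_beta_shift:
  assumes "runner e (beta t p) b = {..<x}"
  shows "runner e (beta (t + int e * u) p) b = {..<x + u}"
proof -
  have "(\<lambda>z. z + u) ` {..<x} = {..<x + u}" by (simp add: shift_image_eq) auto
  then show ?thesis using assms by (simp add: beta_shift runner_shift)
qed

text \<open>
  Otherwise the exchange produces a member of the block that is not a pair of cores.
\<close>

lemma core_spread:
  assumes B: "is_core B" and lam: "lies_in e q r lam B" and ab: "a < e" "b < e"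
  shows "dvec lam a - dvec lam b \<le> 2"
proof (rule ccontr)
  assume contr: "\<not> ?thesis"
  note m = lies_in_mp[OF lam]
  define u where "u = - ((r ! 1 - r ! 0) div int e)"
  define t where "t = charge_act e r w0"
  have len_lam: "length lam = 2" using m by (simp add: multipartitions_def)
  have t: "t = [r ! 0, r ! 1 + int e * u]" and mp: "mp_act mu w0 = mu" if "length mu = 2" for mu
    using that len weyl2_charge_act(1)[OF len] weyl2_mp_act(1)[OF that] list2_eq[OF that] unfolding t_def w0_def u_def by simp_all
  let ?C = "betas w0 lam 0" and ?D = "betas w0 lam 1"
  have run: "runner e ?C i = {..<xvec lam i}" "runner e ?D i = {..<yvec lam i + u}" if "i < e" for i
    using core_runners[OF B lam that] runner_beta_shift[of "r ! 1" "lam ! 1" i "yvec lam i" u]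
      t[OF len_lam] mp[OF len_lam] by (simp_all add: betas_def flip: t_def)
  have "\<exists>C' D'. beta_set C' \<and> beta_set D' \<and> charge C' = charge ?C \<and> charge D' = charge ?D \<and>
     (\<forall>i<e. pair_charge e C' D' i = pair_charge e ?C ?D i) \<and> pair_wt e C' D' = pair_wt e ?C ?D \<and>
     \<not> pos_core e C'"
    by (rule exchange[where x = "xvec lam" and y = "\<lambda>i. yvec lam i + u", OF betas_beta_set(1,2)[OF m w0(1)] run ab])
      (use contr in \<open>simp_all add: dvec_def\<close>)
  then obtain C' D' where C': "beta_set C'" "charge C' = charge ?C" "\<not> pos_core e C'"
    and D': "beta_set D'" "charge D' = charge ?D"
    and same: "\<forall>i<e. pair_charge e C' D' i = pair_charge e ?C ?D i" "pair_wt e C' D' = pair_wt e ?C ?D"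
    by blast
  define mu where "mu = [beta_inv C', beta_inv D']"
  have mu: "mu \<in> multipartitions 2"
    using beta_beta_inv(1) C'(1) D'(1) by (simp add: mu_def multipartitions2_iff)
  have b: "betas w0 mu 0 = C'" "betas w0 mu 1 = D'"
    using beta_beta_inv(2)[OF C'(1)] beta_beta_inv(2)[OF D'(1)] C'(2) D'(2) betas_beta_set(3,4)[OF m w0(1)] mp[of mu]
    by (simp_all add: betas_def mu_def)
  have "cvec lam i = cvec mu i" if "i < e" for i
    using same(1) that betas_pair_charge[OF m w0(1) that] betas_pair_charge[OF mu w0(1) that] b by simp
  moreover have "weight w0 lam = weight w0 mu" using same(2) b by (simp add: weight_def)
  ultimately have "lies_in e q r mu B"
    using same_block[OF _ lam w0] B mu by (simp add: core_block_def)
  then have "partition_wt e (beta_inv C') = 0"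
    using B by (auto simp: core_block_def mu_def)
  then have "pos_core e C'"
    using partition_wt_eq_0_iff[OF e0 beta_beta_inv(1)[OF C'(1)], of "charge C'"] beta_beta_inv(2)[OF C'(1)] by simp
  then show False using C'(3) by simp
qed

text \<open>
  Let \<open>\<delta>\<close> be the difference of \<open>cvec\<close> between runner \<open>j\<close> and the runner before it, corrected by \<open>2
  * wrap j\<close>; it is the same for all members of the block. It is the sum of the corresponding
  differences in the two components, and by \<open>core_spread\<close> these are at most 2 apart. If \<open>\<delta> > 0\<close>,
  both are therefore nonnegative and no member has an addable node of residue \<open>j\<close>; symmetrically
  for \<open>\<delta> < 0\<close>. If \<open>\<delta> = 0\<close>, then \<open>s\<^sub>j\<close> fixes \<open>cvec\<close>, and hence the block.
\<close>

lemma elementary_step: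
  assumes B: "is_core B" and j: "j < e"
  shows "scopes_equivalent e q r B (block_refl e q r j B)"
proof -
  have Bb: "B \<in> blocks e q r" using B by (simp add: core_block_def)
  obtain lam0 where lam0: "lies_in e q r lam0 B" using inhabited[OF Bb] by blast
  let ?p = "pred_runner e j"
  have p: "?p < e" using pred_runner[OF e j] by simp
  have const: "cvec lam b = cvec lam0 b" if "lies_in e q r lam B" "b < e" for lam b
    using same_block[OF Bb lam0 w0, of lam] that by simp
  consider (eq) "cvec lam0 j = cvec lam0 ?p + 2 * wrap j"
    | (gt) "cvec lam0 j > cvec lam0 ?p + 2 * wrap j"
    | (lt) "cvec lam0 j < cvec lam0 ?p + 2 * wrap j" by linarith
  then show ?thesis
  proof cases
    case eq
    have "cvec (refl_mp j lam0) b = cvec lam0 b" if "b < e" for b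
      using refl_mp(3)[OF lies_in_mp[OF lam0] j that] eq by (simp add: swap_charge_def)
    then have "lies_in e q r (refl_mp j lam0) B"
      using same_block[OF Bb lam0 w0] refl_mp(1,4)[OF lies_in_mp[OF lam0] j] w0(1) by simp
    then have "lies_in e q r lam0 (block_refl e q r j B)"
      using block_refl(2)[OF Bb j] lies_in_mp[OF lam0] by simp
    then have "block_refl e q r j B = B"
      using lies_in_unique[OF block_refl(1)[OF Bb j] Bb _ lam0] by blast
    then show ?thesis by (simp add: scopes_equivalent_def)
  next
    case gt
    have "residue e r z \<noteq> j" if lam: "lies_in e q r lam B" and z: "z \<in> addable lam" for lam z
    proof -
      define x where "x i = (if i = 0 then xvec lam else yvec lam)" for i :: nat
      have "xvec lam ?p + wrap j \<le> xvec lam j" "yvec lam ?p + wrap j \<le> yvec lam j"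
        using core_spread[OF B lam j p] core_spread[OF B lam p j] const[OF lam j] const[OF lam p] gt
        unfolding dvec_def cvec_def by linarith+
      then show ?thesis
        using core_runners[OF B lam]
        by (intro no_addable[OF e j lies_in_mp[OF lam] _ _ z, where x = x])
          (auto simp: x_def less_2_cases_iff)
    qed
    then have "elementary_scopes e q r B (block_refl e q r j B)"
      using Bb j unfolding elementary_scopes_def by blast
    then show ?thesis by (simp add: scopes_equivalent_def)
  next
    case lt
    have "residue e r z \<noteq> j" if lam: "lies_in e q r lam B" and z: "z \<in> removable lam" for lam z
    proof -
      define x where "x i = (if i = 0 then xvec lam else yvec lam)" for i :: nat
      have "xvec lam j \<le> xvec lam ?p + wrap j" "yvec lam j \<le> yvec lam ?p + wrap j"
        using core_spread[OF B lam j p] core_spread[OF B lam p j] const[OF lam j] const[OF lam p] lt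
        unfolding dvec_def cvec_def by linarith+
      then show ?thesis
        using core_runners[OF B lam]
        by (intro no_removable[OF e j lies_in_mp[OF lam] _ _ z, where x = x])
          (auto simp: x_def less_2_cases_iff)
    qed
    then have "elementary_scopes e q r B (block_refl e q r j B)"
      using Bb j unfolding elementary_scopes_def by blast
    then show ?thesis by (simp add: scopes_equivalent_def)
  qed
qed

lemma scopes_trans: "scopes_equivalent e q r B B' \<Longrightarrow> scopes_equivalent e q r B' B'' \<Longrightarrow> scopes_equivalent e q r B B''"
  unfolding scopes_equivalent_def by (rule rtranclp_trans)

theorem orbit_scopes_equivalent:
  assumes "is_core B" "B' \<in> weyl_orbit e q r B"
  shows "scopes_equivalent e q r B B'"
proof -
  obtain js where js: "set js \<subseteq> {..<e}" "B' = foldr (block_refl e q r) js B"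
    using assms(2) by (auto simp: weyl_orbit_def)
  have "is_core (foldr (block_refl e q r) js B) \<and> scopes_equivalent e q r B (foldr (block_refl e q r) js B)"
    using js(1)
  proof (induction js)
    case Nil
    then show ?case using assms(1) by (simp add: scopes_equivalent_def)
  next
    case (Cons j js)
    then have IH: "is_core (foldr (block_refl e q r) js B)"
        "scopes_equivalent e q r B (foldr (block_refl e q r) js B)" and j: "j < e"
      by auto
    then show ?case
      using core_block_refl[OF IH(1) j] scopes_trans[OF IH(2) elementary_step[OF IH(1) j]] by simp
  qed
  then show ?thesis using js(2) by simp
qed

section \<open>Core blocks with the same moving vector\<close>

text \<open>
  All members of a block share one vector \<open>cvec\<close>; only its entries below \<open>e\<close> are meaningful.
\<close>

definition has_cvec where
  "has_cvec B c \<longleftrightarrow> is_core B \<and> (\<forall>lam. lies_in e q r lam B \<longrightarrow> (\<forall>b<e. cvec lam b = c b))"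

lemma core_has_cvec:
  assumes "is_core B" "lies_in e q r lam B"
  shows "has_cvec B (cvec lam)"
proof -
  have "B \<in> blocks e q r" using assms(1) by (simp add: core_block_def)
  then show ?thesis using same_block[OF _ assms(2) w0] assms(1) unfolding has_cvec_def by simp
qed

text \<open>
  With respect to any \<open>w\<close>, the members of a core block form pairs as in \<open>tight_pair\<close>; exchanging
  the components only negates the differences. Consequently \<open>h - l\<close> is determined by \<open>cvec\<close> and
  the charge, and as one of \<open>h\<close>, \<open>l\<close> vanishes, so are the weight and the moving vector.
\<close>

lemma core_pair_data:
  assumes B: "is_core B" and lam: "lies_in e q r lam B"
    and w: "w \<in> ext_affine_weyl 2" "charge_act e r w \<in> closed_alcove e 2"
  shows "\<exists>h l. (h = 0 \<or> l = 0) \<and> weight w lam = h + l \<and>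
    moving_vector e (mp_act lam w) (charge_act e r w) = [h, l] \<and>
    int (card {b. b < e \<and> odd (cvec lam b + sum_list (snd w))}) =
      charge_act e r w ! 1 - charge_act e r w ! 0 + 2 * (int h - int l)"
proof -
  note m = lies_in_mp[OF lam]
  note bs = betas_beta_set[OF m w(1)]
  have len_lam: "length lam = 2" using m by (simp add: multipartitions_def)
  have len2: "length (charge_act e r w) = 2" "length (mp_act lam w) = 2" using act[OF m w(1)] by auto
  note ct = list2_eq[OF len2(1), symmetric] and mt = list2_eq[OF len2(2), symmetric]
  have "[charge_act e r w ! 0, charge_act e r w ! 1] \<in> closed_alcove e 2" using w(2) by (simp only: ct)
  then have alcove: "charge (betas w lam 0) \<le> charge (betas w lam 1)"
      "charge (betas w lam 1) \<le> charge (betas w lam 0) + int e"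
    unfolding bs by (simp_all add: closed_alcove_def)
  obtain \<sigma> u0 u1 where w': "w = (\<sigma>, [u0, u1])" "\<sigma> = id \<or> \<sigma> = Transposition.transpose 0 1"
    using weyl2_cases[OF w(1)] .
  define x y where "x = (\<lambda>b. (if \<sigma> = id then xvec lam b else yvec lam b) + u0)"
    and "y = (\<lambda>b. (if \<sigma> = id then yvec lam b else xvec lam b) + u1)"
  have run: "runner e (betas w lam 0) b = {..<x b}" "runner e (betas w lam 1) b = {..<y b}" if "b < e" for b
    using w'(2) core_runners[OF B lam that] runner_beta_shift[of _ _ b]
    unfolding w'(1) betas_def x_def y_def
    by (auto simp: weyl2_charge_act[OF len] weyl2_mp_act[OF len_lam] simp del: One_nat_def)
  have spread: "(x a - y a) - (x b - y b) \<le> 2" if "a < e" "b < e" for a b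
    using core_spread[OF B lam that] core_spread[OF B lam that(2,1)] by (auto simp: x_def y_def dvec_def)
  interpret tight_pair e "betas w lam 0" "betas w lam 1" x y
    by unfold_locales (use e0 bs run spread alcove in auto)
  have "x b + y b = cvec lam b + sum_list (snd w)" for b
    by (auto simp: x_def y_def w'(1) cvec_def)
  then have "int (card {b. b < e \<and> odd (cvec lam b + sum_list (snd w))}) =
      charge_act e r w ! 1 - charge_act e r w ! 0 + 2 * (int high - int low)"
    using card_odd unfolding bs by simp
  moreover have "moving_vector e (mp_act lam w) (charge_act e r w) = [high, low]"
    using moving_vector[of "charge_act e r w ! 0" "mp_act lam w ! 0" "charge_act e r w ! 1" "mp_act lam w ! 1"]
    unfolding betas_def ct mt by simp
  ultimately show ?thesis using high_low pair_wt unfolding weight_def by blast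
qed

lemma has_cvec_unique:
  assumes "has_cvec B c" "has_cvec B' c"
  shows "B = B'"
proof -
  have core: "is_core B" "is_core B'" using assms by (auto simp: has_cvec_def)
  then have Bb: "B \<in> blocks e q r" "B' \<in> blocks e q r" by (auto simp: core_block_def)
  obtain lam lam' where lam: "lies_in e q r lam B" and lam': "lies_in e q r lam' B'"
    using inhabited[OF Bb(1)] inhabited[OF Bb(2)] by blast
  have c: "cvec lam b = cvec lam' b" if "b < e" for b
    using assms lam lam' that unfolding has_cvec_def by simp
  then have "{b. b < e \<and> odd (cvec lam b + s)} = {b. b < e \<and> odd (cvec lam' b + s)}" for s by auto
  then have "weight w0 lam = weight w0 lam'"
    using core_pair_data[OF core(1) lam w0] core_pair_data[OF core(2) lam' w0] by force
  then have "lies_in e q r lam' B"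
    using same_block[OF Bb(1) lam w0] c lies_in_mp[OF lam'] by simp
  then show ?thesis using lies_in_unique[OF Bb _ lam'] by blast
qed

lemma has_cvec_step:
  assumes "has_cvec B c" "swap_step e c c'"
  shows "\<exists>B'. has_cvec B' c' \<and> scopes_equivalent e q r B B'"
proof -
  have core: "is_core B" and Bb: "B \<in> blocks e q r"
    using assms(1) by (auto simp: has_cvec_def core_block_def)
  obtain j where j: "j < e" "\<And>i. i < e \<Longrightarrow> c' i = swap_charge e j c i"
    using assms(2) by (auto simp: swap_step_def)
  have "cvec lam b = c' b" if lam: "lies_in e q r lam (block_refl e q r j B)" and b: "b < e" for lam b
  proof -
    have m: "lam \<in> multipartitions 2" "lies_in e q r (refl_mp j lam) B"
      using block_refl(2)[OF Bb j(1)] lam by auto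
    have "cvec lam b = swap_charge e j (cvec (refl_mp j lam)) b"
      using refl_mp(2)[OF m(1) j(1)] refl_mp(3)[OF refl_mp(1)[OF m(1) j(1)] j(1) b] by simp
    also have "\<dots> = swap_charge e j c b"
      using assms(1) m(2) b j(1) pred_runner[OF e j(1)] by (simp add: has_cvec_def swap_charge_def)
    finally show ?thesis using j(2)[OF b] by simp
  qed
  then have "has_cvec (block_refl e q r j B) c'"
    using core_block_refl[OF core j(1)] by (simp add: has_cvec_def)
  then show ?thesis using elementary_step[OF core j(1)] by blast
qed

lemma has_cvec_steps:
  assumes "(swap_step e)\<^sup>*\<^sup>* c c'" "has_cvec B c"
  shows "\<exists>B'. has_cvec B' c' \<and> scopes_equivalent e q r B B'"
  using assms(1)
proof induction
  case base
  have "scopes_equivalent e q r B B" by (simp add: scopes_equivalent_def)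
  then show ?case using assms(2) by blast
next
  case (step c1 c2)
  then obtain B1 where B1: "has_cvec B1 c1" "scopes_equivalent e q r B B1" by blast
  then show ?case using has_cvec_step[OF B1(1) step(2)] scopes_trans[OF B1(2)] by blast
qed

lemma sum_cvec:
  assumes "lam \<in> multipartitions 2"
  shows "(\<Sum>b<e. cvec lam b) = r ! 0 + r ! 1"
  using part[OF assms] charge_sum_runners[OF e0 beta_set_beta, of "lam ! 0" "r ! 0"]
    charge_sum_runners[OF e0 beta_set_beta, of "lam ! 1" "r ! 1"]
  by (simp add: cvec_def xvec_def yvec_def rcharge_def sum.distrib charge_beta)

text \<open>
  The constant by which \<open>w\<close> shifts \<open>cvec\<close> depends on the charge \<open>r\<^sup>w\<close> alone, even if several
  \<open>w\<close> lead to it.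
\<close>

lemma shift_sum:
  assumes w: "w \<in> ext_affine_weyl 2"
  shows "int e * sum_list (snd w) = charge_act e r w ! 0 + charge_act e r w ! 1 - r ! 0 - r ! 1"
proof -
  have "[\<lambda>_. 0, \<lambda>_. 0] \<in> multipartitions 2"
    by (simp add: multipartitions2_iff is_partition_def antimono_def)
  from act[OF this w] show ?thesis by (auto simp: algebra_simps)
qed

lemma core_moving_vector:
  assumes B: "is_core B" and lam: "lies_in e q r lam B"
    and w: "w \<in> ext_affine_weyl 2" "charge_act e r w \<in> closed_alcove e 2"
  shows "block_moving_vector e q r (charge_act e r w) B =
    moving_vector e (mp_act lam w) (charge_act e r w)"
  unfolding block_moving_vector_def len
proof (rule the_equality)
  show "\<forall>lam' w'. lies_in e q r lam' B \<and> w' \<in> ext_affine_weyl 2 \<and> charge_act e r w' = charge_act e r w \<longrightarrow>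
    moving_vector e (mp_act lam' w') (charge_act e r w') = moving_vector e (mp_act lam w) (charge_act e r w)"
  proof (intro allI impI)
    fix lam' w'
    assume *: "lies_in e q r lam' B \<and> w' \<in> ext_affine_weyl 2 \<and> charge_act e r w' = charge_act e r w"
    then have "int e * sum_list (snd w') = int e * sum_list (snd w)" using shift_sum w(1) by simp
    then have s: "sum_list (snd w') = sum_list (snd w)" using e by simp
    have "cvec lam' b = cvec lam b" if "b < e" for b
      using core_has_cvec[OF B lam] * that by (simp add: has_cvec_def)
    then have "{b. b < e \<and> odd (cvec lam' b + s)} = {b. b < e \<and> odd (cvec lam b + s)}" for s by auto
    then show "moving_vector e (mp_act lam' w') (charge_act e r w') =
        moving_vector e (mp_act lam w) (charge_act e r w)"
      using core_pair_data[OF B lam w] core_pair_data[OF B, of lam' w'] * w(2) s by fastforce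
  qed
next
  fix v
  assume "\<forall>lam w'. lies_in e q r lam B \<and> w' \<in> ext_affine_weyl 2 \<and> charge_act e r w' = charge_act e r w \<longrightarrow>
    moving_vector e (mp_act lam w') (charge_act e r w') = v"
  then show "v = moving_vector e (mp_act lam w) (charge_act e r w)" using lam w(1) by blast
qed

text \<open>
  The moving vector gives the number of odd entries of the shifted vector \<open>cvec\<close>, hence that of
  \<open>cvec\<close> itself. So the two vectors are joined by reflections, each of which is a Scopes
  equivalence or fixes the block, and the core block reached in this way is the given one.
\<close>

theorem moving_vector_scopes_equivalent:
  assumes r': "r' \<in> charge_orbit e r" "r' \<in> closed_alcove e 2"
    and B: "is_core B" "is_core B'"
    and mv: "block_moving_vector e q r r' B = block_moving_vector e q r r' B'"
  shows "scopes_equivalent e q r B B'"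
proof -
  obtain w where w: "w \<in> ext_affine_weyl 2" "r' = charge_act e r w"
    using r'(1) by (auto simp: charge_orbit_def len)
  note w_alc = r'(2)[unfolded w(2)]
  obtain lam lam' where lam: "lies_in e q r lam B" and lam': "lies_in e q r lam' B'"
    using inhabited B unfolding core_block_def by metis
  define s where "s = sum_list (snd w)"
  have odd_eq: "card {b. b < e \<and> odd (cvec lam b + s)} = card {b. b < e \<and> odd (cvec lam' b + s)}"
    using core_pair_data[OF B(1) lam w(1) w_alc] core_pair_data[OF B(2) lam' w(1) w_alc] mv
      core_moving_vector[OF B(1) lam w(1) w_alc] core_moving_vector[OF B(2) lam' w(1) w_alc]
    unfolding w(2) s_def by force
  have "card {b. b < e \<and> odd (cvec lam b)} = card {b. b < e \<and> odd (cvec lam' b)}"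
  proof (cases "even s")
    case True
    then show ?thesis using odd_eq by simp
  next
    case False
    have compl: "card {b. b < e \<and> odd (c b)} = e - card {b. b < e \<and> odd (c b + s)}" for c :: "nat \<Rightarrow> int"
    proof -
      have "{b. b < e \<and> odd (c b)} = {..<e} - {b. b < e \<and> odd (c b + s)}" using False by auto
      then show ?thesis by (simp add: card_Diff_subset subset_eq)
    qed
    show ?thesis by (simp only: compl[of "cvec lam"] compl[of "cvec lam'"] odd_eq)
  qed
  then have "(swap_step e)\<^sup>*\<^sup>* (cvec lam) (cvec lam')"
    using sum_cvec lies_in_mp[OF lam] lies_in_mp[OF lam'] by (intro swap_step_connected[OF e]) auto
  then obtain B1 where B1: "has_cvec B1 (cvec lam')" "scopes_equivalent e q r B B1"
    using has_cvec_steps core_has_cvec[OF B(1) lam] by blast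
  moreover have "B1 = B'" using has_cvec_unique[OF B1(1) core_has_cvec[OF B(2) lam']] .
  ultimately show ?thesis by simp
qed

end

theorem corollary4p26:
  fixes e :: nat and q :: "'f::field" and r :: "int list"
  assumes "e \<ge> 2"
    and "length r = 2"
    and "if e = CHAR('f) then q = 1 else q ^ e = 1 \<and> (\<forall>k. 0 < k \<and> k < e \<longrightarrow> q ^ k \<noteq> 1)"
    and known_block_classification:
      "\<And>lam mu w. \<lbrakk>lam \<in> multipartitions 2; mu \<in> multipartitions 2;
          w \<in> ext_affine_weyl 2; charge_act e r w \<in> closed_alcove e 2\<rbrakk> \<Longrightarrow>
        (\<exists>B \<in> blocks e q r. lies_in e q r lam B \<and> lies_in e q r mu B) \<longleftrightarrow>
        beta_inv (mcore e (mp_act lam w) (charge_act e r w)) =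
          beta_inv (mcore e (mp_act mu w) (charge_act e r w)) \<and>
        mwt e (mp_act lam w) (charge_act e r w) = mwt e (mp_act mu w) (charge_act e r w)"
  shows "(\<forall>B B'. core_block e q r B \<and> core_block e q r B' \<and> B' \<in> weyl_orbit e q r B
            \<longrightarrow> scopes_equivalent e q r B B') \<and>
         (\<forall>r' \<in> charge_orbit e r \<inter> closed_alcove e 2. \<forall>B B'.
            core_block e q r B \<and> core_block e q r B' \<and>
            block_moving_vector e q r r' B = block_moving_vector e q r r' B'
            \<longrightarrow> scopes_equivalent e q r B B')"
proof -
  interpret two_charge_blocks e q r
    by unfold_locales (use assms in blast)+
  show ?thesis using orbit_scopes_equivalent moving_vector_scopes_equivalent by blast
qed

end
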